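(* Let $d\in\mathbb N$ and $\mathbb S_d^1=\{(\lambda,\lambda^2,\dots,\lambda^d)\in\mathbb C^d : \lambda\in S^1\}$, where $S^1$ is the unit circle in $\mathbb C$. The matrix convex set $\left(\mathrm{Conv}(\mathbb S_d^1)\right)^{\rm min}$ has Smith-Ward geometry, and it consists of all $d$-tuples $\mathfrak x=(x_1,\dots,x_d)$ of complex $n\times n$ matrices ($n\in\mathbb N$) for which the $(d+1)\times(d+1)$ block-Toeplitz matrix $$T_{\mathfrak x}=\begin{bmatrix}1&x_1^*&x_2^*&\dots&x_d^*\\ x_1&1&x_1^*&\ddots&\vdots\\ x_2&\ddots&\ddots&\ddots&x_2^*\\ \vdots&\ddots&\ddots&\ddots&x_1^*\\ x_d&\dots&x_2&x_1&1\end{bmatrix}$$ is a positive (semidefinite) matrix.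
   Context: $\mathbb B$ is the C$^*$-algebra of bounded linear operators on $\ell^2(\mathbb N)$ and $\mathbb K$ is the ideal of compact operators. $\mathrm{Conv}$ denotes convex hull. For a $d$-tuple $\mathfrak x$ of elements of a unital C$^*$-algebra, $\mathcal O_{\mathfrak x}=\mathrm{Span}\{1,x_1,x_1^*,\dots,x_d,x_d^*\}$. The matrix range is $W(\mathfrak x)=\bigsqcup_n W_n(\mathfrak x)$, $W_n(\mathfrak x)=\{(\phi(x_1),\dots,\phi(x_d)) : \phi:\mathrm C^*(\mathcal O_{\mathfrak x})\to M_n(\mathbb C)\text{ unital completely positive}\}$. For $\mathfrak x\in\mathbb B^d$, the essential matrix range $W_{\rm e}(\mathfrak x)=\bigsqcup_n W_{n,{\rm e}}(\mathfrak x)$ is defined in the same way but using only those $\phi$ that vanish on every compact operator in $\mathrm C^*(\mathcal O_{\mathfrak x})$; it equals the matrix range of the image of $\mathfrak x$ in $\mathbb B/\mathbb K$. For a compact convex set $K\subseteq\mathbb C^d$, $K^{\rm min}=\bigsqcup_nK_n^{\rm min}$, where $K_n^{\rm min}$ is the set of $d$-tuples $(a_1,\dots,a_d)$ of $n\times n$ matrices for which there are positive $h_1,\dots,h_m\in M_n(\mathbb C)$ and $\lambda_j=(\lambda_{j1},\dots,\lambda_{jd})\in K$ with $\sum_jh_j=1_n$ and $a_\ell=\sum_j\lambda_{j\ell}h_j$ for all $\ell$. A tuple $\mathfrak x\in\mathbb B^d$ has the Smith-Ward property if $W_{\rm e}(\mathfrak x)=W(\mathfrak x+\mathfrak k)$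 for some $\mathfrak k\in\mathbb K^d$. A compact matrix convex set is a graded set $K_{\rm nc}=\bigsqcup_n K_n$, $K_n\subseteq M_n(\mathbb C)^d$ compact, such that $\sum_{j=1}^m\gamma_j^*\mathfrak a_j\gamma_j\in K_n$ whenever $\mathfrak a_j\in K_{n_j}$ and $\gamma_j:\mathbb C^n\to\mathbb C^{n_j}$ are linear with $\sum_j\gamma_j^*\gamma_j=1_n$. It has Smith-Ward geometry if every tuple $\mathfrak x\in\mathbb B^d$ with $W_{\rm e}(\mathfrak x)=K_{\rm nc}$ has the Smith-Ward property. *)

theory Defs
  imports "HOL-Analysis.Analysis" "Jordan_Normal_Form.Schur_Decomposition"
begin

(* Both HOL-Analysis and Jordan_Normal_Form define vec; here vec, mat and $ are those of
   Jordan_Normal_Form. *)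
hide_type (open) Finite_Cartesian_Product.vec
hide_const (open) Finite_Cartesian_Product.vec Finite_Cartesian_Product.mat
  Determinants.det Finite_Cartesian_Product.row Finite_Cartesian_Product.column
unbundle no vec_syntax


section \<open>The complex Hilbert space \<open>\<ell>\<^sup>2(\<nat>)\<close>\<close>

typedef ell2 = "{x :: nat \<Rightarrow> complex. summable (\<lambda>n. (cmod (x n))\<^sup>2)}"
  morphisms ell2_coord Abs_ell2
  by (intro exI[of _ "\<lambda>_. 0"]) simp

setup_lifting type_definition_ell2

lemma ell2_mult_summable:
  assumes "summable (\<lambda>n. (cmod (x n))\<^sup>2)" "summable (\<lambda>n. (cmod (y n))\<^sup>2)"
  shows "summable (\<lambda>n. cmod (x n) * cmod (y n))"
proof (rule summable_comparison_test')
  show "summable (\<lambda>n. (cmod (x n))\<^sup>2 + (cmod (y n))\<^sup>2)"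
    using assms by (rule summable_add)
  fix n :: nat
  have "2 * (cmod (x n) * cmod (y n)) \<le> (cmod (x n))\<^sup>2 + (cmod (y n))\<^sup>2"
    using sum_squares_bound[of "cmod (x n)" "cmod (y n)"] by (simp add: mult.assoc)
  moreover have "0 \<le> cmod (x n) * cmod (y n)" by simp
  ultimately show "norm (cmod (x n) * cmod (y n)) \<le> (cmod (x n))\<^sup>2 + (cmod (y n))\<^sup>2"
    by (simp only: real_norm_def abs_of_nonneg)
qed

lemma ell2_add_closed:
  assumes "summable (\<lambda>n. (cmod (x n))\<^sup>2)" "summable (\<lambda>n. (cmod (y n))\<^sup>2)"
  shows "summable (\<lambda>n. (cmod (x n + y n))\<^sup>2)"
proof (rule summable_comparison_test')
  show "summable (\<lambda>n. (cmod (x n))\<^sup>2 + (cmod (y n))\<^sup>2 + 2 * (cmod (x n) * cmod (y n)))"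
    using assms by (intro summable_add summable_mult ell2_mult_summable)
  fix n :: nat
  have "(cmod (x n + y n))\<^sup>2 \<le> (cmod (x n) + cmod (y n))\<^sup>2"
    by (simp add: norm_triangle_ineq power_mono)
  then show "norm ((cmod (x n + y n))\<^sup>2)
      \<le> (cmod (x n))\<^sup>2 + (cmod (y n))\<^sup>2 + 2 * (cmod (x n) * cmod (y n))"
    by (simp add: power2_sum)
qed

lemma ell2_scale_closed:
  assumes "summable (\<lambda>n. (cmod (x n))\<^sup>2)"
  shows "summable (\<lambda>n. (cmod (c * x n))\<^sup>2)"
  using summable_mult[OF assms, of "(cmod c)\<^sup>2"] by (simp add: norm_mult power_mult_distrib)

lift_definition ell2_scale :: "complex \<Rightarrow> ell2 \<Rightarrow> ell2" (infixr \<open>*\<^sub>\<ell>\<close> 75)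
  is "\<lambda>c x n. c * x n"
  by (rule ell2_scale_closed)

lift_definition ell2_cinner :: "ell2 \<Rightarrow> ell2 \<Rightarrow> complex"
  is "\<lambda>x y. \<Sum>n. x n * cnj (y n)" .

lemma ell2_coord_summable: "summable (\<lambda>n. (cmod (ell2_coord x n))\<^sup>2)"
  using ell2_coord[of x] by (rule CollectD)

lemma ell2_cinner_summable: "summable (\<lambda>n. ell2_coord x n * cnj (ell2_coord y n))"
proof (rule summable_norm_cancel)
  show "summable (\<lambda>n. cmod (ell2_coord x n * cnj (ell2_coord y n)))"
    unfolding norm_mult complex_mod_cnj
    by (rule ell2_mult_summable[OF ell2_coord_summable ell2_coord_summable])
qed

instantiation ell2 :: real_inner
begin

lift_definition zero_ell2 :: ell2 is "\<lambda>_. 0" by simp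
lift_definition plus_ell2 :: "ell2 \<Rightarrow> ell2 \<Rightarrow> ell2" is "\<lambda>x y n. x n + y n"
  by (rule ell2_add_closed)
lift_definition uminus_ell2 :: "ell2 \<Rightarrow> ell2" is "\<lambda>x n. - x n" by simp
definition minus_ell2 :: "ell2 \<Rightarrow> ell2 \<Rightarrow> ell2" where "minus_ell2 x y = x + - y"
definition scaleR_ell2 :: "real \<Rightarrow> ell2 \<Rightarrow> ell2" where
  "scaleR_ell2 r x = complex_of_real r *\<^sub>\<ell> x"
definition inner_ell2 :: "ell2 \<Rightarrow> ell2 \<Rightarrow> real" where
  "inner_ell2 x y = Re (ell2_cinner x y)"
definition norm_ell2 :: "ell2 \<Rightarrow> real" where "norm_ell2 x = sqrt (inner x x)"
definition dist_ell2 :: "ell2 \<Rightarrow> ell2 \<Rightarrow> real" where "dist_ell2 x y = norm (x - y)"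
definition sgn_ell2 :: "ell2 \<Rightarrow> ell2" where "sgn_ell2 x = inverse (norm x) *\<^sub>R x"
definition uniformity_ell2 :: "(ell2 \<times> ell2) filter" where
  "uniformity_ell2 = (INF e\<in>{0<..}. principal {(x, y). dist x y < e})"
definition open_ell2 :: "ell2 set \<Rightarrow> bool" where
  "open_ell2 U \<longleftrightarrow> (\<forall>x\<in>U. eventually (\<lambda>(x', y). x' = x \<longrightarrow> y \<in> U) uniformity)"

instance
proof
  fix x y z :: ell2 and r s :: real
  show "x + y + z = x + (y + z)" by transfer (simp add: add.assoc)
  show "x + y = y + x" by transfer (simp add: add.commute)
  show "0 + x = x" by transfer simp
  show "- x + x = 0" by transfer simp
  show "x - y = x + - y" by (simp add: minus_ell2_def)
  show "r *\<^sub>R (x + y) = r *\<^sub>R x + r *\<^sub>R y"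
    unfolding scaleR_ell2_def by transfer (simp add: algebra_simps)
  show "(r + s) *\<^sub>R x = r *\<^sub>R x + s *\<^sub>R x"
    unfolding scaleR_ell2_def by transfer (simp add: algebra_simps)
  show "r *\<^sub>R s *\<^sub>R x = (r * s) *\<^sub>R x"
    unfolding scaleR_ell2_def by transfer (simp add: algebra_simps)
  show "1 *\<^sub>R x = x" unfolding scaleR_ell2_def by transfer simp
  show "dist x y = norm (x - y)" by (simp add: dist_ell2_def)
  show "sgn x = inverse (norm x) *\<^sub>R x" by (simp add: sgn_ell2_def)
  show "uniformity = (INF e\<in>{0<..}. principal {(x, y :: ell2). dist x y < e})"
    by (simp add: uniformity_ell2_def)
  show "open U \<longleftrightarrow> (\<forall>x\<in>U. eventually (\<lambda>(x', y). x' = x \<longrightarrow> y \<in> U) uniformity)"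
    for U :: "ell2 set" by (simp add: open_ell2_def)
  have inner_eq: "inner a b = (\<Sum>n. Re (ell2_coord a n * cnj (ell2_coord b n)))" for a b
    unfolding inner_ell2_def ell2_cinner.rep_eq
    by (rule bounded_linear.suminf[OF bounded_linear_Re ell2_cinner_summable])
  have sumRe: "summable (\<lambda>n. Re (ell2_coord a n * cnj (ell2_coord b n)))" for a b
    by (rule bounded_linear.summable[OF bounded_linear_Re ell2_cinner_summable])
  show "inner x y = inner y x" unfolding inner_eq by (simp add: mult.commute)
  show "inner (x + y) z = inner x z + inner y z"
    unfolding inner_eq
    by (subst suminf_add[OF sumRe sumRe]) (simp add: plus_ell2.rep_eq algebra_simps)
  show "inner (r *\<^sub>R x) y = r * inner x y"
    unfolding inner_eq
    by (subst suminf_mult[OF sumRe, symmetric])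
      (simp add: scaleR_ell2_def ell2_scale.rep_eq algebra_simps)
  have sq: "Re (ell2_coord x n * cnj (ell2_coord x n)) = (cmod (ell2_coord x n))\<^sup>2" for n
    by (simp add: complex_mult_cnj cmod_power2)
  show "0 \<le> inner x x" unfolding inner_eq sq by (rule suminf_nonneg) (simp_all add: ell2_coord_summable)
  have "inner x x = 0 \<longleftrightarrow> (\<forall>n. ell2_coord x n = 0)"
    unfolding inner_eq sq by (subst suminf_eq_zero_iff) (simp_all add: ell2_coord_summable)
  also have "\<dots> \<longleftrightarrow> x = 0" by transfer auto
  finally show "inner x x = 0 \<longleftrightarrow> x = 0" .
  show "norm x = sqrt (inner x x)" by (simp add: norm_ell2_def)
qed

end

lemma norm_ell2_scale: "norm (c *\<^sub>\<ell> x) = cmod c * norm x"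
proof -
  have "ell2_cinner (c *\<^sub>\<ell> x) (c *\<^sub>\<ell> x)
      = (\<Sum>n. complex_of_real ((cmod c)\<^sup>2) * (ell2_coord x n * cnj (ell2_coord x n)))"
    by (simp add: ell2_cinner.rep_eq ell2_scale.rep_eq complex_norm_square algebra_simps
        del: of_real_power)
  also have "\<dots> = complex_of_real ((cmod c)\<^sup>2) * ell2_cinner x x"
    by (simp add: suminf_mult ell2_cinner_summable ell2_cinner.rep_eq)
  finally have "ell2_cinner (c *\<^sub>\<ell> x) (c *\<^sub>\<ell> x) = complex_of_real ((cmod c)\<^sup>2) * ell2_cinner x x" .
  then have "Re (ell2_cinner (c *\<^sub>\<ell> x) (c *\<^sub>\<ell> x)) = (cmod c)\<^sup>2 * Re (ell2_cinner x x)"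
    by (simp only: Re_complex_of_real Im_complex_of_real times_complex.sel)
  then show ?thesis
    unfolding norm_ell2_def inner_ell2_def by (simp only: real_sqrt_mult real_sqrt_abs abs_norm_cancel)
qed

lemma bounded_linear_ell2_scale: "bounded_linear (ell2_scale c)"
proof (rule bounded_linear_intro[where K = "cmod c"])
  fix x y :: ell2 and r :: real
  show "c *\<^sub>\<ell> (x + y) = c *\<^sub>\<ell> x + c *\<^sub>\<ell> y" by transfer (simp add: algebra_simps)
  show "c *\<^sub>\<ell> (r *\<^sub>R x) = r *\<^sub>R (c *\<^sub>\<ell> x)"
    unfolding scaleR_ell2_def by transfer (simp add: algebra_simps)
  show "norm (c *\<^sub>\<ell> x) \<le> norm x * cmod c" by (simp add: norm_ell2_scale)
qed


section \<open>Operators on \<open>\<ell>\<^sup>2(\<nat>)\<close>\<close>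

type_synonym op = "ell2 \<Rightarrow>\<^sub>L ell2"

(* The type op consists of the bounded real-linear maps, with the operator norm. *)
definition BB :: "op set" where
  "BB = {A. \<forall>c v. blinfun_apply A (c *\<^sub>\<ell> v) = c *\<^sub>\<ell> blinfun_apply A v}"

definition KK :: "op set" where
  "KK = {A \<in> BB. compact (closure (blinfun_apply A ` cball 0 1))}"

definition op_scale :: "complex \<Rightarrow> op \<Rightarrow> op" where
  "op_scale c A = Blinfun (\<lambda>v. c *\<^sub>\<ell> blinfun_apply A v)"

lemma op_scale_apply: "blinfun_apply (op_scale c A) v = c *\<^sub>\<ell> blinfun_apply A v"
  unfolding op_scale_def
  by (subst bounded_linear_Blinfun_apply)
    (rule bounded_linear_compose[OF bounded_linear_ell2_scale blinfun.bounded_linear_right], rule refl)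

(* Meaningful for A in BB, where the Hilbert space adjoint exists and is unique. *)
definition op_adj :: "op \<Rightarrow> op" where
  "op_adj A = (THE B. \<forall>v w. ell2_cinner (blinfun_apply A v) w = ell2_cinner v (blinfun_apply B w))"

interpretation op: vector_space op_scale
proof
  fix a b :: complex and A B :: op
  show "op_scale a (A + B) = op_scale a A + op_scale a B"
    by (rule blinfun_eqI) (simp add: op_scale_apply blinfun.add_left
        linear_add[OF bounded_linear.linear[OF bounded_linear_ell2_scale]])
  show "op_scale (a + b) A = op_scale a A + op_scale b A"
    by (rule blinfun_eqI) (simp add: op_scale_apply blinfun.add_left,
        transfer, simp add: algebra_simps)
  show "op_scale a (op_scale b A) = op_scale (a * b) A"
    by (rule blinfun_eqI) (simp add: op_scale_apply, transfer, simp add: algebra_simps)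
  show "op_scale 1 A = A"
    by (rule blinfun_eqI) (simp add: op_scale_apply, transfer, simp)
qed

(* A d-tuple (x_1, ..., x_d) is a list of length d, so that x_l is the entry xs ! (l - 1). *)

definition op_system :: "op list \<Rightarrow> op set" where
  "op_system xs = op.span ({id_blinfun} \<union> set xs \<union> op_adj ` set xs)"

definition is_cstar_subalgebra :: "op set \<Rightarrow> bool" where
  "is_cstar_subalgebra A \<longleftrightarrow> A \<subseteq> BB \<and> closed A \<and> op.subspace A
     \<and> (\<forall>a\<in>A. \<forall>b\<in>A. a o\<^sub>L b \<in> A) \<and> (\<forall>a\<in>A. op_adj a \<in> A)"

definition cstar :: "op set \<Rightarrow> op set" where
  "cstar S = \<Inter>{A. is_cstar_subalgebra A \<and> S \<subseteq> A}"


section \<open>Matrices and unital completely positive maps\<close>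

(* The order on complex is that of HOL-Library.Complex_Order: 0 \<le> z means that z is real and
   nonnegative. So a psd matrix is self-adjoint. *)
definition psd :: "nat \<Rightarrow> complex mat \<Rightarrow> bool" where
  "psd n A \<longleftrightarrow> A \<in> carrier_mat n n \<and> (\<forall>v\<in>carrier_vec n. 0 \<le> (A *\<^sub>v v) \<bullet>c v)"

definition block_mat :: "nat \<Rightarrow> nat \<Rightarrow> (nat \<Rightarrow> nat \<Rightarrow> complex mat) \<Rightarrow> complex mat" where
  "block_mat k n a = mat (k * n) (k * n) (\<lambda>(r, s). a (r div n) (s div n) $$ (r mod n, s mod n))"

definition mat_sum :: "nat \<Rightarrow> nat \<Rightarrow> (nat \<Rightarrow> complex mat) \<Rightarrow> complex mat" where
  "mat_sum n m h = mat n n (\<lambda>(r, s). \<Sum>j<m. h j $$ (r, s))"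

(* Positivity of (a i j) as an operator on the direct sum of k copies of \<ell>\<^sup>2. For entries in a
   C*-subalgebra A of BB this is positivity in the C*-algebra M_k(A). *)
definition op_block_psd :: "nat \<Rightarrow> (nat \<Rightarrow> nat \<Rightarrow> op) \<Rightarrow> bool" where
  "op_block_psd k a \<longleftrightarrow>
     (\<forall>v :: nat \<Rightarrow> ell2. 0 \<le> (\<Sum>i<k. \<Sum>j<k. ell2_cinner (blinfun_apply (a i j) (v j)) (v i)))"

(* Only the values of \<phi> on A are constrained. *)
definition ucp :: "op set \<Rightarrow> nat \<Rightarrow> (op \<Rightarrow> complex mat) \<Rightarrow> bool" where
  "ucp A n \<phi> \<longleftrightarrow>
     (\<forall>a\<in>A. \<phi> a \<in> carrier_mat n n)
     \<and> (\<forall>a\<in>A. \<forall>b\<in>A. \<phi> (a + b) = \<phi> a + \<phi> b)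
     \<and> (\<forall>c. \<forall>a\<in>A. \<phi> (op_scale c a) = c \<cdot>\<^sub>m \<phi> a)
     \<and> \<phi> id_blinfun = 1\<^sub>m n
     \<and> (\<forall>k a. (\<forall>i<k. \<forall>j<k. a i j \<in> A) \<longrightarrow> op_block_psd k a
          \<longrightarrow> psd (k * n) (block_mat k n (\<lambda>i j. \<phi> (a i j))))"


section \<open>Matrix ranges and matrix convex sets\<close>

(* A graded set, i.e. a disjoint union of levels K_n over n \<ge> 1, is a set of pairs (n, tuple). *)
type_synonym graded = "(nat \<times> complex mat list) set"

definition mat_tuples :: "nat \<Rightarrow> nat \<Rightarrow> complex mat list set" where
  "mat_tuples d n = {as. length as = d \<and> set as \<subseteq> carrier_mat n n}"

definition matrix_range :: "op list \<Rightarrow> graded" where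
  "matrix_range xs = (SIGMA n:{1..}. {map \<phi> xs |\<phi>. ucp (cstar (op_system xs)) n \<phi>})"

definition ess_matrix_range :: "op list \<Rightarrow> graded" where
  "ess_matrix_range xs = (SIGMA n:{1..}. {map \<phi> xs |\<phi>. ucp (cstar (op_system xs)) n \<phi>
     \<and> (\<forall>a \<in> cstar (op_system xs) \<inter> KK. \<phi> a = 0\<^sub>m n n)})"

definition smith_ward_property :: "op list \<Rightarrow> bool" where
  "smith_ward_property xs \<longleftrightarrow>
     (\<exists>ks. length ks = length xs \<and> set ks \<subseteq> KK
        \<and> ess_matrix_range xs = matrix_range (map2 (+) xs ks))"

(* Topology of M_n(C)^d: the entries embed it homeomorphically into a product of copies of the
   complex numbers, which carries the product topology. *)
definition tuple_entries :: "nat \<Rightarrow> nat \<Rightarrow> complex mat list \<Rightarrow> (nat \<Rightarrow> nat \<Rightarrow> nat \<Rightarrow> complex)" where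
  "tuple_entries d n as = (\<lambda>l r s. if l < d \<and> r < n \<and> s < n then (as ! l) $$ (r, s) else 0)"

definition compact_matrix_convex :: "nat \<Rightarrow> graded \<Rightarrow> bool" where
  "compact_matrix_convex d K \<longleftrightarrow>
     K \<subseteq> (SIGMA n:{1..}. mat_tuples d n)
     \<and> (\<forall>n\<ge>1. compact (tuple_entries d n ` (K `` {n})))
     \<and> (\<forall>n\<ge>1. \<forall>m nn aa \<gamma>.
          (\<forall>j<m. (nn j, aa j) \<in> K \<and> \<gamma> j \<in> carrier_mat (nn j) n)
          \<and> mat_sum n m (\<lambda>j. mat_adjoint (\<gamma> j) * \<gamma> j) = 1\<^sub>m n
          \<longrightarrow> (n, map (\<lambda>l. mat_sum n m (\<lambda>j. mat_adjoint (\<gamma> j) * (aa j ! l) * \<gamma> j)) [0..<d]) \<in> K)"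

definition smith_ward_geometry :: "nat \<Rightarrow> graded \<Rightarrow> bool" where
  "smith_ward_geometry d K \<longleftrightarrow>
     (\<forall>xs. length xs = d \<and> set xs \<subseteq> BB \<and> ess_matrix_range xs = K \<longrightarrow> smith_ward_property xs)"

definition conv_tuples :: "nat \<Rightarrow> complex list set \<Rightarrow> complex list set" where
  "conv_tuples d S = {v. \<exists>(m :: nat) (t :: nat \<Rightarrow> real) p.
     (\<forall>j<m. p j \<in> S \<and> 0 \<le> t j) \<and> (\<Sum>j<m. t j) = 1
     \<and> v = map (\<lambda>l. \<Sum>j<m. complex_of_real (t j) * (p j ! l)) [0..<d]}"

definition min_matrix_convex :: "nat \<Rightarrow> complex list set \<Rightarrow> graded" where
  "min_matrix_convex d K = (SIGMA n:{1..}. {as \<in> mat_tuples d n. \<exists>m h p.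
     (\<forall>j<m. psd n (h j) \<and> p j \<in> K) \<and> mat_sum n m h = 1\<^sub>m n
     \<and> (\<forall>l<d. as ! l = mat_sum n m (\<lambda>j. (p j ! l) \<cdot>\<^sub>m h j))})"

definition circle_curve :: "nat \<Rightarrow> complex list set" where
  "circle_curve d = {map (\<lambda>l. z ^ l) [1..<Suc d] |z. cmod z = 1}"

definition block_toeplitz :: "nat \<Rightarrow> nat \<Rightarrow> complex mat list \<Rightarrow> complex mat" where
  "block_toeplitz d n as = block_mat (Suc d) n
     (\<lambda>i j. if i = j then 1\<^sub>m n
            else if j < i then as ! (i - j - 1)
            else mat_adjoint (as ! (j - i - 1)))"

end

theory Submission
  imports Defs "Jordan_Normal_Form.Spectral_Radius"
begin

text \<open>A tuple of matrices with positive block Toeplitz matrix \<open>T = V\<^sup>*V\<close> is a moment sequence of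
  a positive matrix-valued measure on the circle: the shift of the block columns of \<open>V\<close> extends to a
  unitary matrix, and diagonalizing it gives finitely many nodes and weights. So membership in the
  minimal matrix convex set is the single inequality \<open>T \<ge> 0\<close>, which makes compactness and matrix
  convexity evident.

  For the Smith-Ward property, let \<open>x\<close> have this set as its essential matrix range. Then the Toeplitz
  operator matrix of \<open>x\<close> is positive modulo arbitrarily small errors on the vectors supported far out,
  since otherwise compressions to vectors running off to infinity would produce a matrix state that
  kills the compact operators and violates \<open>T \<ge> 0\<close>. If the Toeplitz form is bounded below by \<open>-e\<close>,
  then averaging \<open>(1 + e)\<^sup>-\<^sup>1 P x P + (1 - P) x (1 - P)\<close> over many coordinate projections \<open>P\<close> of
  rapidly growing rank perturbs \<open>x\<close> by a compact tuple of norm about \<open>e \<parallel>x\<parallel>\<close> and improves the lower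
  bound at will; iterating gives compact \<open>k\<close> with \<open>T \<ge> 0\<close> for \<open>x + k\<close>, hence
  \<open>W(x + k) \<subseteq> W\<^sub>e(x)\<close>. Conversely, a state on \<open>C\<^sup>*(x)\<close> that kills compact operators and sends
  \<open>x\<^sub>1\<close> to a point \<open>z\<close> of the circle forces unit vectors running off to infinity on which \<open>x\<^sub>1\<close> is
  almost \<open>z\<close>; their vector states cluster at a state of all bounded operators that, by \<open>T \<ge> 0\<close>,
  sends \<open>x\<^sub>l + k\<^sub>l\<close> to \<open>z\<^sup>l\<close>. Combining such states with matrix weights gives the other inclusion.\<close>

section \<open>Unitary matrices and normal forms\<close>

text \<open>The algebra generated by \<open>x + k\<close> need not lie in the one generated by
  \<open>x\<close>, so maps cannot simply be restricted from one to the other. Everything is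
  transported by vectors: a failure of positivity, or a value on the circle, is turned into vectors
  supported beyond any given coordinate, and their vector states cluster at maps that are defined on
  all of \<open>BB\<close> and vanish on \<open>KK\<close>; these restrict to either algebra. The
  passage from a state to vectors takes the place of the quotient by the compact operators: a
  self-adjoint element that is nonnegative far out has a compact negative part inside its own
  algebra, so a state that kills compact elements is nonnegative on it. Only the first entry has to
  be followed, because a probability measure on the circle whose mean lies on the circle is a point
  mass, which fixes all higher moments. In the perturbation step a single cut could discard corners
  of norm comparable to that of \<open>x\<close>, which is why many cuts are averaged, and the
  factor \<open>1 / (1 + e)\<close> is what turns the lower bound \<open>- e\<close> on the
  compressed part into 0.\<close>

lemma mat_adjoint_carrier [simp]:
  "A \<in> carrier_mat n m \<Longrightarrow> mat_adjoint A \<in> carrier_mat m n"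
  unfolding mat_adjoint_def by auto

lemma mat_adjoint_dim [simp]:
  "dim_row (mat_adjoint A) = dim_col A" "dim_col (mat_adjoint A) = dim_row A"
  unfolding mat_adjoint_def by auto

lemma mat_adjoint_index [simp]:
  fixes A :: "complex mat"
  assumes "i < dim_col A" "j < dim_row A"
  shows "mat_adjoint A $$ (i, j) = cnj (A $$ (j, i))"
  using assms unfolding mat_adjoint_def by (subst mat_of_rows_index) auto

lemma mat_adjoint_adjoint [simp]: "mat_adjoint (mat_adjoint A) = (A :: complex mat)"
  by (rule eq_matI) auto

lemma index_mult_mat_sum:
  assumes "A \<in> carrier_mat n k" "B \<in> carrier_mat k m" "i < n" "j < m"
  shows "(A * B) $$ (i, j) = (\<Sum>l<k. A $$ (i, l) * B $$ (l, j))"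
  using assms by (auto simp: scalar_prod_def atLeast0LessThan)

lemma mat_adjoint_mult:
  fixes A B :: "complex mat"
  assumes "A \<in> carrier_mat n k" "B \<in> carrier_mat k m"
  shows "mat_adjoint (A * B) = mat_adjoint B * mat_adjoint A"
  using assms by (intro eq_matI) (auto simp: scalar_prod_def mult.commute)

lemma cscalar_prod_sum:
  fixes x y :: "complex vec"
  assumes "x \<in> carrier_vec n" "y \<in> carrier_vec n"
  shows "x \<bullet>c y = (\<Sum>i<n. x $ i * cnj (y $ i))"
  using assms by (auto simp: scalar_prod_def atLeast0LessThan)

lemma mult_mat_vec_sum:
  assumes "A \<in> carrier_mat n m" "v \<in> carrier_vec m" "i < n"
  shows "(A *\<^sub>v v) $ i = (\<Sum>j<m. A $$ (i, j) * v $ j)"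
  using assms by (auto simp: scalar_prod_def atLeast0LessThan)

lemma cscalar_prod_adjoint:
  fixes A :: "complex mat"
  assumes "A \<in> carrier_mat n m" "x \<in> carrier_vec m" "y \<in> carrier_vec n"
  shows "(A *\<^sub>v x) \<bullet>c y = x \<bullet>c (mat_adjoint A *\<^sub>v y)"
proof -
  have "(A *\<^sub>v x) \<bullet>c y = (\<Sum>i<n. \<Sum>j<m. A $$ (i, j) * x $ j * cnj (y $ i))"
    using assms by (subst cscalar_prod_sum[of _ n])
      (auto simp: mult_mat_vec_sum[OF assms(1,2)] sum_distrib_right simp del: index_mult_mat_vec)
  also have "\<dots> = (\<Sum>j<m. \<Sum>i<n. A $$ (i, j) * x $ j * cnj (y $ i))"
    by (rule sum.swap)
  also have "\<dots> = x \<bullet>c (mat_adjoint A *\<^sub>v y)"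
  proof -
    have Ay: "mat_adjoint A *\<^sub>v y \<in> carrier_vec m"
      using assms by (intro mult_mat_vec_carrier[of _ m n]) auto
    show ?thesis
      unfolding cscalar_prod_sum[OF assms(2) Ay]
    proof (rule sum.cong[OF refl])
      fix j assume "j \<in> {..<m}"
      then have j: "j < m" by simp
      have "(mat_adjoint A *\<^sub>v y) $ j = (\<Sum>i<n. cnj (A $$ (i, j)) * y $ i)"
        using assms j by (subst mult_mat_vec_sum[of _ m n]) (auto intro!: sum.cong)
      then show "(\<Sum>i<n. A $$ (i, j) * x $ j * cnj (y $ i)) = x $ j * cnj ((mat_adjoint A *\<^sub>v y) $ j)"
        by (simp add: sum_distrib_left algebra_simps)
    qed
  qed
  finally show ?thesis .
qed

lemma unitary_right_inverse:
  fixes U :: "complex mat"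
  assumes "U \<in> carrier_mat n n" "mat_adjoint U * U = 1\<^sub>m n"
  shows "U * mat_adjoint U = 1\<^sub>m n"
  using assms mat_mult_left_right_inverse[of "mat_adjoint U" n U] by auto

text \<open>A complex Householder reflection: with \<open>u = w - b\<close> the scalar \<open>c = 1 / \<langle>w, u\<rangle>\<close>
  makes \<open>1 - c u u\<^sup>*\<close> unitary because \<open>\<parallel>u\<parallel>\<^sup>2 = 2 Re \<langle>w, u\<rangle>\<close>.\<close>

lemma householder:
  fixes w b :: "complex vec"
  assumes w: "w \<in> carrier_vec n" and b: "b \<in> carrier_vec n" and eq: "w \<bullet>c w = b \<bullet>c b"
  obtains H where "H \<in> carrier_mat n n" "mat_adjoint H * H = 1\<^sub>m n" "H *\<^sub>v w = b"
    "\<And>x. x \<in> carrier_vec n \<Longrightarrow> x \<bullet>c w = x \<bullet>c b \<Longrightarrow> H *\<^sub>v x = x"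
proof -
  define u where "u = w - b"
  have u: "u \<in> carrier_vec n" unfolding u_def using w b by auto
  define s where "s = (\<Sum>i<n. u $ i * cnj (u $ i))"
  define z where "z = (\<Sum>i<n. w $ i * cnj (u $ i))"
  \<comment> \<open>If \<open>z = 0\<close> then \<open>s = 0\<close>, so \<open>u = 0\<close> and
    \<open>w = b\<close>; since \<open>1 / 0 = 0\<close>, \<open>H\<close> is then the identity, as
    it should be.\<close>
  define c where "c = 1 / z"
  have ui: "u $ i = w $ i - b $ i" if "i < n" for i
    unfolding u_def using w b that by auto
  have eq': "(\<Sum>i<n. w $ i * cnj (w $ i)) = (\<Sum>i<n. b $ i * cnj (b $ i))"
    using eq w b by (simp add: cscalar_prod_sum[of _ n])
  have sz: "s = z + cnj z"
  proof -
    have "s - (z + cnj z) = (\<Sum>i<n. u $ i * cnj (u $ i) - (w $ i * cnj (u $ i) + cnj (w $ i) * u $ i))"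
      unfolding s_def z_def by (simp only: sum.distrib sum_subtractf cnj_sum complex_cnj_mult complex_cnj_cnj)
    also have "\<dots> = (\<Sum>i<n. b $ i * cnj (b $ i) - w $ i * cnj (w $ i))"
      by (rule sum.cong) (auto simp: ui algebra_simps)
    also have "\<dots> = 0" using eq' by (simp add: sum_subtractf)
    finally show ?thesis by simp
  qed
  have s0: "u = 0\<^sub>v n" if "z = 0"
  proof -
    have "u \<bullet>c u = 0" using that sz u by (simp add: cscalar_prod_sum[of _ n] s_def)
    then show ?thesis using conjugate_square_eq_0_vec[OF u] by simp
  qed
  have wb: "w = b" if "z = 0"
  proof (rule eq_vecI)
    fix i assume "i < dim_vec b"
    then have "i < n" using b by simp
    then show "w $ i = b $ i" using ui[of i] s0[OF that] by simp
  qed (use w b in auto)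
  have cc: "c + cnj c = c * cnj c * s"
    unfolding c_def sz by (cases "z = 0") (auto simp: field_simps)
  define H where "H = mat n n (\<lambda>(i, j). (if i = j then 1 else 0) - c * u $ i * cnj (u $ j))"
  have H: "H \<in> carrier_mat n n" unfolding H_def by auto
  have Hx: "H *\<^sub>v x = x - (c * (x \<bullet>c u)) \<cdot>\<^sub>v u" if x: "x \<in> carrier_vec n" for x
  proof (rule eq_vecI)
    fix i assume "i < dim_vec (x - (c * (x \<bullet>c u)) \<cdot>\<^sub>v u)"
    then have i: "i < n" using u by simp
    have "(H *\<^sub>v x) $ i = (\<Sum>j<n. (if i = j then x $ j else 0) - c * u $ i * (x $ j * cnj (u $ j)))"
      unfolding mult_mat_vec_sum[OF H x i]
      by (rule sum.cong) (use i in \<open>auto simp: H_def algebra_simps\<close>)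
    also have "\<dots> = x $ i - c * u $ i * (x \<bullet>c u)"
      using i by (simp add: sum_subtractf sum_distrib_left[symmetric] cscalar_prod_sum[OF x u])
    finally show "(H *\<^sub>v x) $ i = (x - (c * (x \<bullet>c u)) \<cdot>\<^sub>v u) $ i"
      using i x u by (simp del: index_mult_mat_vec)
  qed (use H x u in auto)
  have "mat_adjoint H * H = 1\<^sub>m n"
  proof (rule eq_matI)
    fix i j assume "i < dim_row (1\<^sub>m n :: complex mat)" "j < dim_col (1\<^sub>m n :: complex mat)"
    then have i: "i < n" and j: "j < n" by auto
    have "(mat_adjoint H * H) $$ (i, j) = (\<Sum>k<n. cnj (H $$ (k, i)) * H $$ (k, j))"
      using H i j by (subst index_mult_mat_sum[of _ n n _ n]) auto
    also have "\<dots> = (\<Sum>k<n. (if k = i then (if i = j then 1 else 0) else 0)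
        - (if k = i then c * u $ i * cnj (u $ j) else 0)
        - (if k = j then cnj c * u $ i * cnj (u $ j) else 0)
        + c * cnj c * u $ i * cnj (u $ j) * (u $ k * cnj (u $ k)))"
      using i j by (intro sum.cong) (auto simp: H_def algebra_simps)
    also have "\<dots> = (if i = j then 1 else 0) - c * u $ i * cnj (u $ j)
        - cnj c * u $ i * cnj (u $ j) + c * cnj c * u $ i * cnj (u $ j) * s"
      using i j by (simp add: sum_subtractf sum.distrib sum_distrib_left[symmetric] s_def)
    also have "\<dots> = (if i = j then 1 else 0) - (c + cnj c - c * cnj c * s) * (u $ i * cnj (u $ j))"
      by (simp add: algebra_simps)
    finally show "(mat_adjoint H * H) $$ (i, j) = 1\<^sub>m n $$ (i, j)"
      using i j cc by simp
  qed (use H in auto)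
  moreover have "H *\<^sub>v w = b"
  proof -
    have wu: "w \<bullet>c u = z" unfolding z_def using w u by (rule cscalar_prod_sum)
    show ?thesis
    proof (rule eq_vecI)
      fix i assume "i < dim_vec b"
      then have i: "i < n" using b by simp
      have "(H *\<^sub>v w) $ i = w $ i - c * z * u $ i"
        unfolding Hx[OF w] wu using i w u by simp
      also have "\<dots> = b $ i"
        using i ui[OF i] wb s0 by (cases "z = 0") (auto simp: c_def)
      finally show "(H *\<^sub>v w) $ i = b $ i" .
    qed (use H b in auto)
  qed
  moreover have "H *\<^sub>v x = x" if x: "x \<in> carrier_vec n" and xw: "x \<bullet>c w = x \<bullet>c b" for x
  proof -
    have "x \<bullet>c u = (\<Sum>i<n. x $ i * cnj (w $ i) - x $ i * cnj (b $ i))"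
      unfolding cscalar_prod_sum[OF x u] by (rule sum.cong) (auto simp: ui algebra_simps)
    also have "\<dots> = x \<bullet>c w - x \<bullet>c b"
      using x w b by (simp add: cscalar_prod_sum[of _ n] sum_subtractf)
    finally have "x \<bullet>c u = x \<bullet>c w - x \<bullet>c b" .
    then show ?thesis using Hx[OF x] xw x u by (intro eq_vecI) auto
  qed
  ultimately show ?thesis using H that by blast
qed

text \<open>Equal Gram matrices make the map from the \<open>a i\<close> to the \<open>b i\<close>
  isometric on spans, also for dependent families. In the induction a reflection moving
  \<open>w\<close>, the image of \<open>a k\<close> under \<open>U\<close>, to \<open>b k\<close> is
  composed with \<open>U\<close>; it fixes the earlier \<open>b i\<close> because each has the same
  inner product with \<open>w\<close> as with \<open>b k\<close>.\<close>

lemma unitary_extension: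
  fixes a b :: "nat \<Rightarrow> complex vec"
  assumes "\<And>i. i < k \<Longrightarrow> a i \<in> carrier_vec n" "\<And>i. i < k \<Longrightarrow> b i \<in> carrier_vec n"
    and "\<And>i j. i < k \<Longrightarrow> j < k \<Longrightarrow> a i \<bullet>c a j = b i \<bullet>c b j"
  shows "\<exists>U. U \<in> carrier_mat n n \<and> mat_adjoint U * U = 1\<^sub>m n \<and> (\<forall>i<k. U *\<^sub>v a i = b i)"
  using assms
proof (induction k)
  case 0
  have "mat_adjoint (1\<^sub>m n) = (1\<^sub>m n :: complex mat)" by (rule eq_matI) auto
  then show ?case by (intro exI[of _ "1\<^sub>m n"]) auto
next
  case (Suc k)
  then obtain U where U: "U \<in> carrier_mat n n" and UU: "mat_adjoint U * U = 1\<^sub>m n"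
    and Ua: "\<And>i. i < k \<Longrightarrow> U *\<^sub>v a i = b i" by auto
  have iso: "(U *\<^sub>v x) \<bullet>c (U *\<^sub>v y) = x \<bullet>c y"
    if "x \<in> carrier_vec n" "y \<in> carrier_vec n" for x y
    using that U UU by (subst cscalar_prod_adjoint[OF U])
      (auto simp: assoc_mult_mat_vec[symmetric, of _ n n _ n])
  define w where "w = U *\<^sub>v a k"
  have w: "w \<in> carrier_vec n" unfolding w_def using U Suc.prems(1)[of k] by auto
  have bk: "b k \<in> carrier_vec n" using Suc.prems(2) by simp
  have "w \<bullet>c w = b k \<bullet>c b k" unfolding w_def using iso Suc.prems(1,3) by simp
  then obtain H where H: "H \<in> carrier_mat n n" "mat_adjoint H * H = 1\<^sub>m n" "H *\<^sub>v w = b k"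
    and Hx: "\<And>x. x \<in> carrier_vec n \<Longrightarrow> x \<bullet>c w = x \<bullet>c b k \<Longrightarrow> H *\<^sub>v x = x"
    using householder[OF w bk] by blast
  have "H *\<^sub>v b i = b i" if "i < k" for i
  proof (rule Hx)
    show "b i \<in> carrier_vec n" using Suc.prems(2)[of i] that by simp
    have "b i \<bullet>c w = a i \<bullet>c a k"
      unfolding w_def using that Ua[of i] iso[of "a i" "a k"] Suc.prems(1)[of i] Suc.prems(1)[of k] by simp
    then show "b i \<bullet>c w = b i \<bullet>c b k" using Suc.prems(3)[of i k] that by simp
  qed
  then have 1: "(H * U) *\<^sub>v a i = b i" if "i < Suc k" for i
    using that Suc.prems(1) H U Ua w_def
    by (auto simp: assoc_mult_mat_vec[of _ n n _ n] less_Suc_eq)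
  have "mat_adjoint (H * U) * (H * U) = mat_adjoint U * (mat_adjoint H * (H * U))"
    using H U by (simp add: mat_adjoint_mult[of _ n n _ n] assoc_mult_mat[of _ n n _ n _ n])
  also have "mat_adjoint H * (H * U) = (mat_adjoint H * H) * U"
    using H U by (intro assoc_mult_mat[of _ n n _ n _ n, symmetric]) auto
  also have "mat_adjoint U * (mat_adjoint H * H * U) = 1\<^sub>m n" using H U UU by simp
  finally show ?case using 1 H U by (intro exI[of _ "H * U"]) auto
qed

lemma unit_eigenvector_exists:
  fixes A :: "complex mat"
  assumes A: "A \<in> carrier_mat n n" and n: "n \<noteq> 0"
  obtains v l where "v \<in> carrier_vec n" "v \<bullet>c v = 1" "A *\<^sub>v v = l \<cdot>\<^sub>v v"
proof -
  obtain l where "eigenvalue A l" using spectrum_non_empty[OF A] n unfolding spectrum_def by auto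
  then obtain v where v: "v \<in> carrier_vec n" "v \<noteq> 0\<^sub>v n" "A *\<^sub>v v = l \<cdot>\<^sub>v v"
    unfolding eigenvalue_def eigenvector_def using A by auto
  define s where "s = (\<Sum>i<n. (cmod (v $ i))\<^sup>2)"
  have vs: "v \<bullet>c v = complex_of_real s"
    unfolding s_def cscalar_prod_sum[OF v(1) v(1)] of_real_sum by (simp only: complex_norm_square)
  have "s \<noteq> 0" using vs v conjugate_square_eq_0_vec[OF v(1)] by auto
  moreover have "s \<ge> 0" unfolding s_def by (rule sum_nonneg) simp
  ultimately have s: "s > 0" by simp
  define w where "w = complex_of_real (1 / sqrt s) \<cdot>\<^sub>v v"
  have "w \<bullet>c w = complex_of_real (1 / sqrt s) * complex_of_real (1 / sqrt s) * (v \<bullet>c v)"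
    unfolding w_def using v(1)
    by (simp add: cscalar_prod_sum[of _ n] sum_distrib_left algebra_simps)
  also have "\<dots> = complex_of_real (1 / sqrt s * (1 / sqrt s) * s)"
    unfolding vs by (simp only: of_real_mult)
  also have "1 / sqrt s * (1 / sqrt s) * s = 1" using s by simp
  finally have "w \<bullet>c w = 1" by simp
  moreover have "A *\<^sub>v w = l \<cdot>\<^sub>v w"
    unfolding w_def using v A by (auto simp: mult_mat_vec[of _ n n] smult_smult_assoc mult.commute)
  ultimately show ?thesis using that[of w l] v(1) unfolding w_def by simp
qed

definition diagm :: "nat \<Rightarrow> (nat \<Rightarrow> complex) \<Rightarrow> complex mat" where
  "diagm n e = mat n n (\<lambda>(i, j). if i = j then e i else 0)"

lemma diagm_carrier [simp]: "diagm n e \<in> carrier_mat n n"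
  unfolding diagm_def by simp

lemma index_diagm_mult:
  assumes "A \<in> carrier_mat n m" "i < n" "j < m"
  shows "(diagm n e * A) $$ (i, j) = e i * A $$ (i, j)"
proof -
  have "(diagm n e * A) $$ (i, j) = (\<Sum>l<n. if l = i then e i * A $$ (i, j) else 0)"
    using assms by (subst index_mult_mat_sum[of _ n n _ m]) (auto simp: diagm_def if_distrib[of "\<lambda>x. x * _"] cong: if_cong intro!: sum.cong)
  then show ?thesis using assms by simp
qed


lemma unitary_mult:
  fixes U V :: "complex mat"
  assumes "U \<in> carrier_mat n n" "V \<in> carrier_mat n n"
    "mat_adjoint U * U = 1\<^sub>m n" "mat_adjoint V * V = 1\<^sub>m n"
  shows "mat_adjoint (U * V) * (U * V) = 1\<^sub>m n"
proof -
  have "mat_adjoint (U * V) * (U * V) = mat_adjoint V * (mat_adjoint U * (U * V))"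
    using assms by (simp add: mat_adjoint_mult[of _ n n _ n] assoc_mult_mat[of _ n n _ n _ n])
  also have "mat_adjoint U * (U * V) = (mat_adjoint U * U) * V"
    using assms by (intro assoc_mult_mat[of _ n n _ n _ n, symmetric]) auto
  finally show ?thesis using assms by simp
qed

text \<open>A reflection carries the first basis vector to a unit eigenvector, so the first column
  of the conjugated matrix is \<open>l\<close> times that basis vector. Comparing the corner entries
  of the two products in the normality equation leaves square sum 0 for the rest of the first
  row.\<close>

lemma normal_deflation:
  fixes A :: "complex mat"
  assumes A: "A \<in> carrier_mat (Suc m) (Suc m)"
    and normal: "mat_adjoint A * A = A * mat_adjoint A"
  obtains H where "H \<in> carrier_mat (Suc m) (Suc m)" "mat_adjoint H * H = 1\<^sub>m (Suc m)"
    "\<And>i. i < m \<Longrightarrow> (mat_adjoint H * A * H) $$ (Suc i, 0) = 0"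
    "\<And>i. i < m \<Longrightarrow> (mat_adjoint H * A * H) $$ (0, Suc i) = 0"
    "mat_adjoint (mat_adjoint H * A * H) * (mat_adjoint H * A * H)
      = (mat_adjoint H * A * H) * mat_adjoint (mat_adjoint H * A * H)"
proof -
  let ?n = "Suc m"
  obtain v l where v: "v \<in> carrier_vec ?n" "v \<bullet>c v = 1" "A *\<^sub>v v = l \<cdot>\<^sub>v v"
    using unit_eigenvector_exists[OF A] by blast
  define e where "e = (unit_vec ?n 0 :: complex vec)"
  have e: "e \<in> carrier_vec ?n" unfolding e_def by simp
  have "e \<bullet>c e = 1" unfolding e_def
    by (subst cscalar_prod_sum[of _ ?n]) (auto simp: sum.lessThan_Suc_shift simp del: sum.lessThan_Suc)
  then obtain H where H: "H \<in> carrier_mat ?n ?n" "mat_adjoint H * H = 1\<^sub>m ?n" "H *\<^sub>v e = v"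
    using householder[OF e v(1)] v(2) by metis
  note HH = unitary_right_inverse[OF H(1,2)]
  define B where "B = mat_adjoint H * A * H"
  have aH: "mat_adjoint H \<in> carrier_mat ?n ?n" and aA: "mat_adjoint A \<in> carrier_mat ?n ?n"
    using H A by auto
  have B: "B \<in> carrier_mat ?n ?n" unfolding B_def using H(1) aH A by (intro mult_carrier_mat) auto
  have aB: "mat_adjoint B = mat_adjoint H * mat_adjoint A * H"
    unfolding B_def using H(1) aH A aA
    by (simp add: mat_adjoint_mult[of _ ?n ?n _ ?n] assoc_mult_mat[of _ ?n ?n _ ?n _ ?n])
  have conj: "(mat_adjoint H * X * H) * (mat_adjoint H * Y * H) = mat_adjoint H * (X * Y) * H"
    if X: "X \<in> carrier_mat ?n ?n" and Y: "Y \<in> carrier_mat ?n ?n" for X Y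
  proof -
    note assoc = assoc_mult_mat[of _ ?n ?n _ ?n _ ?n]
    have "(mat_adjoint H * X * H) * (mat_adjoint H * Y * H)
        = mat_adjoint H * X * ((H * mat_adjoint H) * (Y * H))"
      using X Y H(1) aH by (simp add: assoc mult_carrier_mat[of _ ?n ?n])
    also have "\<dots> = mat_adjoint H * (X * Y) * H"
      using X Y H(1) aH by (simp add: HH assoc mult_carrier_mat[of _ ?n ?n])
    finally show ?thesis .
  qed
  have nB: "mat_adjoint B * B = B * mat_adjoint B"
    unfolding aB unfolding B_def using conj[OF A aA] conj[OF aA A] normal by simp
  have "B *\<^sub>v e = mat_adjoint H *\<^sub>v (A *\<^sub>v (H *\<^sub>v e))"
    unfolding B_def using H(1) aH A e
    by (simp add: assoc_mult_mat_vec[of _ ?n ?n _ ?n] mult_carrier_mat[of _ ?n ?n] mult_mat_vec_carrier[of _ ?n ?n])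
  also have "\<dots> = l \<cdot>\<^sub>v (mat_adjoint H *\<^sub>v (H *\<^sub>v e))"
    unfolding H(3) v(3) using aH v(1) by (simp add: mult_mat_vec[of _ ?n ?n])
  also have "mat_adjoint H *\<^sub>v (H *\<^sub>v e) = (mat_adjoint H * H) *\<^sub>v e"
    using H(1) aH e by (simp add: assoc_mult_mat_vec[of _ ?n ?n _ ?n])
  also have "\<dots> = e" using H(2) e by simp
  finally have Be: "B *\<^sub>v e = l \<cdot>\<^sub>v e" .
  have "col B 0 = B *\<^sub>v e"
    using B by (intro eq_vecI) (auto simp: e_def)
  have col0: "B $$ (i, 0) = (if i = 0 then l else 0)" if "i < ?n" for i
  proof -
    have "B $$ (i, 0) = (B *\<^sub>v e) $ i" using that B \<open>col B 0 = B *\<^sub>v e\<close>[symmetric] by simp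
    then show ?thesis unfolding Be using that by (simp add: e_def)
  qed
  have "(mat_adjoint B * B) $$ (0, 0) = (\<Sum>k<?n. cnj (B $$ (k, 0)) * B $$ (k, 0))"
    using B by (subst index_mult_mat_sum[of _ ?n ?n _ ?n]) auto
  also have "\<dots> = cnj l * l"
    unfolding sum.lessThan_Suc_shift using col0 by simp
  finally have n1: "(mat_adjoint B * B) $$ (0, 0) = cnj l * l" .
  have "(B * mat_adjoint B) $$ (0, 0) = (\<Sum>k<?n. B $$ (0, k) * cnj (B $$ (0, k)))"
    using B by (subst index_mult_mat_sum[of _ ?n ?n _ ?n]) auto
  also have "\<dots> = l * cnj l + (\<Sum>k<m. B $$ (0, Suc k) * cnj (B $$ (0, Suc k)))"
    unfolding sum.lessThan_Suc_shift using col0 by simp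
  finally have "complex_of_real (\<Sum>k<m. (cmod (B $$ (0, Suc k)))\<^sup>2) = 0"
    using n1 nB unfolding of_real_sum complex_norm_square by simp
  then have "(\<Sum>k<m. (cmod (B $$ (0, Suc k)))\<^sup>2) = 0" unfolding of_real_eq_0_iff .
  then have "B $$ (0, Suc k) = 0" if "k < m" for k
    using that by (subst (asm) sum_nonneg_eq_0_iff) auto
  then show ?thesis using that[OF H(1,2)] nB col0 unfolding B_def by auto
qed

text \<open>Stated for normal matrices because it serves both a Hermitian matrix, for its square
  root, and a unitary one, for the nodes of the measure.\<close>

theorem normal_diagonalization:
  fixes A :: "complex mat"
  assumes "A \<in> carrier_mat n n" "mat_adjoint A * A = A * mat_adjoint A"
  shows "\<exists>W e. W \<in> carrier_mat n n \<and> mat_adjoint W * W = 1\<^sub>m n \<and> mat_adjoint W * A * W = diagm n e"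
  using assms
proof (induction n arbitrary: A)
  case 0
  then show ?case by (intro exI[of _ "1\<^sub>m 0"] exI[of _ "\<lambda>_. 0"]) (auto simp: diagm_def)
next
  case (Suc m)
  let ?n = "Suc m"
  note A = Suc.prems(1)
  obtain H where H: "H \<in> carrier_mat ?n ?n" "mat_adjoint H * H = 1\<^sub>m ?n"
    and col0: "\<And>i. i < m \<Longrightarrow> (mat_adjoint H * A * H) $$ (Suc i, 0) = 0"
    and row0: "\<And>i. i < m \<Longrightarrow> (mat_adjoint H * A * H) $$ (0, Suc i) = 0"
    and nB: "mat_adjoint (mat_adjoint H * A * H) * (mat_adjoint H * A * H)
      = (mat_adjoint H * A * H) * mat_adjoint (mat_adjoint H * A * H)"
    using normal_deflation[OF Suc.prems] by blast
  define B where "B = mat_adjoint H * A * H"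
  have aH: "mat_adjoint H \<in> carrier_mat ?n ?n" using H by auto
  have B: "B \<in> carrier_mat ?n ?n" unfolding B_def using H(1) aH A by (intro mult_carrier_mat) auto
  define C where "C = mat m m (\<lambda>(i, j). B $$ (Suc i, Suc j))"
  have C: "C \<in> carrier_mat m m" unfolding C_def by simp
  have "mat_adjoint C * C = C * mat_adjoint C"
  proof (rule eq_matI)
    fix i j assume "i < dim_row (C * mat_adjoint C)" "j < dim_col (C * mat_adjoint C)"
    then have i: "i < m" and j: "j < m" using C by auto
    have "(mat_adjoint C * C) $$ (i, j) = (\<Sum>k<m. cnj (B $$ (Suc k, Suc i)) * B $$ (Suc k, Suc j))"
      using C i j by (subst index_mult_mat_sum[of _ m m _ m]) (auto simp: C_def)
    also have "\<dots> = (\<Sum>k<?n. cnj (B $$ (k, Suc i)) * B $$ (k, Suc j))"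
      unfolding sum.lessThan_Suc_shift using row0[of i, folded B_def] i by simp
    also have "\<dots> = (mat_adjoint B * B) $$ (Suc i, Suc j)"
      using B i j by (subst index_mult_mat_sum[of _ ?n ?n _ ?n]) (auto simp del: sum.lessThan_Suc)
    also have "\<dots> = (B * mat_adjoint B) $$ (Suc i, Suc j)" using nB unfolding B_def by simp
    also have "\<dots> = (\<Sum>k<?n. B $$ (Suc i, k) * cnj (B $$ (Suc j, k)))"
      using B i j by (subst index_mult_mat_sum[of _ ?n ?n _ ?n]) (auto simp del: sum.lessThan_Suc)
    also have "\<dots> = (\<Sum>k<m. B $$ (Suc i, Suc k) * cnj (B $$ (Suc j, Suc k)))"
      unfolding sum.lessThan_Suc_shift using col0[of i, folded B_def] i by simp
    also have "\<dots> = (C * mat_adjoint C) $$ (i, j)"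
      using C i j by (subst index_mult_mat_sum[of _ m m _ m]) (auto simp: C_def)
    finally show "(mat_adjoint C * C) $$ (i, j) = (C * mat_adjoint C) $$ (i, j)" .
  qed (use C in auto)
  then obtain V e where V: "V \<in> carrier_mat m m" "mat_adjoint V * V = 1\<^sub>m m"
    and VC: "mat_adjoint V * C * V = diagm m e" using Suc.IH[OF C] by blast
  \<comment> \<open>\<open>F c X\<close> is the block diagonal matrix with the scalar
    \<open>c\<close> and the block \<open>X\<close>.\<close>
  define F where "F = (\<lambda>(c :: complex) X. mat ?n ?n (\<lambda>(i, j). case (i, j) of
    (Suc a, Suc b) \<Rightarrow> X $$ (a, b) | (0, 0) \<Rightarrow> c | _ \<Rightarrow> (0 :: complex)))"
  have F: "F c X \<in> carrier_mat ?n ?n" for c X unfolding F_def by simp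
  have Fmult: "F c X * F c' Y = F (c * c') (X * Y)"
    if "X \<in> carrier_mat m m" "Y \<in> carrier_mat m m" for c c' X Y
  proof (rule eq_matI)
    fix i j assume "i < dim_row (F (c * c') (X * Y))" "j < dim_col (F (c * c') (X * Y))"
    then have i: "i < ?n" and j: "j < ?n" using F[of "c * c'" "X * Y"] by auto
    have "(F c X * F c' Y) $$ (i, j) = (\<Sum>k<?n. F c X $$ (i, k) * F c' Y $$ (k, j))"
      using i j F by (intro index_mult_mat_sum[of _ ?n ?n _ ?n]) auto
    also have "\<dots> = F c X $$ (i, 0) * F c' Y $$ (0, j)
        + (\<Sum>k<m. F c X $$ (i, Suc k) * F c' Y $$ (Suc k, j))"
      unfolding sum.lessThan_Suc_shift by simp
    also have "\<dots> = F (c * c') (X * Y) $$ (i, j)"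
      using i j that
      by (cases i; cases j) (simp_all add: F_def index_mult_mat_sum[of X m m Y m] del: index_mult_mat)
    finally show "(F c X * F c' Y) $$ (i, j) = F (c * c') (X * Y) $$ (i, j)" .
  qed (simp_all add: F_def)
  have Fadj: "mat_adjoint (F c X) = F (cnj c) (mat_adjoint X)" if "X \<in> carrier_mat m m" for c X
  proof (rule eq_matI)
    fix i j assume "i < dim_row (F (cnj c) (mat_adjoint X))" "j < dim_col (F (cnj c) (mat_adjoint X))"
    then have "i < ?n" "j < ?n" using F[of "cnj c" "mat_adjoint X"] by auto
    then show "mat_adjoint (F c X) $$ (i, j) = F (cnj c) (mat_adjoint X) $$ (i, j)"
      using that by (cases i; cases j) (simp_all add: F_def)
  qed (use F in \<open>auto simp: F_def\<close>)
  have BF: "B = F (B $$ (0, 0)) C"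
  proof (rule eq_matI)
    fix i j assume "i < dim_row (F (B $$ (0, 0)) C)" "j < dim_col (F (B $$ (0, 0)) C)"
    then have "i < ?n" "j < ?n" using F[of "B $$ (0, 0)" C] by auto
    then show "B $$ (i, j) = F (B $$ (0, 0)) C $$ (i, j)"
      using row0 col0 by (cases i; cases j) (simp_all add: F_def C_def B_def[symmetric])
  qed (use B in \<open>auto simp: F_def\<close>)
  have F1: "F 1 (1\<^sub>m m) = 1\<^sub>m ?n"
  proof (rule eq_matI)
    fix i j assume "i < dim_row (1\<^sub>m ?n :: complex mat)" "j < dim_col (1\<^sub>m ?n :: complex mat)"
    then show "F 1 (1\<^sub>m m) $$ (i, j) = 1\<^sub>m ?n $$ (i, j)"
      by (cases i; cases j) (simp_all add: F_def)
  qed (use F in auto)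
  define W where "W = H * F 1 V"
  have W: "W \<in> carrier_mat ?n ?n" unfolding W_def using H F by auto
  have "mat_adjoint (F 1 V) * F 1 V = 1\<^sub>m ?n"
    using V by (simp add: Fadj Fmult F1)
  then have "mat_adjoint W * W = 1\<^sub>m ?n"
    unfolding W_def using H F by (intro unitary_mult) auto
  moreover have "mat_adjoint W * A * W = diagm ?n (case_nat (B $$ (0, 0)) e)"
  proof -
    note assoc = assoc_mult_mat[of _ ?n ?n _ ?n _ ?n]
    have aF: "mat_adjoint (F 1 V) \<in> carrier_mat ?n ?n" using F by auto
    have "mat_adjoint W * A * W = mat_adjoint (F 1 V) * B * F 1 V"
      unfolding W_def B_def using H(1) aH A F[of 1 V] aF
      by (simp add: mat_adjoint_mult[of _ ?n ?n _ ?n] assoc mult_carrier_mat[of _ ?n ?n])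
    also have "\<dots> = F (B $$ (0, 0)) (mat_adjoint V * C * V)"
      using V C by (subst BF) (simp add: Fadj Fmult mult_carrier_mat[of _ m m])
    also have "\<dots> = diagm ?n (case_nat (B $$ (0, 0)) e)"
      unfolding VC
    proof (rule eq_matI)
      fix i j assume "i < dim_row (diagm ?n (case_nat (B $$ (0, 0)) e))"
        "j < dim_col (diagm ?n (case_nat (B $$ (0, 0)) e))"
      then show "F (B $$ (0, 0)) (diagm m e) $$ (i, j) = diagm ?n (case_nat (B $$ (0, 0)) e) $$ (i, j)"
        by (cases i; cases j) (simp_all add: F_def diagm_def)
    qed (simp_all add: F_def diagm_def)
    finally show ?thesis .
  qed
  ultimately show ?case using W by blast
qed

section \<open>Positive semidefinite block Toeplitz matrices\<close>

lemma zero_le_complex_iff: "0 \<le> (z :: complex) \<longleftrightarrow> 0 \<le> Re z \<and> Im z = 0"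
  by (auto simp: less_eq_complex_def)

text \<open>Coefficient functions in place of \<open>vec\<close> keep the sums free of carrier
  conditions, so that they can be split into blocks and interchanged; values from \<open>n\<close>
  on do not enter.\<close>

lemma psd_iff_sum:
  "psd n A \<longleftrightarrow> A \<in> carrier_mat n n \<and>
    (\<forall>f :: nat \<Rightarrow> complex. 0 \<le> (\<Sum>r<n. \<Sum>s<n. A $$ (r, s) * f s * cnj (f r)))"
proof -
  have form: "(A *\<^sub>v v) \<bullet>c v = (\<Sum>r<n. \<Sum>s<n. A $$ (r, s) * v $ s * cnj (v $ r))"
    if "A \<in> carrier_mat n n" "v \<in> carrier_vec n" for v
  proof -
    have "A *\<^sub>v v \<in> carrier_vec n" using that by auto
    then show ?thesis
      using that by (simp add: cscalar_prod_sum[of _ n] mult_mat_vec_sum[of A n n] sum_distrib_right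
        del: index_mult_mat_vec)
  qed
  have "(\<forall>v\<in>carrier_vec n. 0 \<le> (A *\<^sub>v v) \<bullet>c v) \<longleftrightarrow>
      (\<forall>f :: nat \<Rightarrow> complex. 0 \<le> (\<Sum>r<n. \<Sum>s<n. A $$ (r, s) * f s * cnj (f r)))"
    if A: "A \<in> carrier_mat n n"
  proof (intro iffI allI ballI)
    fix f :: "nat \<Rightarrow> complex"
    assume "\<forall>v\<in>carrier_vec n. 0 \<le> (A *\<^sub>v v) \<bullet>c v"
    then have "0 \<le> (A *\<^sub>v vec n f) \<bullet>c vec n f" by simp
    then show "0 \<le> (\<Sum>r<n. \<Sum>s<n. A $$ (r, s) * f s * cnj (f r))"
      unfolding form[OF A vec_carrier] by simp
  qed (simp add: form[OF A])
  then show ?thesis unfolding psd_def by blast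
qed

lemma sum_blocks:
  fixes f :: "nat \<Rightarrow> 'a :: comm_monoid_add"
  shows "(\<Sum>t<k * n. f t) = (\<Sum>i<k. \<Sum>r<n. f (i * n + r))"
proof -
  have "sum f {i * n..<i * n + n} = (\<Sum>r<n. f (i * n + r))" for i
    using sum.shift_bounds_nat_ivl[of f 0 "i * n" n] by (simp add: atLeast0LessThan add.commute)
  then show ?thesis using sum.nat_group[of f n k] by simp
qed

lemma block_mat_carrier [simp]: "block_mat k n a \<in> carrier_mat (k * n) (k * n)"
  unfolding block_mat_def by simp

lemma block_index_less: "i < k \<Longrightarrow> r < n \<Longrightarrow> i * n + r < k * (n :: nat)"
proof -
  assume "i < k" "r < n"
  then have "i * n + r < Suc i * n" "Suc i * n \<le> k * n" using mult_le_mono1[of "Suc i" k n] by auto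
  then show ?thesis by linarith
qed

lemma block_mat_index:
  "i < k \<Longrightarrow> j < k \<Longrightarrow> r < n \<Longrightarrow> s < n \<Longrightarrow>
    block_mat k n a $$ (i * n + r, j * n + s) = a i j $$ (r, s)"
  unfolding block_mat_def by (simp add: block_index_less)

lemma psd_block_mat_iff:
  "psd (k * n) (block_mat k n a) \<longleftrightarrow>
    (\<forall>u :: nat \<Rightarrow> nat \<Rightarrow> complex. 0 \<le> (\<Sum>i<k. \<Sum>j<k. \<Sum>r<n. \<Sum>s<n. a i j $$ (r, s) * u j s * cnj (u i r)))"
proof -
  have form: "(\<Sum>x<k * n. \<Sum>y<k * n. block_mat k n a $$ (x, y) * f y * cnj (f x))
      = (\<Sum>i<k. \<Sum>j<k. \<Sum>r<n. \<Sum>s<n. a i j $$ (r, s) * f (j * n + s) * cnj (f (i * n + r)))" for f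
  proof -
    have "(\<Sum>x<k * n. \<Sum>y<k * n. block_mat k n a $$ (x, y) * f y * cnj (f x))
      = (\<Sum>i<k. \<Sum>r<n. \<Sum>j<k. \<Sum>s<n. a i j $$ (r, s) * f (j * n + s) * cnj (f (i * n + r)))"
      unfolding sum_blocks by (intro sum.cong refl) (simp add: block_mat_index)
    also have "\<dots> = (\<Sum>i<k. \<Sum>j<k. \<Sum>r<n. \<Sum>s<n. a i j $$ (r, s) * f (j * n + s) * cnj (f (i * n + r)))"
      by (intro sum.cong refl sum.swap)
    finally show ?thesis .
  qed
  show ?thesis
    unfolding psd_iff_sum form
  proof (intro iffI conjI allI)
    fix u :: "nat \<Rightarrow> nat \<Rightarrow> complex"
    assume H: "block_mat k n a \<in> carrier_mat (k * n) (k * n) \<and> (\<forall>f :: nat \<Rightarrow> complex. 0 \<le> (\<Sum>i<k. \<Sum>j<k. \<Sum>r<n. \<Sum>s<n. a i j $$ (r, s) * f (j * n + s) * cnj (f (i * n + r))))"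
    have "(\<Sum>i<k. \<Sum>j<k. \<Sum>r<n. \<Sum>s<n. a i j $$ (r, s) * u j s * cnj (u i r)) =
       (\<Sum>i<k. \<Sum>j<k. \<Sum>r<n. \<Sum>s<n. a i j $$ (r, s) * u ((j * n + s) div n) ((j * n + s) mod n) * cnj (u ((i * n + r) div n) ((i * n + r) mod n)))"
      by (intro sum.cong refl) simp
    also have "0 \<le> \<dots>" using H[THEN conjunct2, THEN spec, of "\<lambda>t. u (t div n) (t mod n)"] .
    finally show "0 \<le> (\<Sum>i<k. \<Sum>j<k. \<Sum>r<n. \<Sum>s<n. a i j $$ (r, s) * u j s * cnj (u i r))" .
  next
    fix f :: "nat \<Rightarrow> complex"
    assume H: "\<forall>u :: nat \<Rightarrow> nat \<Rightarrow> complex. 0 \<le> (\<Sum>i<k. \<Sum>j<k. \<Sum>r<n. \<Sum>s<n. a i j $$ (r, s) * u j s * cnj (u i r))"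
    show "0 \<le> (\<Sum>i<k. \<Sum>j<k. \<Sum>r<n. \<Sum>s<n. a i j $$ (r, s) * f (j * n + s) * cnj (f (i * n + r)))"
      using H[THEN spec, of "\<lambda>i r. f (i * n + r)"] by simp
  qed simp
qed

text \<open>Polarization: the form is real at the vectors with entries 1, 1 and 1, i at the
  positions \<open>r\<close> and \<open>s\<close>; the first gives the imaginary part of the
  identity, the second the real part.\<close>

lemma psd_hermitian:
  assumes A: "psd n A" and r: "r < n" and s: "s < n"
  shows "A $$ (s, r) = cnj (A $$ (r, s))"
proof -
  have form: "0 \<le> A $$ (r, r) * a * cnj a + A $$ (s, s) * b * cnj b
      + A $$ (r, s) * b * cnj a + A $$ (s, r) * a * cnj b" if "r \<noteq> s" for a b :: complex
  proof -
    define f where "f = (\<lambda>t. if t = r then a else if t = s then b else 0)"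
    have "0 \<le> (\<Sum>x<n. \<Sum>y<n. A $$ (x, y) * f y * cnj (f x))" using A unfolding psd_iff_sum by blast
    also have "\<dots> = (\<Sum>x\<in>{r, s}. \<Sum>y<n. A $$ (x, y) * f y * cnj (f x))"
      using r s by (intro sum.mono_neutral_right) (auto simp: f_def)
    also have "\<dots> = (\<Sum>x\<in>{r, s}. \<Sum>y\<in>{r, s}. A $$ (x, y) * f y * cnj (f x))"
      using r s by (intro sum.cong refl sum.mono_neutral_right) (auto simp: f_def)
    also have "\<dots> = A $$ (r, r) * a * cnj a + A $$ (s, s) * b * cnj b
      + A $$ (r, s) * b * cnj a + A $$ (s, r) * a * cnj b"
      using that by (simp add: f_def algebra_simps)
    finally show ?thesis .
  qed
  have diag: "0 \<le> A $$ (t, t)" if t: "t < n" for t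
  proof -
    define f where "f = (\<lambda>x. if x = t then 1 else 0 :: complex)"
    have "0 \<le> (\<Sum>x<n. \<Sum>y<n. A $$ (x, y) * f y * cnj (f x))" using A unfolding psd_iff_sum by blast
    also have "\<dots> = (\<Sum>x<n. \<Sum>y<n. if y = t then (if x = t then A $$ (x, y) else 0) else 0)"
      by (intro sum.cong refl) (simp add: f_def)
    also have "\<dots> = A $$ (t, t)" using t by simp
    finally show ?thesis .
  qed
  show ?thesis
  proof (cases "r = s")
    case True
    then show ?thesis using diag[OF r] by (auto simp: complex_eq_iff zero_le_complex_iff)
  next
    case False
    have "Im (A $$ (r, s)) + Im (A $$ (s, r)) = 0" "Re (A $$ (r, s)) - Re (A $$ (s, r)) = 0"
      using form[OF False, of 1 1] form[OF False, of 1 \<i>] diag[OF r] diag[OF s]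
      by (auto simp: zero_le_complex_iff)
    then show ?thesis by (auto simp: complex_eq_iff)
  qed
qed

text \<open>\<open>V\<close> is the square root of the diagonal form times the adjoint of
  \<open>W\<close>. The point is that \<open>A\<close> becomes the Gram matrix of the columns of
  \<open>V\<close>.\<close>

lemma psd_eq_adjoint_mult:
  assumes A: "psd n A"
  obtains V where "V \<in> carrier_mat n n" "A = mat_adjoint V * V"
proof -
  have Ac: "A \<in> carrier_mat n n" using A unfolding psd_def by simp
  have adj: "mat_adjoint A = A"
  proof (rule eq_matI)
    fix i j assume "i < dim_row A" "j < dim_col A"
    then show "mat_adjoint A $$ (i, j) = A $$ (i, j)"
      using Ac psd_hermitian[OF A, of j i] by simp
  qed (use Ac in auto)
  obtain W e where W: "W \<in> carrier_mat n n" "mat_adjoint W * W = 1\<^sub>m n"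
    and D: "mat_adjoint W * A * W = diagm n e"
    using normal_diagonalization[OF Ac] adj by auto
  note WW = unitary_right_inverse[OF W]
  note assoc = assoc_mult_mat[of _ n n _ n _ n]
  have aW: "mat_adjoint W \<in> carrier_mat n n" using W by simp
  have e: "0 \<le> e i" if i: "i < n" for i
  proof -
    have "e i = (mat_adjoint W * (A * W)) $$ (i, i)"
      using D i W(1) aW Ac by (simp add: diagm_def assoc)
    also have "\<dots> = (\<Sum>r<n. cnj (W $$ (r, i)) * (A * W) $$ (r, i))"
      using i W(1) Ac by (subst index_mult_mat_sum[of _ n n _ n]) (auto simp del: index_mult_mat(1))
    also have "\<dots> = (\<Sum>r<n. \<Sum>s<n. A $$ (r, s) * W $$ (s, i) * cnj (W $$ (r, i)))"
      using i W(1) Ac by (simp add: index_mult_mat_sum[of A n n W n] sum_distrib_left algebra_simps del: index_mult_mat(1))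
    also have "0 \<le> \<dots>"
      using A[unfolded psd_iff_sum, THEN conjunct2, THEN spec, of "\<lambda>s. W $$ (s, i)"] .
    finally show ?thesis .
  qed
  define V where "V = diagm n (\<lambda>i. complex_of_real (sqrt (Re (e i)))) * mat_adjoint W"
  have V: "V \<in> carrier_mat n n" unfolding V_def using aW by (intro mult_carrier_mat) auto
  have AW: "A = W * (diagm n e * mat_adjoint W)"
  proof -
    have "W * (diagm n e * mat_adjoint W) = (W * mat_adjoint W) * A * (W * mat_adjoint W)"
      unfolding D[symmetric] using W(1) aW Ac by (simp add: assoc mult_carrier_mat[of _ n n])
    then show ?thesis using WW Ac by simp
  qed
  have "mat_adjoint V * V = A"
  proof (rule eq_matI)
    fix i j assume "i < dim_row A" "j < dim_col A"
    then have i: "i < n" and j: "j < n" using Ac by auto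
    have Vij: "V $$ (k, l) = complex_of_real (sqrt (Re (e k))) * cnj (W $$ (l, k))" if "k < n" "l < n" for k l
      unfolding V_def using that W by (subst index_diagm_mult[of _ _ n]) auto
    have "(mat_adjoint V * V) $$ (i, j) = (\<Sum>k<n. cnj (V $$ (k, i)) * V $$ (k, j))"
      using V i j by (subst index_mult_mat_sum[of _ n n _ n]) auto
    also have "\<dots> = (\<Sum>k<n. W $$ (i, k) * (e k * cnj (W $$ (j, k))))"
    proof (rule sum.cong[OF refl])
      fix k assume "k \<in> {..<n}"
      then have k: "k < n" by simp
      have "complex_of_real (sqrt (Re (e k))) * complex_of_real (sqrt (Re (e k))) = e k"
        using e[OF k] unfolding of_real_mult[symmetric] by (simp add: zero_le_complex_iff complex_eq_iff)
      then show "cnj (V $$ (k, i)) * V $$ (k, j) = W $$ (i, k) * (e k * cnj (W $$ (j, k)))"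
        unfolding Vij[OF k i] Vij[OF k j] by (simp add: algebra_simps)
    qed
    also have "\<dots> = (W * (diagm n e * mat_adjoint W)) $$ (i, j)"
      using W aW i j by (subst index_mult_mat_sum[of _ n n _ n])
        (auto simp: index_diagm_mult[OF aW] simp del: index_mult_mat(1) intro!: mult_carrier_mat[of _ n n])
    finally show "(mat_adjoint V * V) $$ (i, j) = A $$ (i, j)" using AW by simp
  qed (use V Ac in auto)
  then show ?thesis using that V by metis
qed


lemma block_toeplitz_entry:
  assumes "i \<le> d" "j \<le> d" "r < n" "s < n"
  shows "block_toeplitz d n as $$ (i * n + r, j * n + s) =
    (if i = j then 1\<^sub>m n else if j < i then as ! (i - j - 1) else mat_adjoint (as ! (j - i - 1))) $$ (r, s)"
  using assms unfolding block_toeplitz_def by (subst block_mat_index) auto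

text \<open>The measure has one node per eigenvalue of a unitary of size \<open>Suc d * n\<close>
  and rank-one weights with entries \<open>cnj (y j r) * y j s\<close>. Since \<open>V\<close> is
  square, the isometry between spans of columns already extends to a unitary of that finite
  size.\<close>

theorem block_toeplitz_moments:
  assumes T: "psd (Suc d * n) (block_toeplitz d n as)"
    and as: "as \<in> mat_tuples d n"
  obtains z :: "nat \<Rightarrow> complex" and y :: "nat \<Rightarrow> nat \<Rightarrow> complex"
  where "\<And>j. j < Suc d * n \<Longrightarrow> cmod (z j) = 1"
    "\<And>r s. r < n \<Longrightarrow> s < n \<Longrightarrow> (\<Sum>j<Suc d * n. cnj (y j r) * y j s) = (if r = s then 1 else 0)"
    "\<And>l r s. l < d \<Longrightarrow> r < n \<Longrightarrow> s < n \<Longrightarrow>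
      (as ! l) $$ (r, s) = (\<Sum>j<Suc d * n. z j ^ Suc l * (cnj (y j r) * y j s))"
proof -
  let ?N = "Suc d * n"
  define T where "T = block_toeplitz d n as"
  obtain V where V: "V \<in> carrier_mat ?N ?N" and TV: "T = mat_adjoint V * V"
    using psd_eq_adjoint_mult[OF assms(1)] unfolding T_def by blast
  have inner: "col V s \<bullet>c col V r = T $$ (r, s)" if "r < ?N" "s < ?N" for r s
  proof -
    have "T $$ (r, s) = (\<Sum>k<?N. cnj (V $$ (k, r)) * V $$ (k, s))"
      unfolding TV using V that by (subst index_mult_mat_sum[of _ ?N ?N _ ?N]) (auto simp del: mult_Suc)
    also have "\<dots> = col V s \<bullet>c col V r"
      using V that by (subst cscalar_prod_sum[of _ ?N]) (auto simp: mult.commute simp del: mult_Suc)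
    finally show ?thesis by simp
  qed
  \<comment> \<open>Toeplitz structure means that moving both indices by one block changes nothing:
    the first \<open>d\<close> and the last \<open>d\<close> blocks of columns of \<open>V\<close>
    have equal Gram matrices.\<close>
  have shift: "T $$ (r + n, s + n) = T $$ (r, s)" if "r < d * n" "s < d * n" for r s
  proof -
    have n: "0 < n" using that by (cases n) auto
    have r: "r div n < d" "s div n < d" "r mod n < n" "s mod n < n"
      using that n by (auto simp: less_mult_imp_div_less)
    have 1: "r = r div n * n + r mod n" "s = s div n * n + s mod n"
      "r + n = Suc (r div n) * n + r mod n" "s + n = Suc (s div n) * n + s mod n" by auto
    have "T $$ (r, s) = (if r div n = s div n then 1\<^sub>m n else if s div n < r div n then as ! (r div n - s div n - 1)
        else mat_adjoint (as ! (s div n - r div n - 1))) $$ (r mod n, s mod n)"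
      using block_toeplitz_entry[of "r div n" d "s div n" "r mod n" n "s mod n" as] r
      unfolding T_def 1(1,2)[symmetric] by auto
    moreover have "T $$ (r + n, s + n) = (if r div n = s div n then 1\<^sub>m n else if s div n < r div n then as ! (r div n - s div n - 1)
        else mat_adjoint (as ! (s div n - r div n - 1))) $$ (r mod n, s mod n)"
      using block_toeplitz_entry[of "Suc (r div n)" d "Suc (s div n)" "r mod n" n "s mod n" as] r
      unfolding T_def 1(3,4)[symmetric] by auto
    ultimately show ?thesis by simp
  qed
  have "\<exists>U. U \<in> carrier_mat ?N ?N \<and> mat_adjoint U * U = 1\<^sub>m ?N \<and> (\<forall>s<d * n. U *\<^sub>v col V s = col V (s + n))"
    by (rule unitary_extension) (use V shift inner in \<open>auto intro!: carrier_vecI\<close>)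
  then obtain U where U: "U \<in> carrier_mat ?N ?N" "mat_adjoint U * U = 1\<^sub>m ?N"
    and UV: "\<And>s. s < d * n \<Longrightarrow> U *\<^sub>v col V s = col V (s + n)" by blast
  obtain W e where W: "W \<in> carrier_mat ?N ?N" "mat_adjoint W * W = 1\<^sub>m ?N"
    and D: "mat_adjoint W * U * W = diagm ?N e"
    using normal_diagonalization[OF U(1)] U(2) unitary_right_inverse[OF U] by auto
  note WW = unitary_right_inverse[OF W]
  note assoc = assoc_mult_mat[of _ ?N ?N _ ?N _ ?N]
  have aW: "mat_adjoint W \<in> carrier_mat ?N ?N" using W by simp
  have e1: "cnj (e j) * e j = 1" if j: "j < ?N" for j
  proof -
    have "mat_adjoint (diagm ?N e) * diagm ?N e = 1\<^sub>m ?N"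
      unfolding D[symmetric] using W U aW WW unitary_right_inverse[OF U]
      by (intro unitary_mult) (auto intro!: mult_carrier_mat[of _ ?N ?N])
    then have "(mat_adjoint (diagm ?N e) * diagm ?N e) $$ (j, j) = 1" using j by simp
    moreover have "mat_adjoint (diagm ?N e) = diagm ?N (\<lambda>j. cnj (e j))"
      by (rule eq_matI) (auto simp: diagm_def)
    moreover have "(diagm ?N (\<lambda>j. cnj (e j)) * diagm ?N e) $$ (j, j) = cnj (e j) * e j"
      using j by (subst index_diagm_mult[of _ _ ?N]) (auto simp: diagm_def)
    ultimately show ?thesis by simp
  qed
  \<comment> \<open>The columns of \<open>V\<close> in the eigenbasis of \<open>U\<close>. There the
    shift by one block multiplies row \<open>j\<close> by \<open>e j\<close>, so block
    \<open>l\<close> of that row is \<open>e j ^ l\<close> times block 0.\<close>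
  define Z where "Z = mat_adjoint W * V"
  have Z: "Z \<in> carrier_mat ?N ?N" unfolding Z_def using aW V by (rule mult_carrier_mat)
  have ZT: "mat_adjoint Z * Z = T"
  proof -
    have "mat_adjoint Z * Z = mat_adjoint V * ((W * mat_adjoint W) * V)"
      unfolding Z_def using W(1) aW V
      by (simp add: mat_adjoint_mult[of _ ?N ?N _ ?N] assoc mult_carrier_mat[of _ ?N ?N] del: mult_Suc)
    then show ?thesis unfolding TV WW using V by simp
  qed
  have Zs: "Z $$ (j, s + n) = e j * Z $$ (j, s)" if j: "j < ?N" and s: "s < d * n" for j s
  proof -
    have c: "col V s \<in> carrier_vec ?N" "col V (s + n) \<in> carrier_vec ?N" using V by (auto intro!: carrier_vecI)
    have colZ: "col Z t = mat_adjoint W *\<^sub>v col V t" if "t < ?N" for t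
      unfolding Z_def using that aW V by (intro col_mult2[of _ ?N ?N _ ?N]) auto
    have "mat_adjoint W *\<^sub>v col V (s + n) = mat_adjoint W *\<^sub>v (U *\<^sub>v ((W * mat_adjoint W) *\<^sub>v col V s))"
      using UV[OF s] WW c by simp
    also have "\<dots> = (mat_adjoint W * U * W) *\<^sub>v (mat_adjoint W *\<^sub>v col V s)"
      using aW W(1) U(1) c
      by (simp add: assoc_mult_mat_vec[of _ ?N ?N _ ?N] mult_carrier_mat[of _ ?N ?N] mult_mat_vec_carrier[of _ ?N ?N]
          del: mult_Suc)
    also have "\<dots> = diagm ?N e *\<^sub>v col Z s"
      unfolding D using colZ[of s] s by simp
    finally have "col Z (s + n) = diagm ?N e *\<^sub>v col Z s" using colZ[of "s + n"] s by simp
    moreover have "(diagm ?N e *\<^sub>v col Z s) $ j = (diagm ?N e * Z) $$ (j, s)"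
      using Z j s by (auto simp: diagm_def)
    ultimately show ?thesis
      using index_diagm_mult[OF Z, of j s e] Z j s by (metis add.commute add_strict_right_mono index_col carrier_matD mult_Suc trans_less_add2)
  qed
  have Zp: "Z $$ (j, l * n + s) = e j ^ l * Z $$ (j, s)" if j: "j < ?N" and l: "l \<le> d" and s: "s < n" for j l s
    using l
  proof (induction l)
    case (Suc l)
    then have "l * n + s < d * n" using s block_index_less[of l d s n] by simp
    then show ?case using Zs[OF j, of "l * n + s"] Suc by (simp add: add_ac)
  qed simp
  have Tsum: "T $$ (r, s) = (\<Sum>j<?N. cnj (Z $$ (j, r)) * Z $$ (j, s))" if "r < ?N" "s < ?N" for r s
    unfolding ZT[symmetric] using Z that by (subst index_mult_mat_sum[of _ ?N ?N _ ?N]) (auto simp del: mult_Suc)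
  \<comment> \<open>The nodes are the conjugate eigenvalues, because block \<open>(l, 0)\<close> of
    \<open>T\<close> carries the power of \<open>e j\<close> in its conjugated factor.\<close>
  show ?thesis
  proof (rule that[of "\<lambda>j. cnj (e j)" "\<lambda>j s. Z $$ (j, s)"])
    fix j assume "j < ?N"
    then have "complex_of_real ((cmod (cnj (e j)))\<^sup>2) = 1"
      unfolding complex_norm_square using e1 by (simp add: mult.commute)
    then have "(cmod (cnj (e j)))\<^sup>2 = 1" unfolding of_real_eq_1_iff .
    then show "cmod (cnj (e j)) = 1" using power2_eq_imp_eq[of "cmod (cnj (e j))" 1] by simp
  next
    fix r s assume rs: "r < n" "s < n"
    show "(\<Sum>j<?N. cnj (Z $$ (j, r)) * Z $$ (j, s)) = (if r = s then 1 else 0)"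
      using block_toeplitz_entry[of 0 d 0 r n s as] rs Tsum[of r s] unfolding T_def by simp
  next
    fix l r s assume l: "l < d" and rs: "r < n" "s < n"
    have lt: "Suc l * n + r < ?N" using block_index_less[of "Suc l" "Suc d" r n] l rs by simp
    have "(as ! l) $$ (r, s) = T $$ (Suc l * n + r, s)"
      using block_toeplitz_entry[of "Suc l" d 0 r n s as] rs l unfolding T_def by simp
    also have "\<dots> = (\<Sum>j<?N. cnj (Z $$ (j, Suc l * n + r)) * Z $$ (j, s))"
      using lt rs by (intro Tsum) auto
    also have "\<dots> = (\<Sum>j<?N. cnj (e j) ^ Suc l * (cnj (Z $$ (j, r)) * Z $$ (j, s)))"
      using l rs by (intro sum.cong refl, subst Zp) auto
    finally show "(as ! l) $$ (r, s) = (\<Sum>j<?N. cnj (e j) ^ Suc l * (cnj (Z $$ (j, r)) * Z $$ (j, s)))" .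
  qed
qed

lemma sum_swap_pairs:
  "(\<Sum>a\<in>A. \<Sum>b\<in>B. \<Sum>r\<in>R. \<Sum>s\<in>S. f a b r s) = (\<Sum>r\<in>R. \<Sum>s\<in>S. \<Sum>a\<in>A. \<Sum>b\<in>B. f a b r s)"
proof -
  have "(\<Sum>a\<in>A. \<Sum>b\<in>B. \<Sum>r\<in>R. \<Sum>s\<in>S. f a b r s) = (\<Sum>a\<in>A. \<Sum>r\<in>R. \<Sum>s\<in>S. \<Sum>b\<in>B. f a b r s)"
    by (subst sum.swap, intro sum.cong refl, rule sum.swap)
  also have "\<dots> = (\<Sum>r\<in>R. \<Sum>s\<in>S. \<Sum>a\<in>A. \<Sum>b\<in>B. f a b r s)"
    by (subst sum.swap, intro sum.cong refl, rule sum.swap)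
  finally show ?thesis .
qed

lemma sum_swap_triple:
  "(\<Sum>a\<in>A. \<Sum>b\<in>B. \<Sum>j\<in>J. f a b j) = (\<Sum>j\<in>J. \<Sum>a\<in>A. \<Sum>b\<in>B. f a b j)"
proof -
  have "(\<Sum>b\<in>B. \<Sum>j\<in>J. f a b j) = (\<Sum>j\<in>J. \<Sum>b\<in>B. f a b j)" for a
    by (rule sum.swap)
  then show ?thesis using sum.swap[of "\<lambda>a j. \<Sum>b\<in>B. f a b j" J A] by simp
qed

lemma mult_sum_cnj_sum:
  "(h :: complex) * (\<Sum>b\<in>B. f b) * cnj (\<Sum>a\<in>A. g a) = (\<Sum>a\<in>A. \<Sum>b\<in>B. h * f b * cnj (g a))"
proof -
  have "(\<Sum>b\<in>B. f b) * cnj (\<Sum>a\<in>A. g a) = (\<Sum>a\<in>A. \<Sum>b\<in>B. cnj (g a) * f b)"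
    by (subst mult.commute) (simp only: cnj_sum sum_product)
  then have "h * ((\<Sum>b\<in>B. f b) * cnj (\<Sum>a\<in>A. g a)) = (\<Sum>a\<in>A. \<Sum>b\<in>B. h * (cnj (g a) * f b))"
    by (simp only: sum_distrib_left)
  then show ?thesis by (simp only: mult_ac)
qed

lemma sesquilinear_sum:
  fixes H :: "nat \<Rightarrow> nat \<Rightarrow> complex"
  shows "(\<Sum>r\<in>R. \<Sum>s\<in>S. H r s * (\<Sum>b\<in>B. v b s) * cnj (\<Sum>a\<in>A. w a r))
    = (\<Sum>a\<in>A. \<Sum>b\<in>B. \<Sum>r\<in>R. \<Sum>s\<in>S. H r s * v b s * cnj (w a r))"
  unfolding mult_sum_cnj_sum by (rule sum_swap_pairs)

lemma index_adjoint_mult_mult: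
  fixes G Q :: "complex mat"
  assumes Q: "Q \<in> carrier_mat k k" and G: "G \<in> carrier_mat k n" and "r < n" "s < n"
  shows "(mat_adjoint G * Q * G) $$ (r, s) = (\<Sum>x<k. \<Sum>y<k. Q $$ (x, y) * G $$ (y, s) * cnj (G $$ (x, r)))"
proof -
  have "(mat_adjoint G * Q * G) $$ (r, s) = (\<Sum>y<k. (\<Sum>x<k. cnj (G $$ (x, r)) * Q $$ (x, y)) * G $$ (y, s))"
    using assms by (simp add: index_mult_mat_sum[of _ n k _ n] index_mult_mat_sum[of _ n k _ k]
        mult_carrier_mat[of _ n k] del: index_mult_mat(1))
  also have "\<dots> = (\<Sum>y<k. \<Sum>x<k. Q $$ (x, y) * G $$ (y, s) * cnj (G $$ (x, r)))"
    by (intro sum.cong refl) (simp add: sum_distrib_left sum_distrib_right mult_ac)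
  also have "\<dots> = (\<Sum>x<k. \<Sum>y<k. Q $$ (x, y) * G $$ (y, s) * cnj (G $$ (x, r)))"
    by (rule sum.swap)
  finally show ?thesis .
qed

lemma psd_congruence:
  fixes G :: "complex mat"
  assumes Q: "Q \<in> carrier_mat k k" and G: "G \<in> carrier_mat k n"
  shows "(\<Sum>r<n. \<Sum>s<n. (mat_adjoint G * Q * G) $$ (r, s) * v s * cnj (w r))
    = (\<Sum>x<k. \<Sum>y<k. Q $$ (x, y) * (\<Sum>s<n. G $$ (y, s) * v s) * cnj (\<Sum>r<n. G $$ (x, r) * w r))"
proof -
  have "(\<Sum>r<n. \<Sum>s<n. (mat_adjoint G * Q * G) $$ (r, s) * v s * cnj (w r))
    = (\<Sum>r<n. \<Sum>s<n. \<Sum>x<k. \<Sum>y<k. Q $$ (x, y) * (G $$ (y, s) * v s) * cnj (G $$ (x, r) * w r))"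
    by (intro sum.cong refl) (simp add: index_adjoint_mult_mult[OF assms] sum_distrib_left sum_distrib_right mult_ac)
  then show ?thesis unfolding sesquilinear_sum .
qed

section \<open>The minimal matrix convex set of the circle curve as a positivity condition\<close>

definition toeplitz_entry :: "nat \<Rightarrow> complex mat list \<Rightarrow> nat \<Rightarrow> nat \<Rightarrow> complex mat" where
  "toeplitz_entry n as i j = (if i = j then 1\<^sub>m n else if j < i then as ! (i - j - 1)
     else mat_adjoint (as ! (j - i - 1)))"

lemma mat_tuples_nth: "as \<in> mat_tuples d n \<Longrightarrow> l < d \<Longrightarrow> as ! l \<in> carrier_mat n n"
  unfolding mat_tuples_def using nth_mem[of l as] by (auto simp: subset_iff)

lemma toeplitz_entry_carrier:
  "as \<in> mat_tuples d n \<Longrightarrow> i \<le> d \<Longrightarrow> j \<le> d \<Longrightarrow> toeplitz_entry n as i j \<in> carrier_mat n n"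
  unfolding toeplitz_entry_def using mat_tuples_nth[of as d n] by simp

lemma toeplitz_entry_adjoint:
  "as \<in> mat_tuples d n \<Longrightarrow> i \<le> d \<Longrightarrow> j \<le> d \<Longrightarrow> r < n \<Longrightarrow> s < n \<Longrightarrow>
    toeplitz_entry n as i j $$ (r, s) = cnj (toeplitz_entry n as j i $$ (s, r))"
  using toeplitz_entry_carrier[of as d n i j] toeplitz_entry_carrier[of as d n j i]
  unfolding toeplitz_entry_def by (auto split: if_splits)

lemma psd_block_toeplitz_iff:
  "psd (Suc d * n) (block_toeplitz d n as) \<longleftrightarrow> (\<forall>u :: nat \<Rightarrow> nat \<Rightarrow> complex.
    0 \<le> (\<Sum>i<Suc d. \<Sum>j<Suc d. \<Sum>r<n. \<Sum>s<n. toeplitz_entry n as i j $$ (r, s) * u j s * cnj (u i r)))"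
  unfolding block_toeplitz_def psd_block_mat_iff toeplitz_entry_def ..

lemma conv_circleE:
  assumes "p \<in> conv_tuples d (circle_curve d)"
  obtains m :: nat and t :: "nat \<Rightarrow> real" and z where
    "\<And>i. i < m \<Longrightarrow> 0 \<le> t i" "\<And>i. i < m \<Longrightarrow> cmod (z i) = 1" "(\<Sum>i<m. t i) = 1"
    "\<And>l. l < d \<Longrightarrow> p ! l = (\<Sum>i<m. complex_of_real (t i) * z i ^ Suc l)"
proof -
  obtain m :: nat and t :: "nat \<Rightarrow> real" and q where q: "\<And>i. i < m \<Longrightarrow> q i \<in> circle_curve d \<and> 0 \<le> t i"
    and t: "(\<Sum>i<m. t i) = 1"
    and p: "p = map (\<lambda>l. \<Sum>i<m. complex_of_real (t i) * (q i ! l)) [0..<d]"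
    using assms unfolding conv_tuples_def by blast
  have "\<forall>i. \<exists>z. i < m \<longrightarrow> cmod z = 1 \<and> q i = map (\<lambda>l. z ^ l) [1..<Suc d]"
    using q unfolding circle_curve_def by blast
  then obtain z where z: "\<And>i. i < m \<Longrightarrow> cmod (z i) = 1 \<and> q i = map (\<lambda>l. z i ^ l) [1..<Suc d]"
    by metis
  show ?thesis
  proof (rule that[of m t z])
    fix l assume l: "l < d"
    then show "p ! l = (\<Sum>i<m. complex_of_real (t i) * z i ^ Suc l)"
      unfolding p using z by (auto intro!: sum.cong simp del: upt_Suc)
  qed (use q t z in auto)
qed

lemma circle_curve_subset_conv: "circle_curve d \<subseteq> conv_tuples d (circle_curve d)"
proof
  fix p assume p: "p \<in> circle_curve d"
  then have "length p = d" unfolding circle_curve_def by auto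
  then have "p = map (\<lambda>l. \<Sum>j<1::nat. complex_of_real 1 * (p ! l)) [0..<d]"
    by (auto intro!: nth_equalityI)
  then show "p \<in> conv_tuples d (circle_curve d)"
    unfolding conv_tuples_def using p
    by (intro CollectI exI[of _ 1] exI[of _ "\<lambda>_. 1"] exI[of _ "\<lambda>_. p"]) auto
qed

text \<open>The left side is an entry of a rank-one positive matrix, the right side the same entry
  of the scalar Toeplitz matrix of the point \<open>z\<close>: this is why points of the curve have
  positive Toeplitz matrices.\<close>

lemma cmod_1_powers:
  assumes "cmod z = 1"
  shows "z ^ i * cnj z ^ j = (if j \<le> i then z ^ (i - j) else cnj z ^ (j - i))"
proof -
  have zz: "z ^ k * cnj z ^ k = 1" for k
    using assms by (simp add: power_mult_distrib[symmetric] complex_norm_square[symmetric])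
  show ?thesis
  proof (cases "j \<le> i")
    case True
    then have "z ^ i = z ^ (i - j) * z ^ j" by (simp add: power_add[symmetric])
    then show ?thesis using zz[of j] True by simp
  next
    case False
    then have "cnj z ^ j = cnj z ^ i * cnj z ^ (j - i)" by (simp add: power_add[symmetric])
    then show ?thesis using zz[of i] False by (simp add: mult.assoc[symmetric])
  qed
qed

text \<open>The Toeplitz matrix is the sum over \<open>j\<close> of \<open>h j\<close> tensored with
  the scalar Toeplitz matrix \<open>q j\<close> of the point \<open>p j\<close>. Each
  \<open>q j\<close> is a convex combination of rank-one positive matrices, so everything reduces to
  nonnegative multiples of forms of \<open>h j\<close>.\<close>

lemma min_circle_imp_psd:
  assumes as: "as \<in> mat_tuples d n"
    and hp: "\<And>j. j < m \<Longrightarrow> psd n (h j) \<and> p j \<in> conv_tuples d (circle_curve d)"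
    and h1: "mat_sum n m h = 1\<^sub>m n"
    and asl: "\<And>l. l < d \<Longrightarrow> as ! l = mat_sum n m (\<lambda>j. (p j ! l) \<cdot>\<^sub>m h j)"
  shows "psd (Suc d * n) (block_toeplitz d n as)"
  unfolding psd_block_toeplitz_iff
proof
  fix u :: "nat \<Rightarrow> nat \<Rightarrow> complex"
  have hc: "h j \<in> carrier_mat n n" if "j < m" for j using hp[OF that] unfolding psd_def by blast
  have hd: "dim_row (h j) = n" "dim_col (h j) = n" if "j < m" for j using hc[OF that] by auto
  define q where "q = (\<lambda>j a b. if a = b then 1 else if b < a then p j ! (a - b - 1) else cnj (p j ! (b - a - 1)))"
  have entry: "toeplitz_entry n as a b $$ (r, s) = (\<Sum>j<m. q j a b * h j $$ (r, s))"
    if "a \<le> d" "b \<le> d" "r < n" "s < n" for a b r s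
  proof -
    have lower: "toeplitz_entry n as a b $$ (r, s) = (\<Sum>j<m. q j a b * h j $$ (r, s))"
      if "b < a" "a \<le> d" "r < n" "s < n" for a b r s
      using that asl[of "a - b - 1"] hd
      by (auto simp: toeplitz_entry_def q_def mat_sum_def intro!: sum.cong)
    consider "b < a" | "a < b" | "a = b" by linarith
    then show ?thesis
    proof cases
      case 1
      then show ?thesis using lower that by simp
    next
      case 2
      have "toeplitz_entry n as a b $$ (r, s) = cnj (\<Sum>j<m. q j b a * h j $$ (s, r))"
        using toeplitz_entry_adjoint[OF as that] lower[OF 2 that(2,4,3)] by simp
      also have "\<dots> = (\<Sum>j<m. q j a b * h j $$ (r, s))"
        unfolding cnj_sum
      proof (rule sum.cong[OF refl])
        fix j assume "j \<in> {..<m}"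
        then have "h j $$ (r, s) = cnj (h j $$ (s, r))" using psd_hermitian[of n "h j" s r] hp that by auto
        then show "cnj (q j b a * h j $$ (s, r)) = q j a b * h j $$ (r, s)"
          using 2 by (simp add: q_def)
      qed
      finally show ?thesis .
    next
      case 3
      have "mat_sum n m h $$ (r, s) = (\<Sum>j<m. h j $$ (r, s))" using that by (simp add: mat_sum_def)
      then show ?thesis using 3 h1 by (simp add: toeplitz_entry_def q_def)
    qed
  qed
  have pos: "0 \<le> (\<Sum>a<Suc d. \<Sum>b<Suc d. \<Sum>r<n. \<Sum>s<n. q j a b * h j $$ (r, s) * u b s * cnj (u a r))"
    if j: "j < m" for j
  proof -
    obtain k and t :: "nat \<Rightarrow> real" and z where t: "\<And>i. i < k \<Longrightarrow> 0 \<le> t i" and z: "\<And>i. i < k \<Longrightarrow> cmod (z i) = 1"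
      and t1: "(\<Sum>i<k. t i) = 1" and pz: "\<And>l. l < d \<Longrightarrow> p j ! l = (\<Sum>i<k. complex_of_real (t i) * z i ^ Suc l)"
      using conv_circleE[OF hp[OF j, THEN conjunct2]] by blast
    have qz: "q j a b = (\<Sum>i<k. complex_of_real (t i) * (z i ^ a * cnj (z i) ^ b))" if "a \<le> d" "b \<le> d" for a b
    proof -
      consider "b < a" | "a < b" | "a = b" by linarith
      then show ?thesis
      proof cases
        case 1
        then have "Suc (a - b - 1) = a - b" "a - b - 1 < d" using that by auto
        then show ?thesis using 1 pz[of "a - b - 1"] z
          by (auto simp: q_def cmod_1_powers intro!: sum.cong simp del: power_Suc)
      next
        case 2
        then have "Suc (b - a - 1) = b - a" "b - a - 1 < d" using that by auto
        then show ?thesis using 2 pz[of "b - a - 1"] z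
          by (auto simp: q_def cmod_1_powers intro!: sum.cong simp del: power_Suc)
      next
        case 3
        have "(\<Sum>i<k. complex_of_real (t i)) = 1" using t1 by (metis of_real_sum of_real_1)
        then show ?thesis using 3 z by (simp add: q_def cmod_1_powers)
      qed
    qed
    \<comment> \<open>Contracting \<open>u\<close> with the rank-one factor of the node
      \<open>z i\<close> leaves the form of \<open>h j\<close> at the single vector
      \<open>w i\<close>.\<close>
    define w where "w = (\<lambda>i s. \<Sum>b<Suc d. cnj (z i) ^ b * u b s)"
    have "(\<Sum>a<Suc d. \<Sum>b<Suc d. \<Sum>r<n. \<Sum>s<n. q j a b * h j $$ (r, s) * u b s * cnj (u a r))
      = (\<Sum>a<Suc d. \<Sum>b<Suc d. \<Sum>i<k. complex_of_real (t i) * (\<Sum>r<n. \<Sum>s<n. h j $$ (r, s) * (cnj (z i) ^ b * u b s) * cnj (cnj (z i) ^ a * u a r)))"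
    proof (rule sum.cong[OF refl], rule sum.cong[OF refl], goal_cases)
      case (1 a b)
      then have q: "q j a b = (\<Sum>i<k. complex_of_real (t i) * (z i ^ a * cnj (z i) ^ b))" using qz by auto
      have "(\<Sum>r<n. \<Sum>s<n. q j a b * h j $$ (r, s) * u b s * cnj (u a r)) =
        q j a b * (\<Sum>r<n. \<Sum>s<n. h j $$ (r, s) * u b s * cnj (u a r))"
        by (simp add: sum_distrib_left mult.assoc)
      also have "\<dots> = (\<Sum>i<k. complex_of_real (t i) * (z i ^ a * cnj (z i) ^ b * (\<Sum>r<n. \<Sum>s<n. h j $$ (r, s) * u b s * cnj (u a r))))"
        unfolding q by (simp add: sum_distrib_right mult.assoc)
      also have "\<dots> = (\<Sum>i<k. complex_of_real (t i) * (\<Sum>r<n. \<Sum>s<n. h j $$ (r, s) * (cnj (z i) ^ b * u b s) * cnj (cnj (z i) ^ a * u a r)))"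
        by (intro sum.cong refl arg_cong2[where f = "(*)"]) (simp add: sum_distrib_left mult_ac)
      finally show ?case .
    qed
    also have "\<dots> = (\<Sum>i<k. \<Sum>a<Suc d. \<Sum>b<Suc d. complex_of_real (t i) * (\<Sum>r<n. \<Sum>s<n. h j $$ (r, s) * (cnj (z i) ^ b * u b s) * cnj (cnj (z i) ^ a * u a r)))"
      by (rule sum_swap_triple)
    also have "\<dots> = (\<Sum>i<k. complex_of_real (t i) * (\<Sum>r<n. \<Sum>s<n. h j $$ (r, s) * w i s * cnj (w i r)))"
      unfolding w_def sesquilinear_sum by (simp only: sum_distrib_left)
    also have "0 \<le> \<dots>"
    proof (rule sum_nonneg, rule mult_nonneg_nonneg)
      fix i assume "i \<in> {..<k}"
      then show "0 \<le> complex_of_real (t i)" using t by (simp add: zero_le_complex_iff)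
      show "0 \<le> (\<Sum>r<n. \<Sum>s<n. h j $$ (r, s) * w i s * cnj (w i r))"
        using hp[OF j, THEN conjunct1, unfolded psd_iff_sum] by simp
    qed
    finally show ?thesis .
  qed
  have "(\<Sum>a<Suc d. \<Sum>b<Suc d. \<Sum>r<n. \<Sum>s<n. toeplitz_entry n as a b $$ (r, s) * u b s * cnj (u a r))
    = (\<Sum>a<Suc d. \<Sum>b<Suc d. \<Sum>r<n. \<Sum>s<n. \<Sum>j<m. q j a b * h j $$ (r, s) * u b s * cnj (u a r))"
    by (intro sum.cong refl) (simp add: entry sum_distrib_right)
  also have "\<dots> = (\<Sum>a<Suc d. \<Sum>b<Suc d. \<Sum>j<m. \<Sum>r<n. \<Sum>s<n. q j a b * h j $$ (r, s) * u b s * cnj (u a r))"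
    by (rule sum.cong[OF refl], rule sum.cong[OF refl], rule sum_swap_triple)
  also have "\<dots> = (\<Sum>j<m. \<Sum>a<Suc d. \<Sum>b<Suc d. \<Sum>r<n. \<Sum>s<n. q j a b * h j $$ (r, s) * u b s * cnj (u a r))"
    by (rule sum_swap_triple)
  also have "0 \<le> \<dots>" by (rule sum_nonneg) (use pos in auto)
  finally show "0 \<le> (\<Sum>a<Suc d. \<Sum>b<Suc d. \<Sum>r<n. \<Sum>s<n. toeplitz_entry n as a b $$ (r, s) * u b s * cnj (u a r))" .
qed

text \<open>Each weight is the rank-one matrix of the vector \<open>y j\<close>, and each point lies
  on the curve itself, so the convex hull is met only in its generators.\<close>

lemma psd_imp_min_circle:
  assumes "psd (Suc d * n) (block_toeplitz d n as)" and as: "as \<in> mat_tuples d n"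
  shows "\<exists>m h p. (\<forall>j<m. psd n (h j) \<and> p j \<in> conv_tuples d (circle_curve d)) \<and> mat_sum n m h = 1\<^sub>m n
     \<and> (\<forall>l<d. as ! l = mat_sum n m (\<lambda>j. (p j ! l) \<cdot>\<^sub>m h j))"
proof -
  define N where "N = Suc d * n"
  obtain z y where z: "\<And>j. j < N \<Longrightarrow> cmod (z j) = 1"
    and y1: "\<And>r s. r < n \<Longrightarrow> s < n \<Longrightarrow> (\<Sum>j<N. cnj (y j r) * y j s) = (if r = s then 1 else 0)"
    and asl: "\<And>l r s. l < d \<Longrightarrow> r < n \<Longrightarrow> s < n \<Longrightarrow>
      (as ! l) $$ (r, s) = (\<Sum>j<N. z j ^ Suc l * (cnj (y j r) * y j s))"
    using block_toeplitz_moments[OF assms, folded N_def] by blast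
  define h where "h = (\<lambda>j. mat n n (\<lambda>(r, s). cnj (y j r) * y j s))"
  define p where "p = (\<lambda>j. map (\<lambda>l. z j ^ l) [1..<Suc d])"
  have psd: "psd n (h j)" for j
    unfolding psd_iff_sum
  proof (intro conjI allI)
    fix f :: "nat \<Rightarrow> complex"
    have "(\<Sum>r<n. \<Sum>s<n. h j $$ (r, s) * f s * cnj (f r)) = (\<Sum>r<n. cnj (y j r * f r)) * (\<Sum>s<n. y j s * f s)"
      unfolding sum_product by (intro sum.cong refl) (simp add: h_def mult_ac)
    also have "\<dots> = complex_of_real ((cmod (\<Sum>s<n. y j s * f s))\<^sup>2)"
      unfolding complex_norm_square by (simp add: mult.commute)
    also have "0 \<le> \<dots>" by (simp add: zero_le_complex_iff)
    finally show "0 \<le> (\<Sum>r<n. \<Sum>s<n. h j $$ (r, s) * f s * cnj (f r))" .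
  qed (simp add: h_def)
  moreover have "p j \<in> conv_tuples d (circle_curve d)" if "j < N" for j
    using z[OF that] circle_curve_subset_conv[of d] unfolding p_def circle_curve_def by blast
  moreover have "mat_sum n N h = 1\<^sub>m n"
    by (rule eq_matI) (auto simp: mat_sum_def h_def y1)
  moreover have "as ! l = mat_sum n N (\<lambda>j. (p j ! l) \<cdot>\<^sub>m h j)" if l: "l < d" for l
  proof (rule eq_matI)
    have "as ! l \<in> carrier_mat n n" using as l unfolding mat_tuples_def by auto
    then show "dim_row (as ! l) = dim_row (mat_sum n N (\<lambda>j. (p j ! l) \<cdot>\<^sub>m h j))"
      "dim_col (as ! l) = dim_col (mat_sum n N (\<lambda>j. (p j ! l) \<cdot>\<^sub>m h j))" by (auto simp: mat_sum_def)
  qed (use l in \<open>auto simp: mat_sum_def h_def p_def asl simp del: upt_Suc\<close>)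
  ultimately show ?thesis by blast
qed

theorem min_circle_eq_psd_block_toeplitz:
  "min_matrix_convex d (conv_tuples d (circle_curve d)) =
    (SIGMA n:{1..}. {as \<in> mat_tuples d n. psd (Suc d * n) (block_toeplitz d n as)})"
  unfolding min_matrix_convex_def
  using min_circle_imp_psd psd_imp_min_circle
  by (intro Sigma_cong refl Collect_cong conj_cong refl iffI) (blast, blast)

section \<open>Compactness and matrix convexity of the positivity condition\<close>

lemma psd_block_toeplitz_bound:
  assumes "psd (Suc d * n) (block_toeplitz d n as)" "as \<in> mat_tuples d n" and l: "l < d" and rs: "r < n" "s < n"
  shows "cmod ((as ! l) $$ (r, s)) \<le> 1"
proof -
  define N where "N = Suc d * n"
  obtain z y where z: "\<And>j. j < N \<Longrightarrow> cmod (z j) = 1"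
    and y1: "\<And>r s. r < n \<Longrightarrow> s < n \<Longrightarrow> (\<Sum>j<N. cnj (y j r) * y j s) = (if r = s then 1 else 0)"
    and asl: "\<And>l r s. l < d \<Longrightarrow> r < n \<Longrightarrow> s < n \<Longrightarrow>
      (as ! l) $$ (r, s) = (\<Sum>j<N. z j ^ Suc l * (cnj (y j r) * y j s))"
    using block_toeplitz_moments[OF assms(1,2), folded N_def] by blast
  have y2: "(\<Sum>j<N. (cmod (y j r))\<^sup>2) = 1" if "r < n" for r
  proof -
    have "complex_of_real (\<Sum>j<N. (cmod (y j r))\<^sup>2) = 1"
      using y1[OF that that] unfolding of_real_sum complex_norm_square by (simp add: mult.commute)
    then show ?thesis unfolding of_real_eq_1_iff .
  qed
  have "cmod ((as ! l) $$ (r, s)) \<le> (\<Sum>j<N. cmod (z j ^ Suc l * (cnj (y j r) * y j s)))"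
    unfolding asl[OF l rs] by (rule norm_sum)
  also have "\<dots> \<le> (\<Sum>j<N. ((cmod (y j r))\<^sup>2 + (cmod (y j s))\<^sup>2) / 2)"
  proof (rule sum_mono)
    fix j assume "j \<in> {..<N}"
    then have "cmod (z j ^ Suc l * (cnj (y j r) * y j s)) = cmod (y j r) * cmod (y j s)"
      using z by (simp add: norm_mult norm_power)
    then show "cmod (z j ^ Suc l * (cnj (y j r) * y j s)) \<le> ((cmod (y j r))\<^sup>2 + (cmod (y j s))\<^sup>2) / 2"
      using sum_squares_bound[of "cmod (y j r)" "cmod (y j s)"] by simp
  qed
  also have "\<dots> = 1" using y2 rs by (simp add: sum_divide_distrib[symmetric] sum.distrib)
  finally show ?thesis .
qed

text \<open>Tychonoff, in a form that can be iterated over curried arguments. The index type is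
  arbitrary, which later admits the type of all operators as index set.\<close>

lemma compact_function_space:
  fixes S :: "'a \<Rightarrow> 'b :: topological_space set"
  assumes "\<And>i. compact (S i)"
  shows "compact {f. \<forall>i. f i \<in> S i}"
proof -
  have "compactin (product_topology (\<lambda>_. euclidean) UNIV) (PiE UNIV S)"
    unfolding compactin_PiE using assms by (simp add: compactin_euclidean_iff)
  moreover have "PiE UNIV S = {f. \<forall>i. f i \<in> S i}" by (auto simp: PiE_def)
  ultimately show ?thesis by (simp add: euclidean_product_topology compactin_euclidean_iff)
qed


lemma continuous_on_triple_coordinate:
  "continuous_on UNIV (\<lambda>f :: 'a \<Rightarrow> 'b \<Rightarrow> 'c \<Rightarrow> 'd :: topological_space. f l r s)"
  by (rule continuous_on_product_then_coordinatewise[OF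
        continuous_on_product_then_coordinatewise[OF continuous_on_product_coordinates]])

lemma closed_nonneg_Collect:
  fixes g :: "'a :: topological_space \<Rightarrow> complex"
  assumes "continuous_on UNIV g"
  shows "closed {f. 0 \<le> g f}"
proof -
  have "closed ({f. 0 \<le> Re (g f)} \<inter> {f. Im (g f) = 0})"
    using assms by (intro closed_Int closed_Collect_le closed_Collect_eq continuous_on_Re continuous_on_Im
        continuous_on_const)
  moreover have "{f. 0 \<le> g f} = {f. 0 \<le> Re (g f)} \<inter> {f. Im (g f) = 0}"
    by (auto simp: zero_le_complex_iff)
  ultimately show ?thesis by simp
qed

lemma compact_psd_block_toeplitz:
  "compact (tuple_entries d n ` {as \<in> mat_tuples d n. psd (Suc d * n) (block_toeplitz d n as)})"
proof -
  define B where "B = {f :: nat \<Rightarrow> nat \<Rightarrow> nat \<Rightarrow> complex. \<forall>l. f l \<in> {g. \<forall>r. g r \<in> {h. \<forall>s. h s \<in>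
    (if l < d \<and> r < n \<and> s < n then cball 0 1 else {0})}}}"
  \<comment> \<open>The Toeplitz entries as functions of arbitrary arrays \<open>f\<close>, not only
    of entries of matrices, so that \<open>C\<close> is a closed subset of the whole function
    space.\<close>
  define E where "E = (\<lambda>(f :: nat \<Rightarrow> nat \<Rightarrow> nat \<Rightarrow> complex) i j r s. if i = j then (if r = s then 1 else 0)
    else if j < i then f (i - j - 1) r s else cnj (f (j - i - 1) s r))"
  define C where "C = {f. \<forall>u :: nat \<Rightarrow> nat \<Rightarrow> complex.
    0 \<le> (\<Sum>i<Suc d. \<Sum>j<Suc d. \<Sum>r<n. \<Sum>s<n. E f i j r s * u j s * cnj (u i r))}"
  have "compact B"
    unfolding B_def by (intro compact_function_space) auto
  moreover have "closed C"
  proof -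
    have E: "continuous_on UNIV (\<lambda>f. E f i j r s)" for i j r s
      unfolding E_def
      by (cases "i = j"; cases "j < i")
        (simp_all add: continuous_on_triple_coordinate continuous_on_cnj)
    have "closed {f. 0 \<le> (\<Sum>i<Suc d. \<Sum>j<Suc d. \<Sum>r<n. \<Sum>s<n. E f i j r s * u j s * cnj (u i r))}" for u :: "nat \<Rightarrow> nat \<Rightarrow> complex"
      by (intro closed_nonneg_Collect continuous_on_sum continuous_on_mult continuous_on_const E)
    moreover have "C = (\<Inter>u. {f. 0 \<le> (\<Sum>i<Suc d. \<Sum>j<Suc d. \<Sum>r<n. \<Sum>s<n. E f i j r s * u j s * cnj (u i r))})"
      unfolding C_def by auto
    ultimately show ?thesis by (simp only:) (rule closed_INT, rule ballI)
  qed
  moreover have "tuple_entries d n ` {as \<in> mat_tuples d n. psd (Suc d * n) (block_toeplitz d n as)} = B \<inter> C"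
  proof -
    have E: "E (tuple_entries d n as) i j r s = toeplitz_entry n as i j $$ (r, s)"
      if as: "as \<in> mat_tuples d n" and ij: "i < Suc d" "j < Suc d" and rs: "r < n" "s < n" for as i j r s
    proof -
      have dims: "dim_row (as ! l) = n" "dim_col (as ! l) = n" if "l < d" for l
        using mat_tuples_nth[OF as that] by auto
      consider "j < i" "i - j - 1 < d" | "i < j" "j - i - 1 < d" | "i = j" using ij by linarith
      then show ?thesis
        using rs by cases (simp_all add: E_def toeplitz_entry_def tuple_entries_def dims)
    qed
    have psd: "psd (Suc d * n) (block_toeplitz d n as) \<longleftrightarrow> tuple_entries d n as \<in> C"
      if as: "as \<in> mat_tuples d n" for as
    proof -
      have "(\<Sum>i<Suc d. \<Sum>j<Suc d. \<Sum>r<n. \<Sum>s<n. toeplitz_entry n as i j $$ (r, s) * u j s * cnj (u i r))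
        = (\<Sum>i<Suc d. \<Sum>j<Suc d. \<Sum>r<n. \<Sum>s<n. E (tuple_entries d n as) i j r s * u j s * cnj (u i r))" for u
        by (intro sum.cong refl arg_cong2[where f = "(*)"] E[OF as, symmetric]) simp_all
      then show ?thesis unfolding psd_block_toeplitz_iff C_def by simp
    qed
    show ?thesis
    proof (intro equalityI subsetI)
      fix f assume "f \<in> tuple_entries d n ` {as \<in> mat_tuples d n. psd (Suc d * n) (block_toeplitz d n as)}"
      then obtain as where as: "as \<in> mat_tuples d n" "psd (Suc d * n) (block_toeplitz d n as)"
        and f: "f = tuple_entries d n as" by blast
      have "f l r s \<in> (if l < d \<and> r < n \<and> s < n then cball 0 1 else {0})" for l r s
        unfolding f tuple_entries_def using psd_block_toeplitz_bound[OF as(2,1), of l r s] by simp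
      then have "f \<in> B" unfolding B_def by blast
      then show "f \<in> B \<inter> C" using psd as f by blast
    next
      fix f assume f: "f \<in> B \<inter> C"
      define as where "as = map (\<lambda>l. mat n n (\<lambda>(r, s). f l r s)) [0..<d]"
      have as: "as \<in> mat_tuples d n" unfolding as_def mat_tuples_def by auto
      have "f l r s = 0" if "\<not> (l < d \<and> r < n \<and> s < n)" for l r s
      proof -
        have "f l r s \<in> (if l < d \<and> r < n \<and> s < n then cball 0 1 else {0})"
          using f unfolding B_def by blast
        then show ?thesis using that by (simp split: if_splits)
      qed
      then have "tuple_entries d n as = f"
        by (intro ext) (auto simp: tuple_entries_def as_def)
      then show "f \<in> tuple_entries d n ` {as \<in> mat_tuples d n. psd (Suc d * n) (block_toeplitz d n as)}"
        using psd[OF as] as f by blast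
    qed
  qed
  ultimately show ?thesis by (simp add: compact_Int_closed)
qed

text \<open>Each block of the new Toeplitz matrix is the sum of the compressions by
  \<open>G j\<close> of the corresponding old blocks; on the diagonal this is the normalization
  \<open>G1\<close>. The form at \<open>u\<close> is therefore the sum of the old forms at the
  vectors obtained by applying \<open>G j\<close> to every component of \<open>u\<close>.\<close>

lemma psd_block_toeplitz_matrix_convex:
  assumes aa: "\<And>j. j < m \<Longrightarrow> aa j \<in> mat_tuples d (nn j)"
    and psd: "\<And>j. j < m \<Longrightarrow> psd (Suc d * nn j) (block_toeplitz d (nn j) (aa j))"
    and G: "\<And>j. j < m \<Longrightarrow> G j \<in> carrier_mat (nn j) n"
    and G1: "mat_sum n m (\<lambda>j. mat_adjoint (G j) * G j) = 1\<^sub>m n"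
  shows "psd (Suc d * n) (block_toeplitz d n
    (map (\<lambda>l. mat_sum n m (\<lambda>j. mat_adjoint (G j) * (aa j ! l) * G j)) [0..<d]))"
    (is "psd _ (block_toeplitz d n ?as)")
  unfolding psd_block_toeplitz_iff
proof
  fix u :: "nat \<Rightarrow> nat \<Rightarrow> complex"
  have as: "?as \<in> mat_tuples d n" unfolding mat_tuples_def mat_sum_def by auto
  define S where "S = (\<lambda>j a b. mat_adjoint (G j) * toeplitz_entry (nn j) (aa j) a b * G j)"
  have Tc: "toeplitz_entry (nn j) (aa j) a b \<in> carrier_mat (nn j) (nn j)" if "j < m" "a \<le> d" "b \<le> d" for j a b
    using toeplitz_entry_carrier[OF aa] that by blast
  have entry: "toeplitz_entry n ?as a b $$ (r, s) = (\<Sum>j<m. S j a b $$ (r, s))"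
    if "a \<le> d" "b \<le> d" "r < n" "s < n" for a b r s
  proof -
    have lower: "toeplitz_entry n ?as a b $$ (r, s) = (\<Sum>j<m. S j a b $$ (r, s))"
      if "b < a" "a \<le> d" "r < n" "s < n" for a b r s
    proof -
      have "?as ! (a - b - 1) = mat_sum n m (\<lambda>j. mat_adjoint (G j) * (aa j ! (a - b - 1)) * G j)"
        using that by simp
      then show ?thesis
        using that by (simp add: toeplitz_entry_def S_def mat_sum_def del: index_mult_mat(1))
    qed
    consider "b < a" | "a < b" | "a = b" by linarith
    then show ?thesis
    proof cases
      case 1
      then show ?thesis using lower that by simp
    next
      case 2
      have "toeplitz_entry n ?as a b $$ (r, s) = cnj (\<Sum>j<m. S j b a $$ (s, r))"
        using toeplitz_entry_adjoint[OF as that] lower[OF 2 that(2,4,3)] by simp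
      also have "\<dots> = (\<Sum>j<m. S j a b $$ (r, s))"
        unfolding cnj_sum
      proof (rule sum.cong[OF refl])
        fix j assume "j \<in> {..<m}"
        then have j: "j < m" by simp
        have "cnj (S j b a $$ (s, r)) = (\<Sum>x<nn j. \<Sum>y<nn j.
            cnj (toeplitz_entry (nn j) (aa j) b a $$ (x, y)) * cnj (G j $$ (y, r)) * G j $$ (x, s))"
          unfolding S_def index_adjoint_mult_mult[OF Tc[OF j that(2,1)] G[OF j] that(4,3)] by simp
        also have "\<dots> = (\<Sum>x<nn j. \<Sum>y<nn j.
            toeplitz_entry (nn j) (aa j) a b $$ (y, x) * G j $$ (x, s) * cnj (G j $$ (y, r)))"
          using toeplitz_entry_adjoint[OF aa[OF j] that(1,2)] by (intro sum.cong refl) (simp add: mult_ac)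
        also have "\<dots> = (\<Sum>y<nn j. \<Sum>x<nn j.
            toeplitz_entry (nn j) (aa j) a b $$ (y, x) * G j $$ (x, s) * cnj (G j $$ (y, r)))"
          by (rule sum.swap)
        also have "\<dots> = S j a b $$ (r, s)"
          unfolding S_def index_adjoint_mult_mult[OF Tc[OF j that(1,2)] G[OF j] that(3,4)] ..
        finally show "cnj (S j b a $$ (s, r)) = S j a b $$ (r, s)" .
      qed
      finally show ?thesis .
    next
      case 3
      have "(\<Sum>j<m. S j a b $$ (r, s)) = (\<Sum>j<m. (mat_adjoint (G j) * G j) $$ (r, s))"
      proof (rule sum.cong[OF refl])
        fix j assume "j \<in> {..<m}"
        then have "mat_adjoint (G j) * 1\<^sub>m (nn j) = mat_adjoint (G j)"
          using G[of j] by (intro right_mult_one_mat[of _ n]) auto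
        then show "S j a b $$ (r, s) = (mat_adjoint (G j) * G j) $$ (r, s)"
          using 3 by (simp add: S_def toeplitz_entry_def)
      qed
      also have "\<dots> = mat_sum n m (\<lambda>j. mat_adjoint (G j) * G j) $$ (r, s)"
        using that by (simp add: mat_sum_def del: index_mult_mat(1))
      finally show ?thesis using 3 G1 by (simp add: toeplitz_entry_def)
    qed
  qed
  define w where "w = (\<lambda>j a x. \<Sum>r<n. G j $$ (x, r) * u a r)"
  have "(\<Sum>a<Suc d. \<Sum>b<Suc d. \<Sum>r<n. \<Sum>s<n. toeplitz_entry n ?as a b $$ (r, s) * u b s * cnj (u a r))
    = (\<Sum>a<Suc d. \<Sum>b<Suc d. \<Sum>r<n. \<Sum>s<n. \<Sum>j<m. S j a b $$ (r, s) * u b s * cnj (u a r))"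
    by (intro sum.cong refl) (simp add: entry sum_distrib_right)
  also have "\<dots> = (\<Sum>a<Suc d. \<Sum>b<Suc d. \<Sum>j<m. \<Sum>r<n. \<Sum>s<n. S j a b $$ (r, s) * u b s * cnj (u a r))"
    by (rule sum.cong[OF refl], rule sum.cong[OF refl], rule sum_swap_triple)
  also have "\<dots> = (\<Sum>j<m. \<Sum>a<Suc d. \<Sum>b<Suc d. \<Sum>r<n. \<Sum>s<n. S j a b $$ (r, s) * u b s * cnj (u a r))"
    by (rule sum_swap_triple)
  also have "\<dots> = (\<Sum>j<m. \<Sum>a<Suc d. \<Sum>b<Suc d. \<Sum>x<nn j. \<Sum>y<nn j.
      toeplitz_entry (nn j) (aa j) a b $$ (x, y) * w j b y * cnj (w j a x))"
    unfolding w_def S_def using Tc G by (intro sum.cong refl psd_congruence) auto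
  also have "0 \<le> \<dots>"
  proof (rule sum_nonneg)
    fix j assume "j \<in> {..<m}"
    then have "psd (Suc d * nn j) (block_toeplitz d (nn j) (aa j))" using psd by simp
    then show "0 \<le> (\<Sum>a<Suc d. \<Sum>b<Suc d. \<Sum>x<nn j. \<Sum>y<nn j.
      toeplitz_entry (nn j) (aa j) a b $$ (x, y) * w j b y * cnj (w j a x))"
      unfolding psd_block_toeplitz_iff by (rule spec)
  qed
  finally show "0 \<le> (\<Sum>a<Suc d. \<Sum>b<Suc d. \<Sum>r<n. \<Sum>s<n. toeplitz_entry n ?as a b $$ (r, s) * u b s * cnj (u a r))" .
qed

theorem compact_matrix_convex_min_circle:
  "compact_matrix_convex d (min_matrix_convex d (conv_tuples d (circle_curve d)))"
  unfolding compact_matrix_convex_def min_circle_eq_psd_block_toeplitz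
proof (intro conjI allI impI)
  fix n :: nat assume "1 \<le> n"
  then have "(SIGMA n:{1..}. {as \<in> mat_tuples d n. psd (Suc d * n) (block_toeplitz d n as)}) `` {n}
    = {as \<in> mat_tuples d n. psd (Suc d * n) (block_toeplitz d n as)}" by auto
  then show "compact (tuple_entries d n ` ((SIGMA n:{1..}. {as \<in> mat_tuples d n. psd (Suc d * n) (block_toeplitz d n as)}) `` {n}))"
    using compact_psd_block_toeplitz by simp
next
  fix n m :: nat and nn aa and G :: "nat \<Rightarrow> complex mat"
  assume n: "1 \<le> n" and H: "(\<forall>j<m. (nn j, aa j) \<in> (SIGMA n:{1..}. {as \<in> mat_tuples d n. psd (Suc d * n) (block_toeplitz d n as)})
      \<and> G j \<in> carrier_mat (nn j) n) \<and> mat_sum n m (\<lambda>j. mat_adjoint (G j) * G j) = 1\<^sub>m n"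
  have "map (\<lambda>l. mat_sum n m (\<lambda>j. mat_adjoint (G j) * (aa j ! l) * G j)) [0..<d] \<in> mat_tuples d n"
    unfolding mat_tuples_def mat_sum_def by auto
  moreover have "psd (Suc d * n) (block_toeplitz d n
    (map (\<lambda>l. mat_sum n m (\<lambda>j. mat_adjoint (G j) * (aa j ! l) * G j)) [0..<d]))"
    by (rule psd_block_toeplitz_matrix_convex) (use H in auto)
  ultimately show "(n, map (\<lambda>l. mat_sum n m (\<lambda>j. mat_adjoint (G j) * (aa j ! l) * G j)) [0..<d])
    \<in> (SIGMA n:{1..}. {as \<in> mat_tuples d n. psd (Suc d * n) (block_toeplitz d n as)})"
    using n by simp
qed auto

section \<open>Hilbert space structure of \<open>\<ell>\<^sup>2(\<nat>)\<close>\<close>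

lemma cinner_add_left: "ell2_cinner (x + y) z = ell2_cinner x z + ell2_cinner y z"
  unfolding ell2_cinner.rep_eq plus_ell2.rep_eq
  by (subst suminf_add[OF ell2_cinner_summable ell2_cinner_summable]) (simp add: algebra_simps)

lemma cinner_scale_left: "ell2_cinner (c *\<^sub>\<ell> x) z = c * ell2_cinner x z"
  unfolding ell2_cinner.rep_eq ell2_scale.rep_eq
  by (subst suminf_mult[OF ell2_cinner_summable, symmetric]) (simp add: algebra_simps)

lemma cinner_commute: "ell2_cinner y x = cnj (ell2_cinner x y)"
proof -
  have "(\<lambda>n. cnj (ell2_coord x n * cnj (ell2_coord y n))) sums cnj (\<Sum>n. ell2_coord x n * cnj (ell2_coord y n))"
    unfolding sums_cnj by (rule summable_sums[OF ell2_cinner_summable])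
  then show ?thesis unfolding ell2_cinner.rep_eq by (simp add: sums_iff mult.commute)
qed

lemma cinner_add_right: "ell2_cinner z (x + y) = ell2_cinner z x + ell2_cinner z y"
  using cinner_add_left[of x y z] by (metis cinner_commute complex_cnj_add)

lemma cinner_scale_right: "ell2_cinner z (c *\<^sub>\<ell> x) = cnj c * ell2_cinner z x"
  using cinner_scale_left[of c x z] by (metis cinner_commute complex_cnj_mult)

lemma scaleR_eq_scale: "r *\<^sub>R x = complex_of_real r *\<^sub>\<ell> (x :: ell2)"
  by (rule scaleR_ell2_def)

lemma ell2_scale_minus: "(- 1) *\<^sub>\<ell> x = - x"
  by transfer simp

lemma cinner_minus_left [simp]: "ell2_cinner (- x) z = - ell2_cinner x z"
  using cinner_scale_left[of "-1" x z] by (simp add: ell2_scale_minus)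

lemma cinner_minus_right [simp]: "ell2_cinner z (- x) = - ell2_cinner z x"
  using cinner_scale_right[of z "-1" x] by (simp add: ell2_scale_minus)

lemma cinner_diff_left: "ell2_cinner (x - y) z = ell2_cinner x z - ell2_cinner y z"
  unfolding minus_ell2_def cinner_add_left cinner_minus_left by simp

lemma cinner_diff_right: "ell2_cinner z (x - y) = ell2_cinner z x - ell2_cinner z y"
  unfolding minus_ell2_def cinner_add_right cinner_minus_right by simp

lemma cinner_zero [simp]: "ell2_cinner 0 z = 0" "ell2_cinner z 0 = 0"
  using cinner_add_left[of 0 0 z] cinner_add_right[of z 0 0] by auto

lemma cinner_sum_left: "ell2_cinner (\<Sum>i\<in>I. f i) z = (\<Sum>i\<in>I. ell2_cinner (f i) z)"
  by (induction I rule: infinite_finite_induct) (auto simp: cinner_add_left)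

lemma cinner_sum_right: "ell2_cinner z (\<Sum>i\<in>I. f i) = (\<Sum>i\<in>I. ell2_cinner z (f i))"
  by (induction I rule: infinite_finite_induct) (auto simp: cinner_add_right)

lemma Re_cinner: "Re (ell2_cinner x y) = inner x y"
  unfolding inner_ell2_def ..

lemma cinner_self: "ell2_cinner x x = complex_of_real ((norm x)\<^sup>2)"
proof -
  have "Im (ell2_cinner x x) = 0" using cinner_commute[of x x] by (metis Im_complex_of_real Reals_cnj_iff complex_is_Real_iff)
  moreover have "Re (ell2_cinner x x) = (norm x)\<^sup>2" by (simp add: Re_cinner power2_norm_eq_inner)
  ultimately show ?thesis by (auto simp: complex_eq_iff simp del: of_real_power)
qed

lemma cmod_cinner_le: "cmod (ell2_cinner x y) \<le> norm x * norm y"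
proof -
  define z where "z = ell2_cinner x y"
  \<comment> \<open>This phase makes the inner product real and nonnegative, which reduces the bound
    to the real Cauchy-Schwarz inequality; for \<open>z = 0\<close> it is 0.\<close>
  define c where "c = cnj (sgn z)"
  have "c * z = complex_of_real (cmod z)"
    unfolding c_def by (cases "z = 0") (auto simp: sgn_div_norm scaleR_conv_of_real complex_norm_square[symmetric] power2_eq_square field_simps)
  then have "cmod z = Re (ell2_cinner (c *\<^sub>\<ell> x) y)" by (simp add: cinner_scale_left z_def)
  also have "\<dots> \<le> norm (c *\<^sub>\<ell> x) * norm y" unfolding Re_cinner by (rule norm_cauchy_schwarz)
  also have "\<dots> \<le> norm x * norm y"
    unfolding norm_ell2_scale c_def by (cases "z = 0") (auto simp: norm_sgn)
  finally show ?thesis unfolding z_def .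
qed

lemma ell2_eq_by_cinner: "(\<And>z. ell2_cinner x z = ell2_cinner y z) \<Longrightarrow> x = y"
  using cinner_self[of "x - y"] by (simp add: cinner_diff_left)

lemma bounded_linear_cinner_left: "bounded_linear (\<lambda>x. ell2_cinner x y)"
  by (rule bounded_linear_intro[where K = "norm y"])
    (auto simp: cinner_add_left scaleR_eq_scale cinner_scale_left scaleR_conv_of_real cmod_cinner_le)

lemma bounded_linear_cinner_right: "bounded_linear (\<lambda>y. ell2_cinner x y)"
  by (rule bounded_linear_intro[where K = "norm x"])
    (auto simp: cinner_add_right scaleR_eq_scale cinner_scale_right scaleR_conv_of_real
      cmod_cinner_le[of x] mult.commute[of _ "norm x"])

lemmas tendsto_cinner_left = bounded_linear.tendsto[OF bounded_linear_cinner_left]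

lemma norm_ell2_eq: "(norm x)\<^sup>2 = (\<Sum>n. (cmod (ell2_coord x n))\<^sup>2)"
proof -
  have "complex_of_real ((norm x)\<^sup>2) = (\<Sum>n. complex_of_real ((cmod (ell2_coord x n))\<^sup>2))"
    unfolding cinner_self[symmetric] ell2_cinner.rep_eq complex_norm_square ..
  also have "\<dots> = complex_of_real (\<Sum>n. (cmod (ell2_coord x n))\<^sup>2)"
    by (rule suminf_of_real[OF ell2_coord_summable, symmetric])
  finally show ?thesis unfolding of_real_eq_iff .
qed

lemma ell2_coord_eqI: "(\<And>n. ell2_coord x n = ell2_coord y n) \<Longrightarrow> x = y"
  using ell2_coord_inject by blast

lemma ell2_coord_Abs:
  "summable (\<lambda>n. (cmod (f n))\<^sup>2) \<Longrightarrow> ell2_coord (Abs_ell2 f) = f"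
  by (simp add: Abs_ell2_inverse)

lemma ell2_coord_minus: "ell2_coord (x - y) n = ell2_coord x n - ell2_coord y n"
  unfolding minus_ell2_def plus_ell2.rep_eq uminus_ell2.rep_eq by simp

lemma ell2_coord_sum: "ell2_coord (\<Sum>i\<in>I. f i) n = (\<Sum>i\<in>I. ell2_coord (f i) n)"
  by (induction I rule: infinite_finite_induct) (auto simp: plus_ell2.rep_eq zero_ell2.rep_eq)

lemma sum_coord_le: "(\<Sum>n<N. (cmod (ell2_coord x n))\<^sup>2) \<le> (norm x)\<^sup>2"
  unfolding norm_ell2_eq by (rule sum_le_suminf[OF ell2_coord_summable]) auto

lemma cmod_coord_le: "cmod (ell2_coord x n) \<le> norm x"
proof (rule power2_le_imp_le)
  have "(cmod (ell2_coord x n))\<^sup>2 \<le> (\<Sum>k<Suc n. (cmod (ell2_coord x k))\<^sup>2)"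
    by (simp add: sum_nonneg)
  then show "(cmod (ell2_coord x n))\<^sup>2 \<le> (norm x)\<^sup>2" using sum_coord_le[of x "Suc n"] by linarith
qed simp

text \<open>Coordinates converge because each is dominated by the norm. The Cauchy estimate survives
  on every finite partial sum, hence on the whole series; this puts the coordinatewise limit into
  the space and gives convergence in norm.\<close>

instance ell2 :: banach
proof
  fix X :: "nat \<Rightarrow> ell2"
  assume X: "Cauchy X"
  have "Cauchy (\<lambda>i. ell2_coord (X i) n)" for n
  proof (rule metric_CauchyI)
    fix e :: real assume "0 < e"
    then obtain M where M: "\<And>i j. i \<ge> M \<Longrightarrow> j \<ge> M \<Longrightarrow> dist (X i) (X j) < e"
      using metric_CauchyD[OF X \<open>0 < e\<close>] by auto
    show "\<exists>M. \<forall>i\<ge>M. \<forall>j\<ge>M. dist (ell2_coord (X i) n) (ell2_coord (X j) n) < e"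
    proof (intro exI[of _ M] allI impI)
      fix i j assume "M \<le> i" "M \<le> j"
      then show "dist (ell2_coord (X i) n) (ell2_coord (X j) n) < e"
        using M[of i j] cmod_coord_le[of "X i - X j" n] by (simp add: dist_norm ell2_coord_minus)
    qed
  qed
  then have "\<forall>n. \<exists>l. (\<lambda>i. ell2_coord (X i) n) \<longlonglongrightarrow> l"
    using Cauchy_convergent convergent_def by blast
  then obtain f where f: "\<And>n. (\<lambda>i. ell2_coord (X i) n) \<longlonglongrightarrow> f n" by metis
  have bound: "(\<Sum>n<N. (cmod (ell2_coord (X i) n - f n))\<^sup>2) \<le> e\<^sup>2"
    if M: "\<And>j. j \<ge> M \<Longrightarrow> norm (X i - X j) \<le> e" and e: "0 \<le> e" for M i e N
  proof (rule tendsto_upperbound)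
    show "(\<lambda>j. \<Sum>n<N. (cmod (ell2_coord (X i) n - ell2_coord (X j) n))\<^sup>2)
        \<longlonglongrightarrow> (\<Sum>n<N. (cmod (ell2_coord (X i) n - f n))\<^sup>2)"
      by (intro tendsto_intros f)
    have "(\<Sum>n<N. (cmod (ell2_coord (X i) n - ell2_coord (X j) n))\<^sup>2) \<le> e\<^sup>2" if "j \<ge> M" for j
      using sum_coord_le[of "X i - X j" N] power_mono[OF M[OF that], of 2] by (simp add: ell2_coord_minus)
    then show "\<forall>\<^sub>F j in sequentially. (\<Sum>n<N. (cmod (ell2_coord (X i) n - ell2_coord (X j) n))\<^sup>2) \<le> e\<^sup>2"
      unfolding eventually_sequentially by blast
  qed simp
  have sum: "summable (\<lambda>n. (cmod (ell2_coord (X i) n - f n))\<^sup>2)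
      \<and> (\<Sum>n. (cmod (ell2_coord (X i) n - f n))\<^sup>2) \<le> e\<^sup>2"
    if "\<And>j. j \<ge> M \<Longrightarrow> norm (X i - X j) \<le> e" "0 \<le> e" for M i e
  proof -
    have "summable (\<lambda>n. (cmod (ell2_coord (X i) n - f n))\<^sup>2)"
      by (rule summableI_nonneg_bounded[of _ "e\<^sup>2"]) (simp, rule bound[of M i e, OF that])
    then show ?thesis using suminf_le_const[of _ "e\<^sup>2"] bound[of M i e, OF that] by blast
  qed
  obtain M0 where M0: "\<And>i j. i \<ge> M0 \<Longrightarrow> j \<ge> M0 \<Longrightarrow> norm (X i - X j) < 1"
    using metric_CauchyD[OF X, of 1] by (auto simp: dist_norm)
  have "summable (\<lambda>n. (cmod (ell2_coord (X M0) n - f n))\<^sup>2)"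
    using sum[of M0 M0 1] M0[of M0] by (auto intro: less_imp_le)
  then have "summable (\<lambda>n. (cmod (ell2_coord (X M0) n + (-1) * (ell2_coord (X M0) n - f n)))\<^sup>2)"
    by (intro ell2_add_closed ell2_scale_closed ell2_coord_summable)
  then have "summable (\<lambda>n. (cmod (f n))\<^sup>2)" by simp
  then have L: "ell2_coord (Abs_ell2 f) = f" by (rule ell2_coord_Abs)
  have "X \<longlonglongrightarrow> Abs_ell2 f"
  proof (rule metric_LIMSEQ_I)
    fix e :: real assume e: "0 < e"
    then have e2: "0 < e / 2" by simp
    then obtain M where M: "\<And>i j. i \<ge> M \<Longrightarrow> j \<ge> M \<Longrightarrow> norm (X i - X j) < e / 2"
      using metric_CauchyD[OF X e2] by (auto simp: dist_norm)
    have "norm (X i - Abs_ell2 f) \<le> e / 2" if "i \<ge> M" for i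
    proof (rule power2_le_imp_le)
      show "(norm (X i - Abs_ell2 f))\<^sup>2 \<le> (e / 2)\<^sup>2"
        unfolding norm_ell2_eq ell2_coord_minus L
        using sum[of M i "e / 2"] M[of i] that e by (auto intro: less_imp_le)
    qed (use e in simp)
    then show "\<exists>M. \<forall>i\<ge>M. dist (X i) (Abs_ell2 f) < e"
      using e by (intro exI[of _ M]) (force simp: dist_norm)
  qed
  then show "convergent X" unfolding convergent_def by blast
qed


section \<open>Coordinate projections\<close>

text \<open>One operation for arbitrary index sets covers initial segments, tails and the blocks
  between two cuts; products of such projections are then intersections of sets.\<close>

lift_definition restr_vec :: "nat set \<Rightarrow> ell2 \<Rightarrow> ell2" is "\<lambda>S x n. if n \<in> S then x n else 0"
  by (rule summable_comparison_test') auto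

lemma coord_restr_vec: "ell2_coord (restr_vec S x) n = (if n \<in> S then ell2_coord x n else 0)"
  by (simp add: restr_vec.rep_eq)

lemma norm_restr_vec_le: "norm (restr_vec S x) \<le> norm x"
proof (rule power2_le_imp_le)
  show "(norm (restr_vec S x))\<^sup>2 \<le> (norm x)\<^sup>2"
    unfolding norm_ell2_eq
    by (rule suminf_le[OF _ ell2_coord_summable ell2_coord_summable]) (simp add: coord_restr_vec)
qed simp

lemma restr_vec_add: "restr_vec S (x + y) = restr_vec S x + restr_vec S y"
  by (rule ell2_coord_eqI) (simp add: coord_restr_vec plus_ell2.rep_eq)

lemma restr_vec_scale: "restr_vec S (c *\<^sub>\<ell> x) = c *\<^sub>\<ell> restr_vec S x"
  by (rule ell2_coord_eqI) (simp add: coord_restr_vec ell2_scale.rep_eq)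

definition restr :: "nat set \<Rightarrow> op" where "restr S = Blinfun (restr_vec S)"

lemma restr_apply: "blinfun_apply (restr S) = restr_vec S"
proof -
  have "bounded_linear (restr_vec S)"
    by (rule bounded_linear_intro[where K = 1])
      (auto simp: restr_vec_add scaleR_eq_scale restr_vec_scale norm_restr_vec_le)
  then show ?thesis unfolding restr_def by (rule bounded_linear_Blinfun_apply)
qed

abbreviation tail :: "nat \<Rightarrow> ell2 \<Rightarrow> ell2" where "tail n \<equiv> restr_vec {n..}"
abbreviation init :: "nat \<Rightarrow> ell2 \<Rightarrow> ell2" where "init n \<equiv> restr_vec {..<n}"

lemma restr_vec_restr_vec: "restr_vec S (restr_vec T x) = restr_vec (S \<inter> T) x"
  by (rule ell2_coord_eqI) (simp add: coord_restr_vec)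

lemma restr_vec_Un: "S \<inter> T = {} \<Longrightarrow> restr_vec (S \<union> T) x = restr_vec S x + restr_vec T x"
  by (rule ell2_coord_eqI) (auto simp: coord_restr_vec plus_ell2.rep_eq)

lemma restr_vec_UNIV [simp]: "restr_vec UNIV x = x"
  by (rule ell2_coord_eqI) (simp add: coord_restr_vec)

lemma restr_vec_empty [simp]: "restr_vec {} x = 0"
  by (rule ell2_coord_eqI) (simp add: coord_restr_vec zero_ell2.rep_eq)

lemma restr_vec_zero [simp]: "restr_vec S 0 = 0"
  by (rule ell2_coord_eqI) (simp add: coord_restr_vec zero_ell2.rep_eq)

lemma cinner_restr_vec: "ell2_cinner (restr_vec S x) y = ell2_cinner x (restr_vec S y)"
  unfolding ell2_cinner.rep_eq by (intro arg_cong[where f = suminf] ext) (simp add: coord_restr_vec)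

lemma lessThan_Int_atLeast: "{..<n :: nat} \<inter> {n..} = {}"
  by auto

lemma init_plus_tail: "init n x + tail n x = x"
proof -
  have "{..<n} \<inter> {n..} = {}" "{..<n} \<union> {n..} = UNIV" by auto
  then show ?thesis using restr_vec_Un[of "{..<n}" "{n..}" x] by simp
qed

lemma norm_init_tail: "(norm (init n x))\<^sup>2 + (norm (tail n x))\<^sup>2 = (norm x)\<^sup>2"
proof -
  have "inner (init n x) (tail n x) = 0"
    using lessThan_Int_atLeast[of n]
    unfolding Re_cinner[symmetric] cinner_restr_vec restr_vec_restr_vec by simp
  then show ?thesis
    using norm_add_Pythagorean[of "init n x" "tail n x"] by (simp add: real_inner_class.orthogonal_def init_plus_tail)
qed

lemma tail_tendsto_0: "(\<lambda>n. tail n x) \<longlonglongrightarrow> 0"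
proof -
  have eq: "(norm (tail n x))\<^sup>2 = (\<Sum>k. (cmod (ell2_coord x (k + n)))\<^sup>2)" for n
  proof -
    have "(norm (tail n x))\<^sup>2 = (\<Sum>k. (cmod (ell2_coord (tail n x) (k + n)))\<^sup>2)
       + (\<Sum>k<n. (cmod (ell2_coord (tail n x) k))\<^sup>2)"
      unfolding norm_ell2_eq by (rule suminf_split_initial_segment[OF ell2_coord_summable])
    then show ?thesis by (simp add: coord_restr_vec)
  qed
  have "(\<lambda>n. \<Sum>k. (cmod (ell2_coord x (k + n)))\<^sup>2) \<longlonglongrightarrow> 0"
    by (rule suminf_exist_split2[OF ell2_coord_summable])
  then have "(\<lambda>n. sqrt ((norm (tail n x))\<^sup>2)) \<longlonglongrightarrow> sqrt 0"
    unfolding eq by (rule tendsto_real_sqrt)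
  then show ?thesis by (simp add: tendsto_norm_zero_iff)
qed

lemma init_tendsto: "(\<lambda>n. init n x) \<longlonglongrightarrow> x"
proof -
  have "init n x = x - tail n x" for n using init_plus_tail[of n x] by (simp add: algebra_simps)
  then show ?thesis using tendsto_diff[OF tendsto_const tail_tendsto_0, of x x] by simp
qed

lemma norm_tail_antimono: "n \<le> m \<Longrightarrow> norm (tail m x) \<le> norm (tail n x)"
  using norm_restr_vec_le[of "{m..}" "tail n x"]
  by (simp add: restr_vec_restr_vec Int_absorb2 atLeast_subset_iff)

lift_definition basis_vec :: "nat \<Rightarrow> ell2" is "\<lambda>n k. if k = n then 1 else 0"
  by (rule summable_finite[of "{_}"]) auto

lemma coord_basis_vec: "ell2_coord (basis_vec n) k = (if k = n then 1 else 0)"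
  by (simp add: basis_vec.rep_eq)

lemma init_eq_sum: "init n x = (\<Sum>k<n. ell2_coord x k *\<^sub>\<ell> basis_vec k)"
  by (rule ell2_coord_eqI)
    (simp add: coord_restr_vec ell2_coord_sum ell2_scale.rep_eq coord_basis_vec if_distrib cong: if_cong)

lemma cinner_basis_vec [simp]: "ell2_cinner x (basis_vec n) = ell2_coord x n"
  unfolding ell2_cinner.rep_eq
  by (subst suminf_finite[of "{n}"]) (auto simp: coord_basis_vec)

lemma norm_basis_vec [simp]: "norm (basis_vec n) = 1"
proof -
  have "complex_of_real ((norm (basis_vec n))\<^sup>2) = 1"
    unfolding cinner_self[symmetric] by (simp add: coord_basis_vec)
  then have "(norm (basis_vec n))\<^sup>2 = 1" unfolding of_real_eq_1_iff .
  then show ?thesis using power2_eq_imp_eq[of "norm (basis_vec n)" 1] by simp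
qed


section \<open>Bounded and compact operators\<close>

lemma BB_scale: "A \<in> BB \<Longrightarrow> blinfun_apply A (c *\<^sub>\<ell> v) = c *\<^sub>\<ell> blinfun_apply A v"
  unfolding BB_def by blast

lemma restr_BB [simp]: "restr S \<in> BB"
  unfolding BB_def by (simp add: restr_apply restr_vec_scale)

lemma ell2_scale_add: "c *\<^sub>\<ell> (x + y) = c *\<^sub>\<ell> x + c *\<^sub>\<ell> y"
  by (rule linear_add[OF bounded_linear.linear[OF bounded_linear_ell2_scale]])

lemma ell2_scale_scale: "c *\<^sub>\<ell> d *\<^sub>\<ell> x = (c * d) *\<^sub>\<ell> x"
  by transfer (simp add: algebra_simps)

lemma BB_closed_intros:
  "id_blinfun \<in> BB" "0 \<in> BB"
  "A \<in> BB \<Longrightarrow> B \<in> BB \<Longrightarrow> A + B \<in> BB"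
  "A \<in> BB \<Longrightarrow> B \<in> BB \<Longrightarrow> A - B \<in> BB"
  "A \<in> BB \<Longrightarrow> op_scale c A \<in> BB"
  "A \<in> BB \<Longrightarrow> B \<in> BB \<Longrightarrow> A o\<^sub>L B \<in> BB"
proof -
  show "id_blinfun \<in> BB" "A \<in> BB \<Longrightarrow> B \<in> BB \<Longrightarrow> A o\<^sub>L B \<in> BB"
    "A \<in> BB \<Longrightarrow> B \<in> BB \<Longrightarrow> A + B \<in> BB"
    unfolding BB_def by (auto simp: blinfun.add_left ell2_scale_add)
  show "0 \<in> BB" unfolding BB_def by (auto simp: linear_0[OF bounded_linear.linear[OF bounded_linear_ell2_scale]])
  show "A \<in> BB \<Longrightarrow> B \<in> BB \<Longrightarrow> A - B \<in> BB"
    unfolding BB_def by (auto simp: blinfun.diff_left linear_diff[OF bounded_linear.linear[OF bounded_linear_ell2_scale]])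
  show "A \<in> BB \<Longrightarrow> op_scale c A \<in> BB"
    unfolding BB_def by (auto simp: op_scale_apply ell2_scale_scale mult.commute)
qed

lemma BB_sum: "(\<And>i. i \<in> I \<Longrightarrow> f i \<in> BB) \<Longrightarrow> (\<Sum>i\<in>I. f i) \<in> BB"
  by (induction I rule: infinite_finite_induct) (auto intro: BB_closed_intros)

lemma closed_BB: "closed BB"
proof -
  have eq: "BB = (\<Inter>c. \<Inter>v. {A. blinfun_apply A (c *\<^sub>\<ell> v) - c *\<^sub>\<ell> blinfun_apply A v = 0})"
    unfolding BB_def by auto
  have "closed {A. blinfun_apply A (c *\<^sub>\<ell> v) - c *\<^sub>\<ell> blinfun_apply A v = 0}" for c v
    by (intro closed_Collect_eq continuous_intros bounded_linear.continuous_on[OF bounded_linear_ell2_scale])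
  then show ?thesis unfolding eq by (intro closed_INT ballI)
qed

text \<open>The values of \<open>A\<close> on basis vectors prescribe the coordinates of the adjoint
  at \<open>w\<close>. Their square summability comes from testing \<open>A\<close> on the
  truncation of the very sequence that is to be bounded.\<close>

lemma BB_adjoint_exists:
  assumes A: "A \<in> BB"
  shows "\<exists>B\<in>BB. \<forall>v w. ell2_cinner (blinfun_apply A v) w = ell2_cinner v (blinfun_apply B w)"
proof -
  define b where "b = (\<lambda>w n. cnj (ell2_cinner (blinfun_apply A (basis_vec n)) w))"
  have fin: "ell2_cinner (blinfun_apply A (\<Sum>n<N. c n *\<^sub>\<ell> basis_vec n)) w = (\<Sum>n<N. c n * cnj (b w n))" for c w N
    by (simp add: blinfun.sum_right BB_scale[OF A] cinner_sum_left cinner_scale_left b_def)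
  have bound: "(\<Sum>n<N. (cmod (b w n))\<^sup>2) \<le> (norm A * norm w)\<^sup>2" for w N
  proof -
    define v where "v = (\<Sum>n<N. b w n *\<^sub>\<ell> basis_vec n)"
    define s where "s = (\<Sum>n<N. (cmod (b w n))\<^sup>2)"
    have s0: "0 \<le> s" unfolding s_def by (rule sum_nonneg) simp
    have "ell2_cinner v v = (\<Sum>n<N. b w n * cnj (ell2_coord v n))"
      unfolding v_def by (simp add: cinner_sum_left cinner_scale_left cinner_commute[of "basis_vec _"] ell2_coord_sum)
    also have "\<dots> = (\<Sum>n<N. b w n * cnj (b w n))"
      by (intro sum.cong refl) (simp add: v_def ell2_coord_sum ell2_scale.rep_eq coord_basis_vec if_distrib cong: if_cong)
    also have "\<dots> = complex_of_real s" unfolding s_def of_real_sum complex_norm_square ..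
    finally have "complex_of_real ((norm v)\<^sup>2) = complex_of_real s" unfolding cinner_self .
    then have nv: "(norm v)\<^sup>2 = s" unfolding of_real_eq_iff .
    have "ell2_cinner (blinfun_apply A v) w = complex_of_real s"
      unfolding v_def fin s_def of_real_sum complex_norm_square ..
    then have "s \<le> norm (blinfun_apply A v) * norm w"
      using cmod_cinner_le[of "blinfun_apply A v" w] s0 by simp
    also have "\<dots> \<le> norm A * norm v * norm w" by (intro mult_right_mono norm_blinfun) auto
    finally have "norm v * norm v \<le> (norm A * norm w) * norm v"
      unfolding nv[symmetric] power2_eq_square by (simp add: mult_ac)
    then have "norm v \<le> norm A * norm w"
      by (cases "norm v = 0") (auto simp: mult_le_cancel_right)
    then show ?thesis unfolding s_def[symmetric] nv[symmetric] by (rule power_mono) simp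
  qed
  have sum: "summable (\<lambda>n. (cmod (b w n))\<^sup>2)" for w
    by (rule summableI_nonneg_bounded[of _ "(norm A * norm w)\<^sup>2"]) (simp, rule bound)
  define f where "f = (\<lambda>w. Abs_ell2 (b w))"
  have coord: "ell2_coord (f w) = b w" for w unfolding f_def by (rule ell2_coord_Abs[OF sum])
  have adj: "ell2_cinner (blinfun_apply A v) w = ell2_cinner v (f w)" for v w
  proof (rule LIMSEQ_unique)
    show "(\<lambda>n. ell2_cinner (blinfun_apply A (init n v)) w) \<longlonglongrightarrow> ell2_cinner (blinfun_apply A v) w"
      by (intro tendsto_cinner_left bounded_linear.tendsto[OF blinfun.bounded_linear_right] init_tendsto)
    have "ell2_cinner (blinfun_apply A (init n v)) w = ell2_cinner (init n v) (f w)" for n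
      unfolding init_eq_sum fin
      by (simp add: cinner_sum_left cinner_scale_left cinner_commute[of "basis_vec _"] coord)
    then show "(\<lambda>n. ell2_cinner (blinfun_apply A (init n v)) w) \<longlonglongrightarrow> ell2_cinner v (f w)"
      using tendsto_cinner_left[OF init_tendsto, of v "f w"] by simp
  qed
  have eqI: "x = y" if "\<And>v. ell2_cinner v x = ell2_cinner v y" for x y
    using that by (intro ell2_eq_by_cinner) (metis cinner_commute)
  have add: "f (w + z) = f w + f z" for w z
    by (rule eqI) (simp add: adj[symmetric] cinner_add_right)
  have scale: "f (c *\<^sub>\<ell> w) = c *\<^sub>\<ell> f w" for c w
    by (rule eqI) (simp add: adj[symmetric] cinner_scale_right)
  have norm: "norm (f w) \<le> norm w * norm A" for w
  proof (rule power2_le_imp_le)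
    show "(norm (f w))\<^sup>2 \<le> (norm w * norm A)\<^sup>2"
      unfolding norm_ell2_eq coord using bound[of w] by (intro suminf_le_const[OF sum]) (simp add: mult.commute)
  qed simp
  have "bounded_linear f"
    by (rule bounded_linear_intro[where K = "norm A"]) (auto simp: add scaleR_eq_scale scale norm)
  then have B: "blinfun_apply (Blinfun f) = f" by (rule bounded_linear_Blinfun_apply)
  show ?thesis
    by (rule bexI[of _ "Blinfun f"]) (auto simp: B adj BB_def scale)
qed

lemma op_adj_unique:
  assumes "\<And>v w. ell2_cinner (blinfun_apply A v) w = ell2_cinner v (blinfun_apply B w)"
  shows "op_adj A = B"
  unfolding op_adj_def
proof (rule the_equality)
  fix C assume C: "\<forall>v w. ell2_cinner (blinfun_apply A v) w = ell2_cinner v (blinfun_apply C w)"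
  show "C = B"
  proof (rule blinfun_eqI)
    fix w
    have "ell2_cinner v (blinfun_apply C w) = ell2_cinner v (blinfun_apply B w)" for v
      using assms C by simp
    then show "blinfun_apply C w = blinfun_apply B w"
      by (intro ell2_eq_by_cinner) (metis cinner_commute)
  qed
qed (use assms in blast)

lemma op_adj:
  assumes "A \<in> BB"
  shows "op_adj A \<in> BB"
    "ell2_cinner (blinfun_apply A v) w = ell2_cinner v (blinfun_apply (op_adj A) w)"
    "ell2_cinner (blinfun_apply (op_adj A) v) w = ell2_cinner v (blinfun_apply A w)"
proof -
  obtain B where B: "B \<in> BB" "\<And>v w. ell2_cinner (blinfun_apply A v) w = ell2_cinner v (blinfun_apply B w)"
    using BB_adjoint_exists[OF assms] by blast
  have eq: "op_adj A = B" by (rule op_adj_unique[OF B(2)])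
  show "op_adj A \<in> BB" using B eq by simp
  show 1: "ell2_cinner (blinfun_apply A v) w = ell2_cinner v (blinfun_apply (op_adj A) w)" for v w
    using B eq by simp
  show "ell2_cinner (blinfun_apply (op_adj A) v) w = ell2_cinner v (blinfun_apply A w)"
    using 1[of w v] by (metis cinner_commute)
qed

lemma norm_op_leI:
  "(\<And>v. norm (blinfun_apply A v) \<le> c * norm v) \<Longrightarrow> 0 \<le> c \<Longrightarrow> norm A \<le> c"
  by (rule norm_blinfun_bound) auto

lemma norm_op_le_cinner:
  assumes "\<And>v w. cmod (ell2_cinner (blinfun_apply A v) w) \<le> c * norm v * norm w" "0 \<le> c"
  shows "norm A \<le> c"
proof (rule norm_op_leI)
  fix v
  have "norm (blinfun_apply A v) * norm (blinfun_apply A v) = cmod (ell2_cinner (blinfun_apply A v) (blinfun_apply A v))"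
    unfolding cinner_self norm_of_real by (simp add: power2_eq_square)
  also have "\<dots> \<le> c * norm v * norm (blinfun_apply A v)" by (rule assms(1))
  finally show "norm (blinfun_apply A v) \<le> c * norm v"
    using assms(2) by (cases "norm (blinfun_apply A v) = 0") (auto simp: mult_le_cancel_right)
qed (rule assms(2))

lemma compact_finite_coordinates:
  "compact ((\<lambda>f :: nat \<Rightarrow> complex. \<Sum>k<n. f k *\<^sub>\<ell> basis_vec k) ` {f. \<forall>k. f k \<in> cball 0 M})"
proof (rule compact_continuous_image)
  have "bounded_linear (\<lambda>c. c *\<^sub>\<ell> x)" for x
  proof (rule bounded_linear_intro[where K = "norm x"])
    fix a b :: complex and r :: real
    show "(a + b) *\<^sub>\<ell> x = a *\<^sub>\<ell> x + b *\<^sub>\<ell> x" by transfer (simp add: algebra_simps)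
    show "(r *\<^sub>R a) *\<^sub>\<ell> x = r *\<^sub>R (a *\<^sub>\<ell> x)"
      unfolding scaleR_eq_scale ell2_scale_scale by (simp add: scaleR_conv_of_real)
  qed (simp add: norm_ell2_scale)
  note bl = this
  have "continuous_on UNIV (\<lambda>f :: nat \<Rightarrow> complex. f k *\<^sub>\<ell> basis_vec k)" for k
    by (rule bounded_linear.continuous_on[OF bl continuous_on_product_coordinates])
  then have "continuous_on UNIV (\<lambda>f :: nat \<Rightarrow> complex. \<Sum>k<n. f k *\<^sub>\<ell> basis_vec k)"
    by (rule continuous_on_sum)
  then show "continuous_on {f. \<forall>k. f k \<in> cball 0 M} (\<lambda>f :: nat \<Rightarrow> complex. \<Sum>k<n. f k *\<^sub>\<ell> basis_vec k)"
    by (rule continuous_on_subset) simp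
  show "compact {f :: nat \<Rightarrow> complex. \<forall>k. f k \<in> cball 0 M}"
    by (intro compact_function_space) auto
qed

text \<open>The working form of compactness: outputs have uniformly small tails. A finite net of the
  image consists of finitely many vectors, which have a common cut; conversely the initial parts
  stay in a compact set of finitely many coordinates and the tails add only a small error.\<close>

lemma KK_iff:
  "A \<in> KK \<longleftrightarrow> A \<in> BB \<and> (\<forall>e>0. \<exists>n. \<forall>v. norm (tail n (blinfun_apply A v)) \<le> e * norm v)"
proof (intro iffI conjI allI impI)
  assume A: "A \<in> KK"
  then show BB: "A \<in> BB" unfolding KK_def by blast
  fix e :: real assume e: "0 < e"
  let ?S = "blinfun_apply A ` cball 0 1"
  have "compact (closure ?S)" using A unfolding KK_def by blast
  then have "\<exists>k. finite k \<and> closure ?S \<subseteq> (\<Union>x\<in>k. ball x (e / 2))"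
    using e unfolding compact_eq_totally_bounded by (auto dest: spec[of _ "e / 2"])
  then obtain k where k: "finite k" "closure ?S \<subseteq> (\<Union>x\<in>k. ball x (e / 2))" by blast
  have "\<forall>\<^sub>F n in sequentially. \<forall>x\<in>k. norm (tail n x) < e / 2"
    using k(1)
  proof (rule eventually_ball_finite, intro ballI)
    fix x
    have "(\<lambda>n. norm (tail n x)) \<longlonglongrightarrow> 0" by (rule tendsto_norm_zero[OF tail_tendsto_0])
    then show "\<forall>\<^sub>F n in sequentially. norm (tail n x) < e / 2" using e by (intro order_tendstoD(2)) auto
  qed
  from eventually_happens'[OF sequentially_bot this]
  obtain n where n: "\<And>x. x \<in> k \<Longrightarrow> norm (tail n x) < e / 2" by auto
  have 1: "norm (tail n (blinfun_apply A v)) \<le> e" if "norm v \<le> 1" for v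
  proof -
    have "blinfun_apply A v \<in> ?S" using that by simp
    then have "blinfun_apply A v \<in> closure ?S" by (rule subsetD[OF closure_subset])
    from subsetD[OF k(2) this] obtain x where x: "x \<in> k" "dist x (blinfun_apply A v) < e / 2" by auto
    have "tail n (blinfun_apply A v) = tail n (blinfun_apply A v - x) + tail n x"
      unfolding restr_vec_add[symmetric] by simp
    then have "norm (tail n (blinfun_apply A v)) \<le> norm (tail n (blinfun_apply A v - x)) + norm (tail n x)"
      using norm_triangle_ineq by simp
    moreover have "norm (tail n (blinfun_apply A v - x)) \<le> dist x (blinfun_apply A v)"
      using norm_restr_vec_le[of "{n..}" "blinfun_apply A v - x"] by (simp add: dist_norm norm_minus_commute)
    ultimately show ?thesis using n[OF x(1)] x(2) by simp
  qed
  have "norm (tail n (blinfun_apply A v)) \<le> e * norm v" for v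
  proof (cases "v = 0")
    case False
    define c where "c = complex_of_real (1 / norm v)"
    have "norm (c *\<^sub>\<ell> v) \<le> 1" using False unfolding c_def norm_ell2_scale norm_of_real by simp
    then have "norm (c *\<^sub>\<ell> tail n (blinfun_apply A v)) \<le> e"
      using 1[of "c *\<^sub>\<ell> v"] by (simp add: BB_scale[OF BB] restr_vec_scale)
    then show ?thesis using False unfolding c_def norm_ell2_scale norm_of_real by (simp add: field_simps)
  qed simp
  then show "\<exists>n. \<forall>v. norm (tail n (blinfun_apply A v)) \<le> e * norm v" by blast
next
  assume A: "A \<in> BB \<and> (\<forall>e>0. \<exists>n. \<forall>v. norm (tail n (blinfun_apply A v)) \<le> e * norm v)"
  let ?S = "blinfun_apply A ` cball 0 1"
  have "\<exists>k. finite k \<and> closure ?S \<subseteq> (\<Union>x\<in>k. ball x e)" if e: "0 < e" for e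
  proof -
    have e4: "0 < e / 4" using e by simp
    then obtain n where n: "\<And>v. norm (tail n (blinfun_apply A v)) \<le> e / 4 * norm v" using A by blast
    \<comment> \<open>Contains the initial parts of all image vectors, whose coordinates are bounded
      by \<open>norm A\<close>; a finite net of it also serves as a coarser net of the
      image.\<close>
    define F where "F = (\<lambda>f :: nat \<Rightarrow> complex. \<Sum>k<n. f k *\<^sub>\<ell> basis_vec k) ` {f. \<forall>k. f k \<in> cball 0 (norm A)}"
    have "compact F" unfolding F_def by (rule compact_finite_coordinates)
    then obtain k where k: "finite k" "F \<subseteq> (\<Union>x\<in>k. ball x (e / 4))"
      using e4 unfolding compact_eq_totally_bounded by meson
    have S: "\<exists>x\<in>k. dist x y < e / 2" if "y \<in> ?S" for y
    proof -
      obtain v where "v \<in> cball 0 1" and v2: "y = blinfun_apply A v" using \<open>y \<in> ?S\<close> by blast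
      then have v: "norm v \<le> 1" "y = blinfun_apply A v" by auto
      have y: "norm y \<le> norm A" unfolding v(2) using norm_blinfun[of A v] v(1)
        by (metis mult_left_le norm_ge_zero order_trans)
      have "cmod (ell2_coord y k) \<le> norm A" for k using cmod_coord_le[of y k] y by linarith
      then have "init n y \<in> F" unfolding F_def init_eq_sum by (intro imageI) simp
      then obtain x where x: "x \<in> k" "dist x (init n y) < e / 4" using subsetD[OF k(2)] by fastforce
      have "dist (init n y) y = norm (tail n y)"
        using init_plus_tail[of n y] by (metis add_diff_cancel_left' dist_norm norm_minus_commute)
      also have "\<dots> \<le> e / 4 * norm v" unfolding v(2) by (rule n)
      also have "\<dots> \<le> e / 4" using v(1) e4 by (intro mult_left_le) auto
      finally have "dist x y < e / 2" using x(2) dist_triangle[of x y "init n y"] by simp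
      then show ?thesis using x(1) by blast
    qed
    have "closure ?S \<subseteq> (\<Union>x\<in>k. ball x e)"
    proof
      fix z assume "z \<in> closure ?S"
      then obtain y where y: "y \<in> ?S" "dist y z < e / 2" using e unfolding closure_approachable by (meson half_gt_zero_iff)
      then obtain x where "x \<in> k" "dist x y < e / 2" using S by blast
      then have "dist x z < e" using y(2) dist_triangle[of x z y] by simp
      then show "z \<in> (\<Union>x\<in>k. ball x e)" using \<open>x \<in> k\<close> by auto
    qed
    then show ?thesis using k(1) by blast
  qed
  note cover = this
  have "compact (closure ?S)"
    unfolding compact_eq_totally_bounded
  proof (intro conjI allI impI)
    show "complete (closure ?S)" by (simp add: complete_eq_closed)
    fix e :: real assume "0 < e"
    then show "\<exists>k. finite k \<and> closure ?S \<subseteq> (\<Union>x\<in>k. ball x e)" by (rule cover)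
  qed
  then show "A \<in> KK" using A unfolding KK_def by blast
qed

lemma KK_BB: "A \<in> KK \<Longrightarrow> A \<in> BB" unfolding KK_def by blast

lemma KK_tail:
  assumes "A \<in> KK" "0 < e"
  obtains n where "\<And>m v. n \<le> m \<Longrightarrow> norm (tail m (blinfun_apply A v)) \<le> e * norm v"
proof -
  obtain n where "\<And>v. norm (tail n (blinfun_apply A v)) \<le> e * norm v" using assms unfolding KK_iff by blast
  then show ?thesis using that[of n] order_trans[OF norm_tail_antimono] by metis
qed

lemma KK_add:
  assumes A: "A \<in> KK" and B: "B \<in> KK"
  shows "A + B \<in> KK"
  unfolding KK_iff
proof (intro conjI allI impI)
  show "A + B \<in> BB" using A B by (simp add: BB_closed_intros KK_BB)
  fix e :: real assume "0 < e"
  then have e: "0 < e / 2" by simp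
  obtain n where n: "\<And>m v. n \<le> m \<Longrightarrow> norm (tail m (blinfun_apply A v)) \<le> e / 2 * norm v" using KK_tail[OF A e] by blast
  obtain n' where n': "\<And>m v. n' \<le> m \<Longrightarrow> norm (tail m (blinfun_apply B v)) \<le> e / 2 * norm v" using KK_tail[OF B e] by blast
  have "norm (tail (max n n') (blinfun_apply (A + B) v)) \<le> e * norm v" for v
    using n[of "max n n'" v] n'[of "max n n'" v]
      norm_triangle_ineq[of "tail (max n n') (blinfun_apply A v)" "tail (max n n') (blinfun_apply B v)"]
    by (simp add: blinfun.add_left restr_vec_add)
  then show "\<exists>n. \<forall>v. norm (tail n (blinfun_apply (A + B) v)) \<le> e * norm v" by blast
qed

lemma KK_scale:
  assumes A: "A \<in> KK"
  shows "op_scale c A \<in> KK"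
  unfolding KK_iff
proof (intro conjI allI impI)
  show "op_scale c A \<in> BB" using A by (simp add: BB_closed_intros KK_BB)
  fix e :: real assume e: "0 < e"
  \<comment> \<open>The extra 1 keeps the divisor positive when \<open>c = 0\<close>.\<close>
  have c: "0 < cmod c + 1" using norm_ge_zero[of c] by linarith
  then have "0 < e / (cmod c + 1)" using e by simp
  then obtain n where n: "\<And>m v. n \<le> m \<Longrightarrow> norm (tail m (blinfun_apply A v)) \<le> e / (cmod c + 1) * norm v"
    using KK_tail[OF A] by blast
  have "norm (tail n (blinfun_apply (op_scale c A) v)) \<le> e * norm v" for v
  proof -
    have "norm (tail n (blinfun_apply (op_scale c A) v)) = cmod c * norm (tail n (blinfun_apply A v))"
      by (simp add: op_scale_apply restr_vec_scale norm_ell2_scale)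
    also have "\<dots> \<le> (cmod c + 1) * (e / (cmod c + 1) * norm v)" using n[of n v] c by (intro mult_mono) auto
    also have "\<dots> = e * norm v" using c by simp
    finally show ?thesis .
  qed
  then show "\<exists>n. \<forall>v. norm (tail n (blinfun_apply (op_scale c A) v)) \<le> e * norm v" by blast
qed

lemma KK_zero: "0 \<in> KK"
  unfolding KK_iff by (auto intro: BB_closed_intros)

lemma KK_sum: "(\<And>i. i \<in> I \<Longrightarrow> f i \<in> KK) \<Longrightarrow> (\<Sum>i\<in>I. f i) \<in> KK"
  by (induction I rule: infinite_finite_induct) (auto intro: KK_add KK_zero)

lemma closed_KK: "closed KK"
  unfolding closed_sequential_limits
proof (intro allI impI)
  fix f A assume H: "(\<forall>n. f n \<in> KK) \<and> f \<longlonglongrightarrow> A"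
  have "A \<in> BB" by (rule closed_sequentially[OF closed_BB, of f]) (use H KK_BB in auto)
  moreover have "\<exists>n. \<forall>v. norm (tail n (blinfun_apply A v)) \<le> e * norm v" if "0 < e" for e
  proof -
    have e: "0 < e / 2" using that by simp
    then obtain i where i: "norm (f i - A) < e / 2" using H LIMSEQ_D[of f A "e / 2"] by blast
    obtain n where n: "\<And>m v. n \<le> m \<Longrightarrow> norm (tail m (blinfun_apply (f i) v)) \<le> e / 2 * norm v"
      using KK_tail[OF _ e] H by blast
    have "norm (tail n (blinfun_apply A v)) \<le> e * norm v" for v
    proof -
      have "tail n (blinfun_apply A v) = tail n (blinfun_apply (f i) v) + tail n (blinfun_apply (A - f i) v)"
        unfolding restr_vec_add[symmetric] by (simp add: blinfun.diff_left)
      then have "norm (tail n (blinfun_apply A v)) \<le> e / 2 * norm v + norm (tail n (blinfun_apply (A - f i) v))"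
        using n[of n v] norm_triangle_ineq[of "tail n (blinfun_apply (f i) v)" "tail n (blinfun_apply (A - f i) v)"] by simp
      also have "norm (tail n (blinfun_apply (A - f i) v)) \<le> norm (A - f i) * norm v"
        using norm_restr_vec_le norm_blinfun order_trans by blast
      also have "\<dots> \<le> e / 2 * norm v" using i by (intro mult_right_mono) (auto simp: norm_minus_commute)
      finally show ?thesis by simp
    qed
    then show ?thesis by blast
  qed
  ultimately show "A \<in> KK" unfolding KK_iff by blast
qed

lemma KK_restr_left: "A \<in> BB \<Longrightarrow> S \<subseteq> {..<n} \<Longrightarrow> restr S o\<^sub>L A \<in> KK"
proof -
  assume A: "A \<in> BB" and "S \<subseteq> {..<n}"
  then have "{n..} \<inter> S = {}" by auto
  then have "tail n (blinfun_apply (restr S o\<^sub>L A) v) = 0" for v by (simp add: restr_apply restr_vec_restr_vec)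
  then show ?thesis unfolding KK_iff using A by (auto simp: BB_closed_intros intro!: exI[of _ n])
qed

text \<open>The range is spanned by the images of \<open>n\<close> basis vectors, whose tails become
  small simultaneously.\<close>

lemma KK_restr_right:
  assumes A: "A \<in> BB"
  shows "A o\<^sub>L restr {..<n} \<in> KK"
  unfolding KK_iff
proof (intro conjI allI impI)
  show "A o\<^sub>L restr {..<n} \<in> BB" using A by (simp add: BB_closed_intros)
  fix e :: real assume e: "0 < e"
  have "(\<lambda>m. \<Sum>k<n. norm (tail m (blinfun_apply A (basis_vec k)))) \<longlonglongrightarrow> (\<Sum>k<n. norm (0 :: ell2))"
    by (intro tendsto_sum tendsto_norm tail_tendsto_0)
  from order_tendstoD(2)[OF this, of e]
  have "\<forall>\<^sub>F m in sequentially. (\<Sum>k<n. norm (tail m (blinfun_apply A (basis_vec k)))) < e"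
    using e by simp
  from eventually_happens'[OF sequentially_bot this]
  obtain m where m: "(\<Sum>k<n. norm (tail m (blinfun_apply A (basis_vec k)))) < e" by auto
  have tsum: "tail m (\<Sum>k\<in>I. f k) = (\<Sum>k\<in>I. tail m (f k))" for f and I :: "nat set"
    by (induction I rule: infinite_finite_induct) (auto simp: restr_vec_add)
  have "norm (tail m (blinfun_apply (A o\<^sub>L restr {..<n}) v)) \<le> e * norm v" for v
  proof -
    have "tail m (blinfun_apply (A o\<^sub>L restr {..<n}) v) = (\<Sum>k<n. ell2_coord v k *\<^sub>\<ell> tail m (blinfun_apply A (basis_vec k)))"
      by (simp add: restr_apply init_eq_sum blinfun.sum_right BB_scale[OF A] tsum restr_vec_scale)
    also have "norm \<dots> \<le> (\<Sum>k<n. cmod (ell2_coord v k) * norm (tail m (blinfun_apply A (basis_vec k))))"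
      by (rule order_trans[OF norm_sum]) (simp add: norm_ell2_scale)
    also have "\<dots> \<le> (\<Sum>k<n. norm v * norm (tail m (blinfun_apply A (basis_vec k))))"
      by (intro sum_mono mult_right_mono cmod_coord_le) auto
    also have "\<dots> = (\<Sum>k<n. norm (tail m (blinfun_apply A (basis_vec k)))) * norm v"
      unfolding sum_distrib_right by (simp only: mult.commute)
    also have "\<dots> \<le> e * norm v" using m by (intro mult_right_mono) auto
    finally show ?thesis .
  qed
  then show "\<exists>m. \<forall>v. norm (tail m (blinfun_apply (A o\<^sub>L restr {..<n}) v)) \<le> e * norm v" by blast
qed

text \<open>The adjoint composed with the projection behind \<open>init p\<close> is compact, so its
  outputs have small tails: the first \<open>p\<close> rows meet far columns only weakly, uniformly
  in both vectors.\<close>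

lemma cinner_init_tail_small:
  assumes A: "A \<in> BB" and e: "0 < e"
  shows "\<exists>q. \<forall>m\<ge>q. \<forall>u w. cmod (ell2_cinner (blinfun_apply A (tail m u)) (init p w)) \<le> e * norm u * norm w"
proof -
  have "op_adj A o\<^sub>L restr {..<p} \<in> KK" by (rule KK_restr_right[OF op_adj(1)[OF A]])
  then obtain q where q: "\<And>m w. q \<le> m \<Longrightarrow> norm (tail m (blinfun_apply (op_adj A) (init p w))) \<le> e * norm w"
    using KK_tail[OF _ e, of "op_adj A o\<^sub>L restr {..<p}"] by (auto simp: restr_apply)
  have "cmod (ell2_cinner (blinfun_apply A (tail m u)) (init p w)) \<le> e * norm u * norm w" if "q \<le> m" for m u w
  proof -
    have "cmod (ell2_cinner (blinfun_apply A (tail m u)) (init p w))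
      \<le> norm u * norm (tail m (blinfun_apply (op_adj A) (init p w)))"
      unfolding op_adj(2)[OF A] cinner_restr_vec by (rule cmod_cinner_le)
    also have "\<dots> \<le> norm u * (e * norm w)" using q[OF that] by (intro mult_left_mono) auto
    finally show ?thesis by (simp add: mult_ac)
  qed
  then show ?thesis by blast
qed

text \<open>Between rapidly growing cuts the operators are almost block tridiagonal, so the off-diagonal
  parts at different cuts act between orthogonal blocks and their average is small in norm.\<close>

lemma averaged_cuts:
  assumes X: "finite X" "X \<subseteq> BB" and e: "0 < e"
  obtains N and c :: "nat \<Rightarrow> nat" where "0 < N" "\<And>k. m \<le> c k"
    "\<And>A u w. A \<in> X \<Longrightarrow> cmod (\<Sum>k<N. ell2_cinner (blinfun_apply A (tail (c k) u)) (init (c k) w))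
      \<le> real N * e * norm u * norm w"
proof -
  \<comment> \<open>Each cut produces two remote terms of size \<open>d\<close>, together half of
    \<open>e\<close>; the other half absorbs the neighbouring blocks through the choice of
    \<open>N\<close>.\<close>
  define d where "d = e / 4"
  have d: "0 < d" unfolding d_def using e by simp
  have step: "\<exists>q>p. q \<ge> m \<and> (\<forall>A\<in>X. \<forall>u w. cmod (ell2_cinner (blinfun_apply A (tail q u)) (init p w)) \<le> d * norm u * norm w)" for p
  proof -
    have "\<forall>A\<in>X. \<exists>q. \<forall>m\<ge>q. \<forall>u w. cmod (ell2_cinner (blinfun_apply A (tail m u)) (init p w)) \<le> d * norm u * norm w"
      using cinner_init_tail_small[OF _ d] X by blast
    then obtain q where q: "\<And>A m u w. A \<in> X \<Longrightarrow> q A \<le> m \<Longrightarrow>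
        cmod (ell2_cinner (blinfun_apply A (tail m u)) (init p w)) \<le> d * norm u * norm w"
      by metis
    define r where "r = max (Suc p) m + (\<Sum>A\<in>X. q A)"
    have "q A \<le> r" if "A \<in> X" for A
      unfolding r_def using member_le_sum[OF that, of q] X(1) by simp
    then show ?thesis using q by (intro exI[of _ r]) (auto simp: r_def)
  qed
  have "\<exists>f. \<forall>n. f n < f (Suc n) \<and> f (Suc n) \<ge> m \<and>
      (\<forall>A\<in>X. \<forall>u w. cmod (ell2_cinner (blinfun_apply A (tail (f (Suc n)) u)) (init (f n) w)) \<le> d * norm u * norm w)"
    using dependent_nat_choice[of "\<lambda>_ _. True" "\<lambda>_ p q. p < q \<and> q \<ge> m \<and>
      (\<forall>A\<in>X. \<forall>u w. cmod (ell2_cinner (blinfun_apply A (tail q u)) (init p w)) \<le> d * norm u * norm w)"] step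
    by auto
  then obtain f where f: "\<And>n. f n < f (Suc n)" "\<And>n. m \<le> f (Suc n)"
    and small: "\<And>n A u w. A \<in> X \<Longrightarrow> cmod (ell2_cinner (blinfun_apply A (tail (f (Suc n)) u)) (init (f n) w)) \<le> d * norm u * norm w"
    by blast
  define D where "D = (\<lambda>k. restr_vec {f k..<f (Suc k)})"
  have init_split: "init (f (Suc k)) w = init (f k) w + D k w" for k w
  proof -
    have "{..<f (Suc k)} = {..<f k} \<union> {f k..<f (Suc k)}" "{..<f k} \<inter> {f k..<f (Suc k)} = {}"
      using f(1)[of k] by auto
    then show ?thesis unfolding D_def using restr_vec_Un by metis
  qed
  have tail_split: "tail (f k) u = D k u + tail (f (Suc k)) u" for k u
  proof -
    have "{f k..} = {f k..<f (Suc k)} \<union> {f (Suc k)..}" "{f k..<f (Suc k)} \<inter> {f (Suc k)..} = {}"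
      using f(1)[of k] by auto
    then show ?thesis unfolding D_def using restr_vec_Un by metis
  qed
  have tail_D: "D k u = tail (f k) (D k u)" for k u
  proof -
    have "{f k..} \<inter> {f k..<f (Suc k)} = {f k..<f (Suc k)}" by auto
    then show ?thesis unfolding D_def restr_vec_restr_vec by simp
  qed
  have D_sum: "(\<Sum>k<N. (norm (D (a + k) u))\<^sup>2) \<le> (norm u)\<^sup>2" for a N u
  proof -
    have "(\<Sum>k<N. (norm (D (a + k) u))\<^sup>2) + (norm (tail (f (a + N)) u))\<^sup>2 \<le> (norm u)\<^sup>2"
    proof (induction N)
      case 0
      then show ?case using norm_restr_vec_le by (simp add: power_mono)
    next
      case (Suc N)
      have "inner (D (a + N) u) (tail (f (Suc (a + N))) u) = 0"
      proof -
        have "{f (a + N)..<f (Suc (a + N))} \<inter> {f (Suc (a + N))..} = {}" by auto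
        then show ?thesis
          unfolding Re_cinner[symmetric] D_def cinner_restr_vec restr_vec_restr_vec by simp
      qed
      then have "(norm (tail (f (a + N)) u))\<^sup>2 = (norm (D (a + N) u))\<^sup>2 + (norm (tail (f (Suc (a + N))) u))\<^sup>2"
        unfolding tail_split[of "a + N"] by (intro norm_add_Pythagorean) (simp add: real_inner_class.orthogonal_def)
      then show ?case using Suc by simp
    qed
    then show ?thesis using zero_le_power2[of "norm (tail (f (a + N)) u)"] by linarith
  qed
  define M where "M = (\<Sum>A\<in>X. norm A)"
  have M: "norm A \<le> M" if "A \<in> X" for A
    unfolding M_def using member_le_sum[OF that, of norm] X(1) by simp
  have M0: "0 \<le> M" unfolding M_def by (rule sum_nonneg) simp
  \<comment> \<open>The neighbouring terms sum to at most \<open>M\<close> times the norms of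
    \<open>u\<close> and \<open>w\<close>, independently of \<open>N\<close>, so their average falls
    below \<open>e / 2\<close>.\<close>
  obtain N :: nat where N: "2 * M / e < real N" using reals_Archimedean2 by blast
  have N0: "0 < N" using N M0 e by (cases N) (auto simp: divide_less_0_iff not_less)
  show ?thesis
  \<comment> \<open>The cuts start at \<open>f 1\<close>: \<open>f 0\<close> is not known to be at
    least \<open>m\<close>, and every cut needs a preceding block \<open>D k\<close>.\<close>
  proof (rule that[of N "\<lambda>k. f (Suc k)"])
    fix A u w assume A: "A \<in> X"
    let ?t = "\<lambda>k. ell2_cinner (blinfun_apply A (tail (f (Suc k)) u)) (init (f (Suc k)) w)"
    have split: "cmod (?t k) \<le> norm A * (norm (D (Suc k) u) * norm (D k w)) + 2 * d * norm u * norm w" for k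
    proof -
      \<comment> \<open>Only the two blocks adjacent to the cut interact strongly; the other two
        terms skip a whole block and are small by the choice of \<open>f\<close>.\<close>
      have "?t k = ell2_cinner (blinfun_apply A (D (Suc k) u)) (D k w)
        + ell2_cinner (blinfun_apply A (tail (f (Suc k)) (D (Suc k) u))) (init (f k) w)
        + ell2_cinner (blinfun_apply A (tail (f (Suc (Suc k))) u)) (init (f (Suc k)) w)"
        unfolding tail_D[symmetric]
        by (subst tail_split) (simp add: blinfun.add_right cinner_add_left init_split[of k] cinner_add_right)
      then have "cmod (?t k) \<le> cmod (ell2_cinner (blinfun_apply A (D (Suc k) u)) (D k w))
        + cmod (ell2_cinner (blinfun_apply A (tail (f (Suc k)) (D (Suc k) u))) (init (f k) w))
        + cmod (ell2_cinner (blinfun_apply A (tail (f (Suc (Suc k))) u)) (init (f (Suc k)) w))"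
        by (metis (no_types, lifting) norm_triangle_ineq norm_triangle_mono order_refl)
      moreover have "cmod (ell2_cinner (blinfun_apply A (D (Suc k) u)) (D k w)) \<le> norm A * (norm (D (Suc k) u) * norm (D k w))"
        using order_trans[OF cmod_cinner_le mult_right_mono[OF norm_blinfun]] by (simp add: mult.assoc)
      moreover have "cmod (ell2_cinner (blinfun_apply A (tail (f (Suc k)) (D (Suc k) u))) (init (f k) w)) \<le> d * norm u * norm w"
      proof (rule order_trans[OF small[OF A]])
        have "norm (D (Suc k) u) \<le> norm u" unfolding D_def by (rule norm_restr_vec_le)
        then show "d * norm (D (Suc k) u) * norm w \<le> d * norm u * norm w"
          using d by (intro mult_right_mono mult_left_mono) auto
      qed
      moreover have "cmod (ell2_cinner (blinfun_apply A (tail (f (Suc (Suc k))) u)) (init (f (Suc k)) w)) \<le> d * norm u * norm w"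
        by (rule small[OF A])
      ultimately show ?thesis by linarith
    qed
    have "cmod (\<Sum>k<N. ?t k) \<le> (\<Sum>k<N. cmod (?t k))" by (rule norm_sum)
    also have "\<dots> \<le> (\<Sum>k<N. norm A * (norm (D (Suc k) u) * norm (D k w)) + 2 * d * norm u * norm w)"
      by (rule sum_mono[OF split])
    also have "\<dots> = norm A * (\<Sum>k<N. norm (D (Suc k) u) * norm (D k w)) + real N * (2 * d * norm u * norm w)"
      by (simp add: sum.distrib sum_distrib_left)
    also have "(\<Sum>k<N. norm (D (Suc k) u) * norm (D k w)) \<le> norm u * norm w"
    proof (rule power2_le_imp_le)
      have "(\<Sum>k<N. norm (D (Suc k) u) * norm (D k w))\<^sup>2
        \<le> (\<Sum>k<N. (norm (D (Suc k) u))\<^sup>2) * (\<Sum>k<N. (norm (D k w))\<^sup>2)"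
        by (rule Cauchy_Schwarz_ineq_sum)
      also have "\<dots> \<le> (norm u)\<^sup>2 * (norm w)\<^sup>2"
        using D_sum[where a = 1 and N = N and u = u] D_sum[where a = 0 and N = N and u = w]
        by (intro mult_mono) (auto intro: sum_nonneg)
      finally show "(\<Sum>k<N. norm (D (Suc k) u) * norm (D k w))\<^sup>2 \<le> (norm u * norm w)\<^sup>2"
        by (simp add: power_mult_distrib)
    qed simp
    also have "norm A * (norm u * norm w) + real N * (2 * d * norm u * norm w)
      = (norm A + real N * e / 2) * (norm u * norm w)"
      unfolding d_def by (simp add: field_simps)
    also have "\<dots> \<le> (real N * e) * (norm u * norm w)"
    proof (intro mult_right_mono mult_nonneg_nonneg)
      have "2 * M < real N * e" using N e by (simp add: field_simps)
      then show "norm A + real N * e / 2 \<le> real N * e" using M[OF A] by linarith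
    qed auto
    finally show "cmod (\<Sum>k<N. ?t k) \<le> real N * e * norm u * norm w"
      using norm_ge_zero[of A] by (simp add: mult_left_mono mult.assoc)
  qed (use N0 f(2) in auto)
qed

section \<open>Compact perturbations with positive Toeplitz form\<close>

definition nsq :: "nat \<Rightarrow> (nat \<Rightarrow> ell2) \<Rightarrow> real" where
  "nsq d v = (\<Sum>i<Suc d. (norm (v i))\<^sup>2)"

text \<open>The upper half of the Toeplitz matrix contributes the conjugates of these terms, so
  twice their real part is the whole off-diagonal form. No adjoints appear, and the dependence on
  \<open>x\<close> is visibly additive.\<close>

definition tcross :: "nat \<Rightarrow> (nat \<Rightarrow> op) \<Rightarrow> (nat \<Rightarrow> ell2) \<Rightarrow> real" where
  "tcross d x v = (\<Sum>i<Suc d. \<Sum>j<i. inner (blinfun_apply (x (i - j - 1)) (v j)) (v i))"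

text \<open>The quadratic form of the Toeplitz operator matrix with symbol entries \<open>x 0, x 1, \<dots>\<close> below
  the diagonal; \<open>x l\<close> corresponds to the paper's \<open>x\<^sub>l\<^sub>+\<^sub>1\<close>.\<close>

definition tform :: "nat \<Rightarrow> (nat \<Rightarrow> op) \<Rightarrow> (nat \<Rightarrow> ell2) \<Rightarrow> real" where
  "tform d x v = nsq d v + 2 * tcross d x v"

text \<open>Nonnegativity of the Toeplitz operator matrix modulo compact operators, expressed by
  tail vectors so that no quotient algebra has to be formed.\<close>

definition ess_nonneg :: "nat \<Rightarrow> (nat \<Rightarrow> op) \<Rightarrow> bool" where
  "ess_nonneg d x \<longleftrightarrow> (\<forall>e>0. \<exists>m. \<forall>v. - e * nsq d (\<lambda>i. tail m (v i)) \<le> tform d x (\<lambda>i. tail m (v i)))"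

lemma nsq_nonneg: "0 \<le> nsq d v"
  unfolding nsq_def by (intro sum_nonneg) auto

lemma norm_sq_le_nsq: "i \<le> d \<Longrightarrow> (norm (v i))\<^sup>2 \<le> nsq d v"
  unfolding nsq_def by (rule member_le_sum) auto

lemma norm_mult_le_nsq: "i \<le> d \<Longrightarrow> j \<le> d \<Longrightarrow> norm (v i) * norm (v j) \<le> nsq d v"
  using sum_squares_bound[of "norm (v i)" "norm (v j)"] norm_sq_le_nsq[of i d v] norm_sq_le_nsq[of j d v]
  by linarith

lemma nsq_tail_le: "nsq d (\<lambda>i. tail m (v i)) \<le> nsq d v"
  unfolding nsq_def by (intro sum_mono power_mono norm_restr_vec_le) auto

lemma nsq_init_tail: "nsq d (\<lambda>i. init m (v i)) + nsq d (\<lambda>i. tail m (v i)) = nsq d v"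
  unfolding nsq_def sum.distrib[symmetric] norm_init_tail ..

lemma abs_tcross_le:
  assumes "\<And>i j. i \<le> d \<Longrightarrow> j < i \<Longrightarrow> \<bar>inner (blinfun_apply (x (i - j - 1)) (v j)) (v i)\<bar> \<le> c * nsq d v"
    and c: "0 \<le> c"
  shows "\<bar>tcross d x v\<bar> \<le> (real (Suc d))\<^sup>2 * c * nsq d v"
proof -
  have "\<bar>tcross d x v\<bar> \<le> (\<Sum>i<Suc d. \<bar>\<Sum>j<i. inner (blinfun_apply (x (i - j - 1)) (v j)) (v i)\<bar>)"
    unfolding tcross_def by (rule sum_abs)
  also have "\<dots> \<le> (\<Sum>i<Suc d. real (Suc d) * (c * nsq d v))"
  proof (rule sum_mono)
    fix i assume i: "i \<in> {..<Suc d}"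
    have "\<bar>\<Sum>j<i. inner (blinfun_apply (x (i - j - 1)) (v j)) (v i)\<bar>
      \<le> (\<Sum>j<i. \<bar>inner (blinfun_apply (x (i - j - 1)) (v j)) (v i)\<bar>)" by (rule sum_abs)
    also have "\<dots> \<le> (\<Sum>j<i. c * nsq d v)" using assms(1) i by (intro sum_mono) auto
    also have "\<dots> = real i * (c * nsq d v)" by simp
    also have "\<dots> \<le> real (Suc d) * (c * nsq d v)"
      using i c nsq_nonneg[of d v] by (intro mult_right_mono) auto
    finally show "\<bar>\<Sum>j<i. inner (blinfun_apply (x (i - j - 1)) (v j)) (v i)\<bar> \<le> real (Suc d) * (c * nsq d v)" .
  qed
  also have "\<dots> = (real (Suc d))\<^sup>2 * c * nsq d v" by (simp add: power2_eq_square algebra_simps)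
  finally show ?thesis .
qed

lemma tcross_add: "tcross d (\<lambda>l. x l + y l) v = tcross d x v + tcross d y v"
  unfolding tcross_def by (simp add: blinfun.add_left inner_add_left sum.distrib)

text \<open>Supplies a first lower bound, however poor, from which the successive improvements can
  start.\<close>

lemma tform_bounded_below:
  obtains C where "0 \<le> C" "\<And>v. - C * nsq d v \<le> tform d x v"
proof -
  define c where "c = (\<Sum>l<d. norm (x l))"
  have c0: "0 \<le> c" unfolding c_def by (rule sum_nonneg) simp
  have "\<bar>tcross d x v\<bar> \<le> (real (Suc d))\<^sup>2 * c * nsq d v" for v
  proof (rule abs_tcross_le[OF _ c0])
    fix i j assume ij: "i \<le> d" "j < i"
    have "norm (x (i - j - 1)) \<le> c"
      unfolding c_def by (rule member_le_sum) (use ij in auto)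
    have "\<bar>inner (blinfun_apply (x (i - j - 1)) (v j)) (v i)\<bar> \<le> norm (blinfun_apply (x (i - j - 1)) (v j)) * norm (v i)"
      by (rule Cauchy_Schwarz_ineq2)
    also have "\<dots> \<le> norm (x (i - j - 1)) * norm (v j) * norm (v i)" by (intro mult_right_mono norm_blinfun) auto
    also have "\<dots> \<le> c * (norm (v j) * norm (v i))"
      unfolding mult.assoc using \<open>norm (x (i - j - 1)) \<le> c\<close> by (intro mult_right_mono) auto
    also have "\<dots> \<le> c * nsq d v" using ij c0 by (intro mult_left_mono norm_mult_le_nsq) auto
    finally show "\<bar>inner (blinfun_apply (x (i - j - 1)) (v j)) (v i)\<bar> \<le> c * nsq d v" .
  qed
  note bound = this
  have "- (2 * ((real (Suc d))\<^sup>2 * c)) * nsq d v \<le> tform d x v" for v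
  proof -
    have "- (2 * ((real (Suc d))\<^sup>2 * c)) * nsq d v = - 2 * ((real (Suc d))\<^sup>2 * c * nsq d v)" by simp
    also have "\<dots> \<le> 2 * tcross d x v" using bound[of v] by linarith
    finally show ?thesis unfolding tform_def using nsq_nonneg[of d v] by linarith
  qed
  then show ?thesis using that[of "2 * ((real (Suc d))\<^sup>2 * c)"] c0 by simp
qed

text \<open>Far out a compact operator is uniformly small, so the condition survives. This allows
  the improvement step to be applied again to an already perturbed tuple.\<close>

lemma ess_nonneg_add_compact:
  assumes x: "ess_nonneg d x" and k: "\<And>l. l < d \<Longrightarrow> k l \<in> KK"
  shows "ess_nonneg d (\<lambda>l. x l + k l)"
  unfolding ess_nonneg_def
proof (intro allI impI)
  fix e :: real assume e: "0 < e"
  \<comment> \<open>\<open>abs_tcross_le\<close> costs a factor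
    \<open>(real (Suc d))\<^sup>2\<close> and \<open>tform\<close> a factor 2, so the compact part
    uses up \<open>e / 2\<close>; the other half is left to \<open>x\<close>.\<close>
  define c where "c = e / (4 * (real (Suc d))\<^sup>2)"
  have c: "0 < c" unfolding c_def using e by (intro divide_pos_pos) auto
  have ce: "2 * ((real (Suc d))\<^sup>2 * c) = e / 2" unfolding c_def by (simp add: field_simps)
  have e2: "0 < e / 2" using e by simp
  obtain m where m: "\<And>v. - (e / 2) * nsq d (\<lambda>i. tail m (v i)) \<le> tform d x (\<lambda>i. tail m (v i))"
    using x e2 unfolding ess_nonneg_def by blast
  have "\<forall>l. \<exists>n. l < d \<longrightarrow> (\<forall>v. norm (tail n (blinfun_apply (k l) v)) \<le> c * norm v)"
    using k c unfolding KK_iff by blast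
  then obtain n where n: "\<And>l v. l < d \<Longrightarrow> norm (tail (n l) (blinfun_apply (k l) v)) \<le> c * norm v" by metis
  define M where "M = m + (\<Sum>l<d. n l)"
  have nM: "n l \<le> M" if "l < d" for l
    unfolding M_def using member_le_sum[of l "{..<d}" n] that by simp
  have "{m..} \<inter> {M..} = {M..}" unfolding M_def by auto
  then have mM: "tail m (tail M u) = tail M u" for u by (simp add: restr_vec_restr_vec)
  have "- e * nsq d (\<lambda>i. tail M (v i)) \<le> tform d (\<lambda>l. x l + k l) (\<lambda>i. tail M (v i))" for v
  proof -
    let ?w = "\<lambda>i. tail M (v i)"
    have "\<bar>tcross d k ?w\<bar> \<le> (real (Suc d))\<^sup>2 * c * nsq d ?w"
    proof (rule abs_tcross_le)
      fix i j assume ij: "i \<le> d" "j < i"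
      let ?l = "i - j - 1"
      have l: "?l < d" using ij by simp
      have "inner (blinfun_apply (k ?l) (?w j)) (?w i) = inner (tail M (blinfun_apply (k ?l) (?w j))) (?w i)"
        unfolding Re_cinner[symmetric] cinner_restr_vec restr_vec_restr_vec by simp
      then have "\<bar>inner (blinfun_apply (k ?l) (?w j)) (?w i)\<bar> \<le> norm (tail M (blinfun_apply (k ?l) (?w j))) * norm (?w i)"
        using Cauchy_Schwarz_ineq2 by metis
      also have "\<dots> \<le> (c * norm (?w j)) * norm (?w i)"
        using order_trans[OF norm_tail_antimono[OF nM[OF l]] n[OF l]] by (intro mult_right_mono) auto
      also have "\<dots> = c * (norm (?w j) * norm (?w i))" by simp
      also have "\<dots> \<le> c * nsq d ?w" using ij c norm_mult_le_nsq[of j d i ?w] by (intro mult_left_mono) auto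
      finally show "\<bar>inner (blinfun_apply (k ?l) (?w j)) (?w i)\<bar> \<le> c * nsq d ?w" .
    qed (use c in simp)
    then have "2 * \<bar>tcross d k ?w\<bar> \<le> e / 2 * nsq d ?w"
      unfolding ce[symmetric] by (simp add: mult.assoc)
    moreover have "- (e / 2) * nsq d ?w \<le> tform d x ?w" using m[of ?w] unfolding mM .
    ultimately show ?thesis unfolding tform_def tcross_add by (simp add: algebra_simps)
  qed
  then show "\<exists>m. \<forall>v. - e * nsq d (\<lambda>i. tail m (v i)) \<le> tform d (\<lambda>l. x l + k l) (\<lambda>i. tail m (v i))" by blast
qed

text \<open>The witness is the average of \<open>(1 + e)\<^sup>-\<^sup>1 P x P + Q x Q\<close> over the cuts of \<open>averaged_cuts\<close>,
  where \<open>Q = 1 - P\<close>.\<close>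

lemma improve_lower_bound:
  assumes x: "\<And>l. l < d \<Longrightarrow> x l \<in> BB" and ess: "ess_nonneg d x"
    and e: "0 \<le> e" "\<And>v. - e * nsq d v \<le> tform d x v"
    and e': "0 < e'" and eta: "0 < eta"
  obtains y where "\<And>l. l < d \<Longrightarrow> y l \<in> BB" "\<And>l. l < d \<Longrightarrow> y l - x l \<in> KK"
    "\<And>l. l < d \<Longrightarrow> norm (y l - x l) \<le> e * norm (x l) + eta"
    "\<And>v. - e' * nsq d v \<le> tform d y v"
proof -
  obtain m where m: "\<And>v. - e' * nsq d (\<lambda>i. tail m (v i)) \<le> tform d x (\<lambda>i. tail m (v i))"
    using ess e' unfolding ess_nonneg_def by blast
  \<comment> \<open>The corner \<open>Q x P\<close> will be estimated as the conjugate of the corner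
    \<open>P x Q\<close> of the adjoint, so adjoints are included.\<close>
  define X where "X = x ` {..<d} \<union> op_adj ` x ` {..<d}"
  have "finite X" "X \<subseteq> BB" unfolding X_def using x op_adj(1) by auto
  moreover have "0 < eta / 2" using eta by simp
  ultimately obtain N c where N: "0 < N" and mc: "\<And>k. m \<le> c k"
    and cuts: "\<And>A u w. A \<in> X \<Longrightarrow> cmod (\<Sum>k<N. ell2_cinner (blinfun_apply A (tail (c k) u)) (init (c k) w))
      \<le> real N * (eta / 2) * norm u * norm w"
    using averaged_cuts by blast
  \<comment> \<open>Chosen so that \<open>(1 + e) * q = 1\<close>: scaling by \<open>q\<close> lifts
    the bound \<open>- e\<close> on the initial part to 0, at a relative norm cost
    \<open>1 - q\<close>, which is at most \<open>e\<close>.\<close>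
  define q where "q = 1 / (1 + e)"
  have q: "0 < q" "q \<le> 1" "1 - q \<le> e" "(1 + e) * q = 1" unfolding q_def using e(1) by (auto simp: field_simps)
  define P where "P = (\<lambda>k. restr {..<c k})"
  define Q where "Q = (\<lambda>k. restr {c k..})"
  define y where "y = (\<lambda>l. (1 / real N) *\<^sub>R (\<Sum>k<N. q *\<^sub>R (P k o\<^sub>L x l o\<^sub>L P k) + (Q k o\<^sub>L x l o\<^sub>L Q k)))"
  have Rscale: "r *\<^sub>R A = op_scale (complex_of_real r) A" for r and A :: op
    by (rule blinfun_eqI) (simp add: op_scale_apply scaleR_eq_scale blinfun.scaleR_left)
  have yBB: "y l \<in> BB" if "l < d" for l
    unfolding y_def Rscale P_def Q_def using x[OF that] by (intro BB_closed_intros BB_sum restr_BB) auto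
  have yapp: "blinfun_apply (y l) v = (1 / real N) *\<^sub>R (\<Sum>k<N. q *\<^sub>R init (c k) (blinfun_apply (x l) (init (c k) v))
      + tail (c k) (blinfun_apply (x l) (tail (c k) v)))" for l v
    by (simp add: y_def P_def Q_def blinfun.scaleR_left blinfun.sum_left blinfun.add_left restr_apply)
  \<comment> \<open>The change consists of a corner scaled by \<open>q - 1\<close> and the two
    discarded corners. Every term contains some \<open>P k\<close>, which gives compactness; the
    discarded corners are bounded through their average over the cuts.\<close>
  have yx: "y l - x l = (1 / real N) *\<^sub>R (\<Sum>k<N. (q - 1) *\<^sub>R (P k o\<^sub>L x l o\<^sub>L P k) - (P k o\<^sub>L x l o\<^sub>L Q k) - (Q k o\<^sub>L x l o\<^sub>L P k))" for l
  proof (rule blinfun_eqI)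
    fix v
    have split: "blinfun_apply (x l) v = init (c k) (blinfun_apply (x l) (init (c k) v)) + init (c k) (blinfun_apply (x l) (tail (c k) v))
      + tail (c k) (blinfun_apply (x l) (init (c k) v)) + tail (c k) (blinfun_apply (x l) (tail (c k) v))" for k
    proof -
      have "blinfun_apply (x l) v = blinfun_apply (x l) (init (c k) v) + blinfun_apply (x l) (tail (c k) v)"
        unfolding blinfun.add_right[symmetric] init_plus_tail ..
      also have "\<dots> = (init (c k) (blinfun_apply (x l) (init (c k) v)) + tail (c k) (blinfun_apply (x l) (init (c k) v)))
        + (init (c k) (blinfun_apply (x l) (tail (c k) v)) + tail (c k) (blinfun_apply (x l) (tail (c k) v)))"
        unfolding init_plus_tail ..
      finally show ?thesis by (simp add: algebra_simps)
    qed
    have "blinfun_apply (x l) v = (1 / real N) *\<^sub>R (\<Sum>k<N. blinfun_apply (x l) v)"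
      using N by (simp add: scaleR_conv_of_real sum_constant_scaleR)
    then have "blinfun_apply (y l - x l) v = (1 / real N) *\<^sub>R ((\<Sum>k<N. q *\<^sub>R init (c k) (blinfun_apply (x l) (init (c k) v))
      + tail (c k) (blinfun_apply (x l) (tail (c k) v))) - (\<Sum>k<N. blinfun_apply (x l) v))"
      unfolding blinfun.diff_left yapp scaleR_diff_right by simp
    also have "\<dots> = (1 / real N) *\<^sub>R (\<Sum>k<N. (q - 1) *\<^sub>R init (c k) (blinfun_apply (x l) (init (c k) v))
      - init (c k) (blinfun_apply (x l) (tail (c k) v)) - tail (c k) (blinfun_apply (x l) (init (c k) v)))"
      unfolding sum_subtractf[symmetric]
    proof (intro arg_cong2[where f = scaleR] refl sum.cong)
      fix k
      show "q *\<^sub>R init (c k) (blinfun_apply (x l) (init (c k) v)) + tail (c k) (blinfun_apply (x l) (tail (c k) v)) - blinfun_apply (x l) v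
        = (q - 1) *\<^sub>R init (c k) (blinfun_apply (x l) (init (c k) v)) - init (c k) (blinfun_apply (x l) (tail (c k) v))
          - tail (c k) (blinfun_apply (x l) (init (c k) v))"
        by (subst split[of k]) (simp add: algebra_simps)
    qed
    finally show "blinfun_apply (y l - x l) v = blinfun_apply ((1 / real N) *\<^sub>R (\<Sum>k<N. (q - 1) *\<^sub>R (P k o\<^sub>L x l o\<^sub>L P k)
        - (P k o\<^sub>L x l o\<^sub>L Q k) - (Q k o\<^sub>L x l o\<^sub>L P k))) v"
      by (simp add: P_def Q_def blinfun.scaleR_left blinfun.sum_left blinfun.diff_left restr_apply)
  qed
  have yK: "y l - x l \<in> KK" if l: "l < d" for l
  proof -
    note xl = x[OF l]
    have 1: "P k o\<^sub>L (x l o\<^sub>L P k) \<in> KK" "P k o\<^sub>L (x l o\<^sub>L Q k) \<in> KK" "(Q k o\<^sub>L x l) o\<^sub>L P k \<in> KK" for k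
      unfolding P_def Q_def using xl by (auto intro!: KK_restr_left KK_restr_right BB_closed_intros restr_BB)
    have assoc: "A o\<^sub>L B o\<^sub>L C = A o\<^sub>L (B o\<^sub>L C)" for A B C :: op by (rule blinfun_eqI) simp
    have neg: "- A = op_scale (- 1) A" for A :: op
      by (rule blinfun_eqI) (simp add: op_scale_apply blinfun.minus_left ell2_scale_minus)
    have "(q - 1) *\<^sub>R (P k o\<^sub>L x l o\<^sub>L P k) - (P k o\<^sub>L x l o\<^sub>L Q k) - (Q k o\<^sub>L x l o\<^sub>L P k) \<in> KK" for k
      using 1[of k] unfolding diff_conv_add_uminus Rscale neg assoc by (intro KK_add KK_scale)
    then show ?thesis unfolding yx unfolding Rscale by (intro KK_scale KK_sum)
  qed
  have ynorm: "norm (y l - x l) \<le> e * norm (x l) + eta" if l: "l < d" for l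
  proof (rule norm_op_le_cinner)
    fix v w
    define s where "s = (\<Sum>k<N. ell2_cinner (blinfun_apply (x l) (tail (c k) v)) (init (c k) w))"
    define t where "t = (\<Sum>k<N. ell2_cinner (blinfun_apply (op_adj (x l)) (tail (c k) w)) (init (c k) v))"
    define r where "r = (\<Sum>k<N. ell2_cinner (blinfun_apply (x l) (init (c k) v)) (init (c k) w))"
    have "ell2_cinner (blinfun_apply (y l - x l) v) w
      = complex_of_real (1 / real N) * (complex_of_real (q - 1) * r - s - cnj t)"
    proof -
      have "cnj t = (\<Sum>k<N. ell2_cinner (blinfun_apply (x l) (init (c k) v)) (tail (c k) w))"
        unfolding t_def cnj_sum by (intro sum.cong refl) (simp add: op_adj(2)[OF x[OF l]] cinner_commute[symmetric])
      then show ?thesis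
        unfolding yx r_def s_def
        by (simp add: blinfun.scaleR_left blinfun.sum_left blinfun.diff_left P_def Q_def restr_apply scaleR_eq_scale
            cinner_scale_left cinner_sum_left cinner_diff_left cinner_restr_vec sum_subtractf sum_distrib_left)
    qed
    then have "cmod (ell2_cinner (blinfun_apply (y l - x l) v) w) = \<bar>1 / real N\<bar> * cmod (complex_of_real (q - 1) * r - s - cnj t)"
      by (simp only: norm_mult norm_of_real)
    also have "\<bar>1 / real N\<bar> = 1 / real N" by simp
    also have "1 / real N * cmod (complex_of_real (q - 1) * r - s - cnj t) \<le> 1 / real N * ((1 - q) * cmod r + cmod s + cmod t)"
    proof (intro mult_left_mono)
      have "cmod (complex_of_real (q - 1) * r - s - cnj t) \<le> cmod (complex_of_real (q - 1) * r) + cmod s + cmod (cnj t)"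
        using norm_triangle_ineq4[of "complex_of_real (q - 1) * r - s" "cnj t"]
          norm_triangle_ineq4[of "complex_of_real (q - 1) * r" s] by linarith
      also have "cmod (complex_of_real (q - 1) * r) = (1 - q) * cmod r"
        unfolding norm_mult norm_of_real using q by simp
      finally show "cmod (complex_of_real (q - 1) * r - s - cnj t) \<le> (1 - q) * cmod r + cmod s + cmod t" by simp
    qed simp
    also have "\<dots> \<le> 1 / real N * (real N * ((e * norm (x l) + eta) * norm v * norm w))"
    proof (intro mult_left_mono)
      have "cmod r \<le> (\<Sum>k<N. norm (x l) * (norm v * norm w))"
        unfolding r_def
      proof (rule order_trans[OF norm_sum sum_mono])
        fix k
        have "cmod (ell2_cinner (blinfun_apply (x l) (init (c k) v)) (init (c k) w))
          \<le> norm (blinfun_apply (x l) (init (c k) v)) * norm (init (c k) w)" by (rule cmod_cinner_le)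
        also have "\<dots> \<le> (norm (x l) * norm (init (c k) v)) * norm (init (c k) w)" by (intro mult_right_mono norm_blinfun) auto
        also have "\<dots> \<le> (norm (x l) * norm v) * norm w"
          by (intro mult_mono norm_restr_vec_le) auto
        finally show "cmod (ell2_cinner (blinfun_apply (x l) (init (c k) v)) (init (c k) w)) \<le> norm (x l) * (norm v * norm w)"
          by (simp add: mult.assoc)
      qed
      then have "(1 - q) * cmod r \<le> e * (real N * (norm (x l) * (norm v * norm w)))"
        using q e by (intro mult_mono) auto
      moreover have "cmod s \<le> real N * (eta / 2) * norm v * norm w"
        unfolding s_def by (rule cuts) (use l X_def in auto)
      moreover have "cmod t \<le> real N * (eta / 2) * norm w * norm v"
        unfolding t_def by (rule cuts) (use l X_def in auto)
      ultimately show "(1 - q) * cmod r + cmod s + cmod t \<le> real N * ((e * norm (x l) + eta) * norm v * norm w)"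
        by (simp add: algebra_simps)
    qed simp
    also have "\<dots> = (e * norm (x l) + eta) * norm v * norm w" using N by simp
    finally show "cmod (ell2_cinner (blinfun_apply (y l - x l) v) w) \<le> (e * norm (x l) + eta) * norm v * norm w" .
  qed (use e(1) eta in simp)
  have "- e' * nsq d v \<le> tform d y v" for v
  proof -
    have restr_inner: "inner (restr_vec S u) w = inner u (restr_vec S w)" for S u w
      unfolding Re_cinner[symmetric] cinner_restr_vec ..
    have "tcross d y v = (\<Sum>i<Suc d. \<Sum>j<i. (1 / real N) * (\<Sum>k<N. q * inner (blinfun_apply (x (i - j - 1)) (init (c k) (v j))) (init (c k) (v i))
      + inner (blinfun_apply (x (i - j - 1)) (tail (c k) (v j))) (tail (c k) (v i))))"
      unfolding tcross_def yapp
      by (simp add: inner_sum_left inner_add_left restr_inner)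
    also have "\<dots> = (\<Sum>i<Suc d. \<Sum>k<N. \<Sum>j<i. (1 / real N) * (q * inner (blinfun_apply (x (i - j - 1)) (init (c k) (v j))) (init (c k) (v i))
      + inner (blinfun_apply (x (i - j - 1)) (tail (c k) (v j))) (tail (c k) (v i))))"
      unfolding sum_distrib_left by (rule sum.cong[OF refl], rule sum.swap)
    also have "\<dots> = (\<Sum>k<N. \<Sum>i<Suc d. \<Sum>j<i. (1 / real N) * (q * inner (blinfun_apply (x (i - j - 1)) (init (c k) (v j))) (init (c k) (v i))
      + inner (blinfun_apply (x (i - j - 1)) (tail (c k) (v j))) (tail (c k) (v i))))"
      by (rule sum.swap)
    also have "\<dots> = (\<Sum>k<N. (1 / real N) * (q * tcross d x (\<lambda>i. init (c k) (v i)) + tcross d x (\<lambda>i. tail (c k) (v i))))"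
      unfolding tcross_def sum_distrib_left sum.distrib distrib_left ..
    finally have cross: "tcross d y v = (\<Sum>k<N. (1 / real N) * (q * tcross d x (\<lambda>i. init (c k) (v i)) + tcross d x (\<lambda>i. tail (c k) (v i))))" .
    have "nsq d v = (\<Sum>k<N. (1 / real N) * nsq d v)" using N by simp
    then have form: "tform d y v = (\<Sum>k<N. (1 / real N) * (nsq d v + 2 * (q * tcross d x (\<lambda>i. init (c k) (v i)) + tcross d x (\<lambda>i. tail (c k) (v i)))))"
      unfolding tform_def cross by (simp add: sum.distrib sum_distrib_left algebra_simps)
    have "(\<Sum>k<N. (1 / real N) * (nsq d v + 2 * (q * tcross d x (\<lambda>i. init (c k) (v i)) + tcross d x (\<lambda>i. tail (c k) (v i)))))
      \<ge> (\<Sum>k<N. (1 / real N) * (- e' * nsq d v))"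
    proof (intro sum_mono mult_left_mono)
      fix k
      \<comment> \<open>Each cut is treated alone: the scaled initial part has a nonnegative form,
        the part beyond the cut is bounded by \<open>e'\<close> because the cut lies at or beyond
        \<open>m\<close>, and the two values of \<open>nsq\<close> add up to
        \<open>nsq d v\<close>.\<close>
      have "0 \<le> q * (tform d x (\<lambda>i. init (c k) (v i)) + e * nsq d (\<lambda>i. init (c k) (v i)))"
        using e(2)[of "\<lambda>i. init (c k) (v i)"] q by simp
      also have "\<dots> = ((1 + e) * q) * nsq d (\<lambda>i. init (c k) (v i)) + 2 * (q * tcross d x (\<lambda>i. init (c k) (v i)))"
        unfolding tform_def by (simp add: algebra_simps)
      finally have 1: "0 \<le> nsq d (\<lambda>i. init (c k) (v i)) + 2 * (q * tcross d x (\<lambda>i. init (c k) (v i)))"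
        unfolding q(4) by simp
      have "{m..} \<inter> {c k..} = {c k..}" using mc[of k] by auto
      then have "tail m (tail (c k) u) = tail (c k) u" for u by (simp add: restr_vec_restr_vec)
      then have "- e' * nsq d (\<lambda>i. tail (c k) (v i)) \<le> tform d x (\<lambda>i. tail (c k) (v i))"
        using m[of "\<lambda>i. tail (c k) (v i)"] by simp
      moreover have "e' * nsq d (\<lambda>i. tail (c k) (v i)) \<le> e' * nsq d v"
        using e' by (intro mult_left_mono nsq_tail_le) auto
      ultimately have 2: "- e' * nsq d v \<le> nsq d (\<lambda>i. tail (c k) (v i)) + 2 * tcross d x (\<lambda>i. tail (c k) (v i))"
        unfolding tform_def by simp
      show "- e' * nsq d v \<le> nsq d v + 2 * (q * tcross d x (\<lambda>i. init (c k) (v i)) + tcross d x (\<lambda>i. tail (c k) (v i)))"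
        using 1 2 unfolding nsq_init_tail[of d "c k" v, symmetric] distrib_left[of 2] by simp
    qed simp
    then show ?thesis unfolding form using N by simp
  qed
  then show ?thesis using that yBB yK ynorm by blast
qed


lemma tendsto_tform:
  assumes "\<And>l. l < d \<Longrightarrow> (\<lambda>n. y n l) \<longlonglongrightarrow> z l"
  shows "(\<lambda>n. tform d (y n) v) \<longlonglongrightarrow> tform d z v"
proof -
  have "(\<lambda>n. inner (blinfun_apply (y n (i - j - 1)) (v j)) (v i))
      \<longlonglongrightarrow> inner (blinfun_apply (z (i - j - 1)) (v j)) (v i)" if "i < Suc d" "j < i" for i j
    using that by (intro tendsto_inner blinfun.tendsto assms tendsto_const) auto
  then show ?thesis
    unfolding tform_def tcross_def
    by (intro tendsto_add tendsto_mult tendsto_const tendsto_sum) auto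
qed

theorem ess_nonneg_imp_compact_perturbation:
  assumes x: "\<And>l. l < d \<Longrightarrow> x l \<in> BB" and ess: "ess_nonneg d x"
  obtains k where "\<And>l. l < d \<Longrightarrow> k l \<in> KK" "\<And>v. 0 \<le> tform d (\<lambda>l. x l + k l) v"
proof -
  \<comment> \<open>The product of the defect \<open>e\<close> with the norms controls how far the
    next step moves, so it is this product that must decay geometrically; the summand 1 makes
    \<open>e\<close> itself decay as well.\<close>
  define ok where "ok = (\<lambda>n y. (\<forall>l<d. y l - x l \<in> KK) \<and>
    (\<exists>e\<ge>0. e * (1 + (\<Sum>l<d. norm (y l))) \<le> (1 / 2) ^ n \<and> (\<forall>v. - e * nsq d v \<le> tform d y v)))"
  have step: "\<exists>z. ok n z \<and> (\<forall>l<d. norm (z l - y l) \<le> e * norm (y l) + eta)"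
    if y: "\<forall>l<d. y l - x l \<in> KK" and e: "0 \<le> e" "\<And>v. - e * nsq d v \<le> tform d y v" and eta: "0 < eta" for n y e eta
  proof -
    have yBB: "y l \<in> BB" if "l < d" for l
      using BB_closed_intros(3)[OF x[OF that] KK_BB[OF y[rule_format, OF that]]] by simp
    have yess: "ess_nonneg d y"
      using ess_nonneg_add_compact[OF ess, of "\<lambda>l. y l - x l"] y by simp
    \<comment> \<open>Bounds 1 plus the norms of any tuple that the step can return, so that
      \<open>e'\<close> can be fixed before the tuple is known.\<close>
    define B where "B = 1 + (\<Sum>l<d. norm (y l) + (e * norm (y l) + eta))"
    have B: "1 \<le> B" unfolding B_def using e(1) eta by (simp add: sum_nonneg)
    define e' where "e' = (1 / 2) ^ n / B"
    have e': "0 < e'" unfolding e'_def using B by simp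
    obtain z where z: "\<And>l. l < d \<Longrightarrow> z l - y l \<in> KK" "\<And>l. l < d \<Longrightarrow> norm (z l - y l) \<le> e * norm (y l) + eta"
      "\<And>v. - e' * nsq d v \<le> tform d z v"
      using improve_lower_bound[OF yBB yess e e' eta] by metis
    have "z l - x l \<in> KK" if "l < d" for l
      using KK_add[OF z(1)[OF that] y[rule_format, OF that]] by simp
    moreover have "e' * (1 + (\<Sum>l<d. norm (z l))) \<le> (1 / 2) ^ n"
    proof -
      have "norm (z l) \<le> norm (y l) + (e * norm (y l) + eta)" if "l < d" for l
        using z(2)[OF that] norm_triangle_ineq2[of "z l" "y l"] by linarith
      then have "1 + (\<Sum>l<d. norm (z l)) \<le> B" unfolding B_def by (intro add_left_mono sum_mono) auto
      then have "e' * (1 + (\<Sum>l<d. norm (z l))) \<le> e' * B" using e' by (intro mult_left_mono) auto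
      also have "\<dots> = (1 / 2) ^ n" unfolding e'_def using B by simp
      finally show ?thesis .
    qed
    ultimately have "ok n z" unfolding ok_def using e' z(3) by (meson less_imp_le)
    then show ?thesis using z(2) by blast
  qed
  have start: "\<exists>y. ok 0 y"
  proof -
    obtain C where "0 \<le> C" "\<And>v. - C * nsq d v \<le> tform d x v" using tform_bounded_below by blast
    \<comment> \<open>The first move may be large; only its target has to satisfy the
      invariant.\<close>
    then show ?thesis using step[of x C 1 0] KK_zero by auto
  qed
  have "\<exists>z. ok (Suc n) z \<and> (\<forall>l<d. norm (z l - y l) \<le> 2 * (1 / 2) ^ n)" if okn: "ok n y" for n y
  proof -
    obtain e where y: "\<forall>l<d. y l - x l \<in> KK" and e: "0 \<le> e" "e * (1 + (\<Sum>l<d. norm (y l))) \<le> (1 / 2) ^ n"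
      "\<And>v. - e * nsq d v \<le> tform d y v"
      using okn unfolding ok_def by blast
    have "e * norm (y l) \<le> (1 / 2) ^ n" if "l < d" for l
    proof -
      have "norm (y l) \<le> (\<Sum>l<d. norm (y l))" by (rule member_le_sum) (use that in auto)
      then have "e * norm (y l) \<le> e * (1 + (\<Sum>l<d. norm (y l)))" using e(1) by (intro mult_left_mono) auto
      then show ?thesis using e(2) by linarith
    qed
    moreover obtain z where "ok (Suc n) z" "\<forall>l<d. norm (z l - y l) \<le> e * norm (y l) + (1 / 2) ^ n"
      using step[OF y e(1,3), of "(1 / 2) ^ n" "Suc n"] by auto
    ultimately show ?thesis by (intro exI[of _ z]) fastforce
  qed
  then obtain y where y: "\<And>n. ok n (y n)" and diff: "\<And>n l. l < d \<Longrightarrow> norm (y (Suc n) l - y n l) \<le> 2 * (1 / 2) ^ n"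
    using dependent_nat_choice[of ok "\<lambda>n y z. \<forall>l<d. norm (z l - y l) \<le> 2 * (1 / 2) ^ n"] start by metis
  have "convergent (\<lambda>n. y n l)" if l: "l < d" for l
  proof -
    have "summable (\<lambda>n. y (Suc n) l - y n l)"
      by (rule summable_comparison_test'[where g = "\<lambda>n. 2 * (1 / 2) ^ n" and N = 0])
        (use diff l in \<open>auto intro: summable_mult summable_geometric\<close>)
    then have "convergent (\<lambda>n. \<Sum>i<n. y (Suc i) l - y i l)" unfolding summable_iff_convergent .
    then have "convergent (\<lambda>n. (\<Sum>i<n. y (Suc i) l - y i l) + y 0 l)"
      by (intro convergent_add convergent_const)
    then show ?thesis using sum_lessThan_telescope[of "\<lambda>i. y i l"] by simp
  qed
  then obtain z where z: "\<And>l. l < d \<Longrightarrow> (\<lambda>n. y n l) \<longlonglongrightarrow> z l"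
    unfolding convergent_def by metis
  show ?thesis
  proof (rule that[of "\<lambda>l. z l - x l"])
    fix l assume l: "l < d"
    show "z l - x l \<in> KK"
      by (rule closed_sequentially[OF closed_KK, of "\<lambda>n. y n l - x l"])
        (use y l in \<open>auto simp: ok_def intro!: tendsto_diff z\<close>)
  next
    fix v
    have "tform d (\<lambda>l. x l + (z l - x l)) v = tform d z v" by simp
    moreover have "0 \<le> tform d z v"
    proof (rule tendsto_le[OF sequentially_bot tendsto_tform[OF z]])
      have "(\<lambda>n. (1 / 2 :: real) ^ n * nsq d v) \<longlonglongrightarrow> 0 * nsq d v"
        by (intro tendsto_mult LIMSEQ_power_zero tendsto_const) simp
      then show "(\<lambda>n. - ((1 / 2) ^ n * nsq d v)) \<longlonglongrightarrow> 0" by (simp add: tendsto_minus_cancel_left[symmetric])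
      have "- ((1 / 2) ^ n * nsq d v) \<le> tform d (y n) v" for n
      proof -
        obtain e where e: "0 \<le> e" "e * (1 + (\<Sum>l<d. norm (y n l))) \<le> (1 / 2) ^ n" "- e * nsq d v \<le> tform d (y n) v"
          using y[of n] unfolding ok_def by blast
        have "e * 1 \<le> e * (1 + (\<Sum>l<d. norm (y n l)))" using e(1) by (intro mult_left_mono) (auto intro: sum_nonneg)
        then have "e * nsq d v \<le> (1 / 2) ^ n * nsq d v" using e(2) nsq_nonneg by (intro mult_right_mono) auto
        then show ?thesis using e(3) by simp
      qed
      then show "\<forall>\<^sub>F n in sequentially. - ((1 / 2) ^ n * nsq d v) \<le> tform d (y n) v" by simp
    qed
    ultimately show "0 \<le> tform d (\<lambda>l. x l + (z l - x l)) v" by simp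
  qed
qed

section \<open>Toeplitz forms and unital completely positive maps\<close>

lemma hermitian_double_sum:
  fixes F :: "nat \<Rightarrow> nat \<Rightarrow> complex"
  assumes "\<And>i j. i < n \<Longrightarrow> j < n \<Longrightarrow> F j i = cnj (F i j)"
  shows "(\<Sum>i<n. \<Sum>j<n. F i j) = complex_of_real ((\<Sum>i<n. Re (F i i)) + 2 * (\<Sum>i<n. \<Sum>j<i. Re (F i j)))"
  using assms
proof (induction n)
  case (Suc n)
  have IH: "(\<Sum>i<n. \<Sum>j<n. F i j) = complex_of_real ((\<Sum>i<n. Re (F i i)) + 2 * (\<Sum>i<n. \<Sum>j<i. Re (F i j)))"
  proof (rule Suc.IH)
    fix i j assume "i < n" "j < n"
    then show "F j i = cnj (F i j)" by (intro Suc.prems) auto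
  qed
  have diag: "F n n = complex_of_real (Re (F n n))"
    using Suc.prems[of n n] by (simp add: complex_eq_iff)
  have off: "(\<Sum>i<n. F i n) + (\<Sum>j<n. F n j) = complex_of_real (2 * (\<Sum>j<n. Re (F n j)))"
  proof -
    have "F i n + F n i = complex_of_real (2 * Re (F n i))" if "i < n" for i
      using Suc.prems[of n i] that by (simp add: complex_eq_iff)
    then have "(\<Sum>i<n. F i n + F n i) = (\<Sum>i<n. complex_of_real (2 * Re (F n i)))"
      by (intro sum.cong refl) auto
    then show ?thesis by (simp only: sum.distrib sum_distrib_left of_real_sum)
  qed
  have "(\<Sum>i<Suc n. \<Sum>j<Suc n. F i j) = (\<Sum>i<n. \<Sum>j<n. F i j) + ((\<Sum>i<n. F i n) + (\<Sum>j<n. F n j)) + F n n"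
    unfolding sum.lessThan_Suc sum.distrib by (simp only: add_ac)
  also have "\<dots> = complex_of_real ((\<Sum>i<n. Re (F i i)) + 2 * (\<Sum>i<n. \<Sum>j<i. Re (F i j)))
      + complex_of_real (2 * (\<Sum>j<n. Re (F n j))) + complex_of_real (Re (F n n))"
    unfolding off diag[symmetric] IH ..
  finally show ?case
    unfolding sum.lessThan_Suc distrib_left of_real_add[symmetric] by (simp only: add_ac)
qed simp

definition op_toeplitz :: "(nat \<Rightarrow> op) \<Rightarrow> nat \<Rightarrow> nat \<Rightarrow> op" where
  "op_toeplitz x i j = (if i = j then id_blinfun else if j < i then x (i - j - 1) else op_adj (x (j - i - 1)))"

text \<open>Justifies defining \<open>tform\<close> by the lower half: the full block form is real
  and equal to it, so positivity of the operator matrix is one real inequality.\<close>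

lemma op_toeplitz_form:
  assumes x: "\<And>l. l < d \<Longrightarrow> x l \<in> BB"
  shows "(\<Sum>i<Suc d. \<Sum>j<Suc d. ell2_cinner (blinfun_apply (op_toeplitz x i j) (v j)) (v i))
    = complex_of_real (tform d x v)"
proof -
  have "(\<Sum>i<Suc d. \<Sum>j<Suc d. ell2_cinner (blinfun_apply (op_toeplitz x i j) (v j)) (v i))
    = complex_of_real ((\<Sum>i<Suc d. Re (ell2_cinner (blinfun_apply (op_toeplitz x i i) (v i)) (v i)))
      + 2 * (\<Sum>i<Suc d. \<Sum>j<i. Re (ell2_cinner (blinfun_apply (op_toeplitz x i j) (v j)) (v i))))"
  proof (rule hermitian_double_sum)
    fix i j assume ij: "i < Suc d" "j < Suc d"
    consider "j < i" "i - j - 1 < d" | "i < j" "j - i - 1 < d" | "i = j" using ij by linarith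
    then show "ell2_cinner (blinfun_apply (op_toeplitz x j i) (v i)) (v j)
      = cnj (ell2_cinner (blinfun_apply (op_toeplitz x i j) (v j)) (v i))"
    proof cases
      case 1
      then show ?thesis using op_adj(3)[OF x[of "i - j - 1"], of "v i" "v j"]
        by (simp add: op_toeplitz_def cinner_commute[symmetric])
    next
      case 2
      then show ?thesis using op_adj(2)[OF x[of "j - i - 1"], of "v i" "v j"]
        by (simp add: op_toeplitz_def cinner_commute[symmetric])
    next
      case 3
      then show ?thesis by (simp add: op_toeplitz_def cinner_commute[symmetric])
    qed
  qed
  also have "(\<Sum>i<Suc d. Re (ell2_cinner (blinfun_apply (op_toeplitz x i i) (v i)) (v i))) = nsq d v"
    unfolding nsq_def by (rule sum.cong[OF refl]) (simp add: op_toeplitz_def Re_cinner power2_norm_eq_inner)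
  also have "(\<Sum>i<Suc d. \<Sum>j<i. Re (ell2_cinner (blinfun_apply (op_toeplitz x i j) (v j)) (v i))) = tcross d x v"
    unfolding tcross_def
    by (rule sum.cong[OF refl], rule sum.cong[OF refl]) (simp add: op_toeplitz_def Re_cinner)
  finally show ?thesis unfolding tform_def .
qed

lemma op_block_psd_toeplitz:
  assumes "\<And>l. l < d \<Longrightarrow> x l \<in> BB" "\<And>v. 0 \<le> tform d x v"
  shows "op_block_psd (Suc d) (op_toeplitz x)"
  unfolding op_block_psd_def
proof
  fix v
  have "(\<Sum>i<Suc d. \<Sum>j<Suc d. ell2_cinner (blinfun_apply (op_toeplitz x i j) (v j)) (v i))
    = complex_of_real (tform d x v)" by (rule op_toeplitz_form[OF assms(1)])
  then show "0 \<le> (\<Sum>i<Suc d. \<Sum>j<Suc d. ell2_cinner (blinfun_apply (op_toeplitz x i j) (v j)) (v i))"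
    using assms(2)[of v] by (simp only: zero_le_complex_iff Re_complex_of_real Im_complex_of_real)
qed

lemma ucpD:
  assumes "ucp A n \<phi>"
  shows "a \<in> A \<Longrightarrow> \<phi> a \<in> carrier_mat n n"
    "a \<in> A \<Longrightarrow> b \<in> A \<Longrightarrow> \<phi> (a + b) = \<phi> a + \<phi> b"
    "a \<in> A \<Longrightarrow> \<phi> (op_scale c a) = c \<cdot>\<^sub>m \<phi> a"
    "\<phi> id_blinfun = 1\<^sub>m n"
    "(\<And>i j. i < k \<Longrightarrow> j < k \<Longrightarrow> f i j \<in> A) \<Longrightarrow> op_block_psd k f \<Longrightarrow> psd (k * n) (block_mat k n (\<lambda>i j. \<phi> (f i j)))"
proof -
  note u = assms[unfolded ucp_def]
  show "a \<in> A \<Longrightarrow> \<phi> a \<in> carrier_mat n n" by (rule u[THEN conjunct1, rule_format])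
  show "a \<in> A \<Longrightarrow> b \<in> A \<Longrightarrow> \<phi> (a + b) = \<phi> a + \<phi> b"
    by (rule u[THEN conjunct2, THEN conjunct1, rule_format])
  show "a \<in> A \<Longrightarrow> \<phi> (op_scale c a) = c \<cdot>\<^sub>m \<phi> a"
    by (rule u[THEN conjunct2, THEN conjunct2, THEN conjunct1, rule_format])
  show "\<phi> id_blinfun = 1\<^sub>m n"
    by (rule u[THEN conjunct2, THEN conjunct2, THEN conjunct2, THEN conjunct1])
  show "psd (k * n) (block_mat k n (\<lambda>i j. \<phi> (f i j)))"
    if "\<And>i j. i < k \<Longrightarrow> j < k \<Longrightarrow> f i j \<in> A" "op_block_psd k f"
    by (rule u[THEN conjunct2, THEN conjunct2, THEN conjunct2, THEN conjunct2, rule_format]) (simp_all add: that)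
qed

lemma ucp_mono: "ucp A n \<phi> \<Longrightarrow> B \<subseteq> A \<Longrightarrow> ucp B n \<phi>"
  unfolding ucp_def by (meson subsetD)

text \<open>Complete positivity turns the operator Toeplitz matrix into a psd block matrix. The
  Hermitian symmetry of the latter identifies images of adjoints with adjoints of images, so it is
  the Toeplitz matrix of \<open>map \<phi> xs\<close>.\<close>

lemma ucp_block_toeplitz_psd:
  assumes \<phi>: "ucp A n \<phi>" and x: "\<And>l. l < d \<Longrightarrow> xs ! l \<in> BB" and len: "length xs = d"
    and A: "id_blinfun \<in> A" "set xs \<subseteq> A" "op_adj ` set xs \<subseteq> A"
    and pos: "\<And>v. 0 \<le> tform d (\<lambda>l. xs ! l) v"
  shows "psd (Suc d * n) (block_toeplitz d n (map \<phi> xs))" "map \<phi> xs \<in> mat_tuples d n"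
proof -
  let ?x = "\<lambda>l. xs ! l"
  have xA: "xs ! l \<in> A" "op_adj (xs ! l) \<in> A" if "l < d" for l using that len A by auto
  have TA: "op_toeplitz ?x i j \<in> A" if "i < Suc d" "j < Suc d" for i j
    using that xA A(1) unfolding op_toeplitz_def by auto
  show tup: "map \<phi> xs \<in> mat_tuples d n"
    unfolding mat_tuples_def using len A(2) ucpD(1)[OF \<phi>] by auto
  have psd: "psd (Suc d * n) (block_mat (Suc d) n (\<lambda>i j. \<phi> (op_toeplitz ?x i j)))"
    by (rule ucpD(5)[OF \<phi> TA op_block_psd_toeplitz[OF x pos]])
  have "toeplitz_entry n (map \<phi> xs) i j $$ (r, s) = \<phi> (op_toeplitz ?x i j) $$ (r, s)"
    if ij: "i < Suc d" "j < Suc d" and rs: "r < n" "s < n" for i j r s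
  proof -
    consider "j < i" "i - j - 1 < d" | "i < j" "j - i - 1 < d" | "i = j" using ij by linarith
    then show ?thesis
    proof cases
      case 1
      then show ?thesis using len by (simp add: toeplitz_entry_def op_toeplitz_def)
    next
      case 2
      have "\<phi> (op_toeplitz ?x i j) $$ (r, s) = cnj (\<phi> (op_toeplitz ?x j i) $$ (s, r))"
        using psd_hermitian[OF psd block_index_less[OF ij(2) rs(2)] block_index_less[OF ij(1) rs(1)]] ij rs
        by (simp add: block_mat_index del: mult_Suc)
      then show ?thesis
        using 2 len rs mat_tuples_nth[OF tup 2(2)] by (simp add: toeplitz_entry_def op_toeplitz_def)
    next
      case 3
      then show ?thesis by (simp add: toeplitz_entry_def op_toeplitz_def ucpD(4)[OF \<phi>])
    qed
  qed
  then have eq: "(\<Sum>i<Suc d. \<Sum>j<Suc d. \<Sum>r<n. \<Sum>s<n. toeplitz_entry n (map \<phi> xs) i j $$ (r, s) * u j s * cnj (u i r))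
    = (\<Sum>i<Suc d. \<Sum>j<Suc d. \<Sum>r<n. \<Sum>s<n. \<phi> (op_toeplitz ?x i j) $$ (r, s) * u j s * cnj (u i r))" for u :: "nat \<Rightarrow> nat \<Rightarrow> complex"
    by (intro sum.cong refl arg_cong2[where f = "(*)"]) simp_all
  show "psd (Suc d * n) (block_toeplitz d n (map \<phi> xs))"
    unfolding psd_block_toeplitz_iff eq using psd unfolding psd_block_mat_iff .
qed

section \<open>Generated C*-algebras, and compressions that cluster at maps on all bounded
  operators\<close>

lemma BB_cstar_subalgebra: "is_cstar_subalgebra BB"
  unfolding is_cstar_subalgebra_def op.subspace_def
  using closed_BB op_adj(1) by (simp add: BB_closed_intros)

lemma cstar_subset_BB: "S \<subseteq> BB \<Longrightarrow> cstar S \<subseteq> BB"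
  unfolding cstar_def using BB_cstar_subalgebra by blast

lemma cstar_superset: "S \<subseteq> cstar S"
  unfolding cstar_def by blast

lemma cstar_is_subalgebra:
  assumes "S \<subseteq> BB"
  shows "is_cstar_subalgebra (cstar S)"
  unfolding is_cstar_subalgebra_def
proof (intro conjI ballI)
  show "cstar S \<subseteq> BB" by (rule cstar_subset_BB[OF assms])
  show "closed (cstar S)" unfolding cstar_def by (rule closed_Inter) (auto simp: is_cstar_subalgebra_def)
  show "op.subspace (cstar S)" unfolding cstar_def op.subspace_def by (auto simp: is_cstar_subalgebra_def op.subspace_def)
  show "a o\<^sub>L b \<in> cstar S" if "a \<in> cstar S" "b \<in> cstar S" for a b
    using that unfolding cstar_def by (auto simp: is_cstar_subalgebra_def)
  show "op_adj a \<in> cstar S" if "a \<in> cstar S" for a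
    using that unfolding cstar_def by (auto simp: is_cstar_subalgebra_def)
qed

lemma op_system_subset_BB:
  assumes "set xs \<subseteq> BB"
  shows "op_system xs \<subseteq> BB"
  unfolding op_system_def
proof (rule op.span_minimal)
  show "{id_blinfun} \<union> set xs \<union> op_adj ` set xs \<subseteq> BB"
    using assms op_adj(1) BB_closed_intros(1) by auto
  show "op.subspace BB" using BB_cstar_subalgebra unfolding is_cstar_subalgebra_def by simp
qed

lemma cstar_op_system_superset:
  "id_blinfun \<in> cstar (op_system xs)" "set xs \<subseteq> cstar (op_system xs)" "op_adj ` set xs \<subseteq> cstar (op_system xs)"
proof -
  have "{id_blinfun} \<union> set xs \<union> op_adj ` set xs \<subseteq> cstar (op_system xs)"
    unfolding op_system_def by (rule subset_trans[OF op.span_superset cstar_superset])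
  then show "id_blinfun \<in> cstar (op_system xs)" "set xs \<subseteq> cstar (op_system xs)" "op_adj ` set xs \<subseteq> cstar (op_system xs)"
    by simp_all
qed

lemma cstar_op_system_subset_BB: "set xs \<subseteq> BB \<Longrightarrow> cstar (op_system xs) \<subseteq> BB"
  by (intro cstar_subset_BB op_system_subset_BB)

theorem matrix_range_subset:
  assumes xs: "set xs \<subseteq> BB" and len: "length xs = d" and pos: "\<And>v. 0 \<le> tform d (\<lambda>l. xs ! l) v"
  shows "matrix_range xs \<subseteq> (SIGMA n:{1..}. {as \<in> mat_tuples d n. psd (Suc d * n) (block_toeplitz d n as)})"
proof -
  have x: "xs ! l \<in> BB" if "l < d" for l using xs len that by auto
  show ?thesis
    unfolding matrix_range_def
    using ucp_block_toeplitz_psd[OF _ x len cstar_op_system_superset pos] by auto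
qed

text \<open>The algebra of all bounded operators is not separable, so the limit of the compressions is taken
  as a cluster point in a product of discs instead of along a subsequence.\<close>

lemma cluster_ucp:
  fixes e :: "nat \<Rightarrow> nat \<Rightarrow> ell2"
  assumes orth: "\<And>m i j. i < n \<Longrightarrow> j < n \<Longrightarrow> ell2_cinner (e m i) (e m j) = (if i = j then 1 else 0)"
    and tl: "\<And>m i. i < n \<Longrightarrow> tail m (e m i) = e m i"
  shows "\<exists>\<phi>. ucp BB n \<phi> \<and> (\<forall>a\<in>KK. \<phi> a = 0\<^sub>m n n) \<and>
    (\<forall>X eps M. finite X \<longrightarrow> 0 < eps \<longrightarrow> (\<exists>m\<ge>M. \<forall>a\<in>X. \<forall>i<n. \<forall>j<n.
      cmod (\<phi> a $$ (i, j) - ell2_cinner (blinfun_apply a (e m j)) (e m i)) < eps))"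
proof -
  define F where "F = (\<lambda>m (a :: op) i j. if i < n \<and> j < n then ell2_cinner (blinfun_apply a (e m j)) (e m i) else 0)"
  have e1: "norm (e m i) = 1" if "i < n" for m i
  proof -
    have "complex_of_real ((norm (e m i))\<^sup>2) = 1" unfolding cinner_self[symmetric] using orth[OF that that] by simp
    then have "(norm (e m i))\<^sup>2 = 1" unfolding of_real_eq_1_iff .
    then show ?thesis using power2_eq_imp_eq[of "norm (e m i)" 1] by simp
  qed
  \<comment> \<open>A product of discs of radius \<open>norm a\<close> indexed by all operators
    \<open>a\<close>; it contains every compression, and Tychonoff supplies the cluster point
    \<open>f\<close>.\<close>
  define C where "C = {f :: op \<Rightarrow> nat \<Rightarrow> nat \<Rightarrow> complex. \<forall>a. f a \<in> {g. \<forall>i. g i \<in> {h. \<forall>j. h j \<in> cball 0 (norm a)}}}"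
  have "compact C" unfolding C_def by (rule compact_function_space)+ simp
  have FC: "F m \<in> C" for m
  proof -
    have "cmod (F m a i j) \<le> norm a" for a i j
    proof (cases "i < n \<and> j < n")
      case True
      have "cmod (ell2_cinner (blinfun_apply a (e m j)) (e m i)) \<le> norm (blinfun_apply a (e m j)) * norm (e m i)"
        by (rule cmod_cinner_le)
      also have "\<dots> \<le> norm a" using norm_blinfun[of a "e m j"] e1 True by simp
      finally show ?thesis using True unfolding F_def by simp
    next
      case False
      then have "F m a i j = 0" unfolding F_def by (rule if_not_P)
      then show ?thesis by simp
    qed
    then show ?thesis unfolding C_def by simp
  qed
  have "filtermap F sequentially \<noteq> bot" by (simp add: filtermap_bot_iff)
  moreover have "eventually (\<lambda>f. f \<in> C) (filtermap F sequentially)" by (simp add: eventually_filtermap FC)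
  ultimately obtain f where f: "inf (nhds f) (filtermap F sequentially) \<noteq> bot"
    using \<open>compact C\<close> unfolding compact_filter by blast
  have cluster: "\<exists>m\<ge>M. F m \<in> U" if U: "open U" "f \<in> U" for U M
  proof (rule ccontr)
    assume "\<not> (\<exists>m\<ge>M. F m \<in> U)"
    then have "eventually (\<lambda>g. g \<notin> U) (filtermap F sequentially)"
      unfolding eventually_filtermap eventually_sequentially by blast
    moreover have "eventually (\<lambda>g. g \<in> U) (nhds f)" using U by (rule eventually_nhds_in_open)
    ultimately have "eventually (\<lambda>_. False) (inf (nhds f) (filtermap F sequentially))"
      unfolding eventually_inf by (intro exI conjI allI impI) auto
    then show False using f by (simp add: trivial_limit_def)
  qed
  \<comment> \<open>A closed condition that holds for all late compressions passes to
    \<open>f\<close>. Linearity, the unit, positivity and small values on a compact operator are all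
    of this kind.\<close>
  have limit: "f \<in> V" if V: "closed V" "\<And>m. m \<ge> M \<Longrightarrow> F m \<in> V" for V M
    using cluster[of "- V" M] V by (auto simp: open_Compl)
  have cont: "continuous_on UNIV (\<lambda>g :: op \<Rightarrow> nat \<Rightarrow> nat \<Rightarrow> complex. g a i j)" for a i j
    by (rule continuous_on_triple_coordinate)
  have add: "f (a + b) i j = f a i j + f b i j" for a b i j
  proof -
    have "f \<in> {g. g (a + b) i j = g a i j + g b i j}"
      by (rule limit[where M = 0], intro closed_Collect_eq continuous_on_add cont)
        (simp add: F_def blinfun.add_left cinner_add_left)
    then show ?thesis by simp
  qed
  have scale: "f (op_scale c a) i j = c * f a i j" for c a i j
  proof -
    have "f \<in> {g. g (op_scale c a) i j = c * g a i j}"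
      by (rule limit[where M = 0], intro closed_Collect_eq continuous_on_mult continuous_on_const cont)
        (simp add: F_def op_scale_apply cinner_scale_left)
    then show ?thesis by simp
  qed
  have unit: "f id_blinfun i j = (if i = j then 1 else 0)" if "i < n" "j < n" for i j
  proof -
    have "f \<in> {g. g id_blinfun i j = (if i = j then 1 else 0)}"
      by (rule limit[where M = 0], intro closed_Collect_eq continuous_on_const cont)
        (use that orth[of j i] in \<open>auto simp: F_def\<close>)
    then show ?thesis by simp
  qed
  have pos: "0 \<le> (\<Sum>i<k. \<Sum>j<k. \<Sum>r<n. \<Sum>s<n. f (a i j) r s * u j s * cnj (u i r))"
    if BB: "\<And>i j. i < k \<Longrightarrow> j < k \<Longrightarrow> a i j \<in> BB" and psd: "op_block_psd k a" for k a and u :: "nat \<Rightarrow> nat \<Rightarrow> complex"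
  proof -
    have "f \<in> {g. 0 \<le> (\<Sum>i<k. \<Sum>j<k. \<Sum>r<n. \<Sum>s<n. g (a i j) r s * u j s * cnj (u i r))}"
    proof (rule limit[where M = 0])
      show "closed {g. 0 \<le> (\<Sum>i<k. \<Sum>j<k. \<Sum>r<n. \<Sum>s<n. g (a i j) r s * u j s * cnj (u i r))}"
        by (intro closed_nonneg_Collect continuous_on_sum continuous_on_mult continuous_on_const cont)
      fix m
      \<comment> \<open>The block form of the compressions at \<open>u\<close> is the operator block
        form at these vectors.\<close>
      define v where "v = (\<lambda>j. \<Sum>s<n. u j s *\<^sub>\<ell> e m s)"
      have "ell2_cinner (blinfun_apply (a i j) (v j)) (v i) = (\<Sum>r<n. \<Sum>s<n. F m (a i j) r s * u j s * cnj (u i r))"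
        if "i < k" "j < k" for i j
      proof -
        have "ell2_cinner (blinfun_apply (a i j) (v j)) (v i)
          = (\<Sum>r<n. \<Sum>s<n. cnj (u i r) * (u j s * ell2_cinner (blinfun_apply (a i j) (e m s)) (e m r)))"
          unfolding v_def blinfun.sum_right BB_scale[OF BB[OF that]] cinner_sum_right
          by (simp add: cinner_sum_left cinner_scale_left cinner_scale_right sum_distrib_left)
        also have "\<dots> = (\<Sum>r<n. \<Sum>s<n. F m (a i j) r s * u j s * cnj (u i r))"
          by (rule sum.cong[OF refl], rule sum.cong[OF refl]) (simp add: F_def mult_ac)
        finally show ?thesis .
      qed
      then have "(\<Sum>i<k. \<Sum>j<k. ell2_cinner (blinfun_apply (a i j) (v j)) (v i))
        = (\<Sum>i<k. \<Sum>j<k. \<Sum>r<n. \<Sum>s<n. F m (a i j) r s * u j s * cnj (u i r))" by simp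
      moreover have "0 \<le> (\<Sum>i<k. \<Sum>j<k. ell2_cinner (blinfun_apply (a i j) (v j)) (v i))"
        using psd unfolding op_block_psd_def by blast
      ultimately show "F m \<in> {g. 0 \<le> (\<Sum>i<k. \<Sum>j<k. \<Sum>r<n. \<Sum>s<n. g (a i j) r s * u j s * cnj (u i r))}" by simp
    qed
    then show ?thesis by simp
  qed
  have compact0: "f a i j = 0" if a: "a \<in> KK" and ij: "i < n" "j < n" for a i j
  proof -
    have "cmod (f a i j) \<le> eps" if eps: "0 < eps" for eps
    proof -
      obtain M where M: "\<And>m v. M \<le> m \<Longrightarrow> norm (tail m (blinfun_apply a v)) \<le> eps * norm v"
        using KK_tail[OF a eps] by blast
      have "f \<in> {g. cmod (g a i j) \<le> eps}"
      proof (rule limit[where M = M])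
        show "closed {g :: op \<Rightarrow> nat \<Rightarrow> nat \<Rightarrow> complex. cmod (g a i j) \<le> eps}"
          by (intro closed_Collect_le continuous_on_norm continuous_on_const cont)
        fix m assume m: "M \<le> m"
        \<comment> \<open>As \<open>e m i\<close> is supported from \<open>m\<close> on, only the
          tail of the output is seen, and for compact \<open>a\<close> that tail is uniformly
          small.\<close>
        have "ell2_cinner (blinfun_apply a (e m j)) (e m i) = ell2_cinner (tail m (blinfun_apply a (e m j))) (e m i)"
          unfolding cinner_restr_vec tl[OF ij(1)] ..
        then have "cmod (ell2_cinner (blinfun_apply a (e m j)) (e m i)) \<le> norm (tail m (blinfun_apply a (e m j))) * norm (e m i)"
          using cmod_cinner_le by simp
        also have "\<dots> \<le> eps" using M[OF m, of "e m j"] e1 ij by simp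
        finally show "F m \<in> {g. cmod (g a i j) \<le> eps}" using ij by (simp add: F_def)
      qed
      then show ?thesis by simp
    qed
    then have "cmod (f a i j) \<le> 0" by (rule field_le_epsilon[OF order_trans]) auto
    then show ?thesis by simp
  qed
  define \<phi> where "\<phi> = (\<lambda>a. mat n n (\<lambda>(i, j). f a i j))"
  have "ucp BB n \<phi>"
    unfolding ucp_def
  proof (intro conjI ballI allI impI)
    fix a show "\<phi> a \<in> carrier_mat n n" unfolding \<phi>_def by simp
    fix b show "\<phi> (a + b) = \<phi> a + \<phi> b" unfolding \<phi>_def by (rule eq_matI) (auto simp: add)
  next
    fix c a show "\<phi> (op_scale c a) = c \<cdot>\<^sub>m \<phi> a" unfolding \<phi>_def by (rule eq_matI) (auto simp: scale)
  next
    show "\<phi> id_blinfun = 1\<^sub>m n" unfolding \<phi>_def by (rule eq_matI) (auto simp: unit)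
  next
    fix k a assume a: "\<forall>i<k. \<forall>j<k. a i j \<in> BB" "op_block_psd k a"
    have "(\<Sum>i<k. \<Sum>j<k. \<Sum>r<n. \<Sum>s<n. \<phi> (a i j) $$ (r, s) * u j s * cnj (u i r))
      = (\<Sum>i<k. \<Sum>j<k. \<Sum>r<n. \<Sum>s<n. f (a i j) r s * u j s * cnj (u i r))" for u :: "nat \<Rightarrow> nat \<Rightarrow> complex"
      by (intro sum.cong refl arg_cong2[where f = "(*)"]) (simp_all add: \<phi>_def)
    then show "psd (k * n) (block_mat k n (\<lambda>i j. \<phi> (a i j)))"
      unfolding psd_block_mat_iff using pos[OF _ a(2)] a(1) by simp
  qed
  moreover have "\<phi> a = 0\<^sub>m n n" if "a \<in> KK" for a
    unfolding \<phi>_def using compact0[OF that] by (intro eq_matI) auto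
  moreover have "\<exists>m\<ge>M. \<forall>a\<in>X. \<forall>i<n. \<forall>j<n.
      cmod (\<phi> a $$ (i, j) - ell2_cinner (blinfun_apply a (e m j)) (e m i)) < eps"
    if X: "finite X" and eps: "0 < eps" for X eps M
  proof -
    \<comment> \<open>A neighbourhood of \<open>f\<close> determined by finitely many entries; a
      cluster point has arbitrarily late compressions in it.\<close>
    define U where "U = (\<Inter>a\<in>X. \<Inter>i\<in>{..<n}. \<Inter>j\<in>{..<n}. {g :: op \<Rightarrow> nat \<Rightarrow> nat \<Rightarrow> complex. cmod (f a i j - g a i j) < eps})"
    have "open U"
      unfolding U_def using X
      by (intro open_INT ballI open_Collect_less continuous_on_norm continuous_on_diff continuous_on_const cont) auto
    moreover have "f \<in> U" unfolding U_def using eps by simp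
    ultimately obtain m where "m \<ge> M" "F m \<in> U" using cluster by blast
    then show ?thesis
      unfolding U_def by (intro exI[of _ m]) (auto simp: F_def \<phi>_def)
  qed
  ultimately show ?thesis by (intro exI[of _ \<phi>] conjI ballI allI impI)
qed

section \<open>Essential positivity is detected by the essential matrix range\<close>

lemma restr_vec_diff: "restr_vec S (x - y) = restr_vec S x - restr_vec S y"
  by (rule ell2_coord_eqI) (simp add: coord_restr_vec ell2_coord_minus)

lemma restr_vec_sum: "restr_vec S (\<Sum>i\<in>I. f i) = (\<Sum>i\<in>I. restr_vec S (f i))"
  by (induction I rule: infinite_finite_induct) (auto simp: restr_vec_add)

lemma cinner_residual:
  fixes e :: "nat \<Rightarrow> ell2"
  assumes orth: "\<And>i j. i < k \<Longrightarrow> j < k \<Longrightarrow> ell2_cinner (e i) (e j) = (if i = j then 1 else 0)" and s: "s < k"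
  shows "ell2_cinner (w - (\<Sum>i<k. ell2_cinner w (e i) *\<^sub>\<ell> e i)) (e s) = 0"
proof -
  have "(\<Sum>i<k. ell2_cinner w (e i) * ell2_cinner (e i) (e s)) = (\<Sum>i<k. if i = s then ell2_cinner w (e i) else 0)"
    by (rule sum.cong[OF refl]) (simp add: orth s)
  then show ?thesis using s by (simp add: cinner_diff_left cinner_sum_left cinner_scale_left)
qed

text \<open>Dimension count: if all basis vectors from \<open>m\<close> on lay in the span, the
  squared coordinates of the family would sum to 1 at each of \<open>k + 1\<close> places, whereas
  \<open>k\<close> unit vectors have total mass at most \<open>k\<close>.\<close>

lemma basis_vec_outside_span:
  fixes e :: "nat \<Rightarrow> ell2"
  assumes orth: "\<And>i j. i < k \<Longrightarrow> j < k \<Longrightarrow> ell2_cinner (e i) (e j) = (if i = j then 1 else 0)"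
  shows "\<exists>n\<ge>m. basis_vec n \<noteq> (\<Sum>i<k. ell2_cinner (basis_vec n) (e i) *\<^sub>\<ell> e i)"
proof (rule ccontr)
  assume "\<not> ?thesis"
  then have eq: "basis_vec n = (\<Sum>i<k. ell2_cinner (basis_vec n) (e i) *\<^sub>\<ell> e i)" if "n \<ge> m" for n
    using that by blast
  have coord: "ell2_cinner (basis_vec n) (e i) = cnj (ell2_coord (e i) n)" for n i
    using cinner_commute[of "basis_vec n" "e i"] by simp
  have "(\<Sum>i<k. (cmod (ell2_coord (e i) n))\<^sup>2) = 1" if n: "n \<ge> m" for n
  proof -
    have "1 = ell2_coord (basis_vec n) n" by (simp add: coord_basis_vec)
    also have "\<dots> = ell2_coord (\<Sum>i<k. ell2_cinner (basis_vec n) (e i) *\<^sub>\<ell> e i) n"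
      using eq[OF n] by simp
    also have "\<dots> = (\<Sum>i<k. cnj (ell2_coord (e i) n) * ell2_coord (e i) n)"
      unfolding ell2_coord_sum ell2_scale.rep_eq coord ..
    also have "\<dots> = complex_of_real (\<Sum>i<k. (cmod (ell2_coord (e i) n))\<^sup>2)"
      unfolding of_real_sum complex_norm_square by (simp add: mult.commute)
    finally have "complex_of_real (\<Sum>i<k. (cmod (ell2_coord (e i) n))\<^sup>2) = complex_of_real 1" by simp
    then show ?thesis unfolding of_real_eq_iff .
  qed
  then have "real (Suc k) = (\<Sum>n\<in>{m..<m + Suc k}. \<Sum>i<k. (cmod (ell2_coord (e i) n))\<^sup>2)" by simp
  also have "\<dots> = (\<Sum>i<k. \<Sum>n\<in>{m..<m + Suc k}. (cmod (ell2_coord (e i) n))\<^sup>2)" by (rule sum.swap)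
  also have "\<dots> \<le> (\<Sum>i<k. 1)"
  proof (rule sum_mono)
    fix i assume "i \<in> {..<k}"
    then have "complex_of_real ((norm (e i))\<^sup>2) = complex_of_real 1" unfolding cinner_self[symmetric] using orth by simp
    then have "(norm (e i))\<^sup>2 = 1" unfolding of_real_eq_iff .
    moreover have "(\<Sum>n\<in>{m..<m + Suc k}. (cmod (ell2_coord (e i) n))\<^sup>2) \<le> (\<Sum>n<m + Suc k. (cmod (ell2_coord (e i) n))\<^sup>2)"
      by (rule sum_mono2) auto
    ultimately show "(\<Sum>n\<in>{m..<m + Suc k}. (cmod (ell2_coord (e i) n))\<^sup>2) \<le> 1"
      using sum_coord_le[where x = "e i" and N = "m + Suc k"] by linarith
  qed
  finally show False by simp
qed

text \<open>Gram-Schmidt for a possibly dependent family: when the next vector adds nothing, a basis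
  vector from \<open>m\<close> on is orthonormalized in its place. So there are always exactly
  \<open>k\<close> members, as a unital map into matrices of fixed size requires.\<close>

lemma orthonormal_tail_family:
  fixes w :: "nat \<Rightarrow> ell2"
  assumes "\<And>i. i < k \<Longrightarrow> tail m (w i) = w i"
  shows "\<exists>e. (\<forall>i<k. \<forall>j<k. ell2_cinner (e i) (e j) = (if i = j then 1 else 0)) \<and> (\<forall>i<k. tail m (e i) = e i)
    \<and> (\<forall>i<k. w i = (\<Sum>s<k. ell2_cinner (w i) (e s) *\<^sub>\<ell> e s))"
  using assms
proof (induction k)
  case (Suc k)
  then obtain e where orth: "\<And>i j. i < k \<Longrightarrow> j < k \<Longrightarrow> ell2_cinner (e i) (e j) = (if i = j then 1 else 0)"
    and tl: "\<And>i. i < k \<Longrightarrow> tail m (e i) = e i"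
    and span: "\<And>i. i < k \<Longrightarrow> w i = (\<Sum>s<k. ell2_cinner (w i) (e s) *\<^sub>\<ell> e s)" by auto
  define res where "res = (\<lambda>u. u - (\<Sum>i<k. ell2_cinner u (e i) *\<^sub>\<ell> e i))"
  have res0: "ell2_cinner (res u) (e s) = 0" if "s < k" for u s
    unfolding res_def by (rule cinner_residual[OF orth that])
  have rest: "tail m (res u) = res u" if "tail m u = u" for u
    unfolding res_def restr_vec_diff restr_vec_sum restr_vec_scale that using tl by simp
  have "\<exists>u. tail m u = u \<and> res u \<noteq> 0 \<and> (res (w k) \<noteq> 0 \<longrightarrow> u = w k)"
  proof (cases "res (w k) = 0")
    case True
    obtain n where n: "n \<ge> m" "basis_vec n \<noteq> (\<Sum>i<k. ell2_cinner (basis_vec n) (e i) *\<^sub>\<ell> e i)"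
      using basis_vec_outside_span[OF orth] by blast
    have "tail m (basis_vec n) = basis_vec n"
      by (rule ell2_coord_eqI) (use n in \<open>auto simp: coord_restr_vec coord_basis_vec\<close>)
    then show ?thesis using True n unfolding res_def by (intro exI[of _ "basis_vec n"]) auto
  next
    case False
    then show ?thesis using Suc.prems[of k] by (intro exI[of _ "w k"]) auto
  qed
  then obtain u where u: "tail m u = u" "res u \<noteq> 0" "res (w k) \<noteq> 0 \<Longrightarrow> u = w k" by blast
  define c where "c = complex_of_real (1 / norm (res u))"
  define f where "f = c *\<^sub>\<ell> res u"
  have c0: "c \<noteq> 0" unfolding c_def using u(2) by simp
  have "norm f = 1" unfolding f_def norm_ell2_scale c_def norm_of_real using u(2) by simp
  then have ff: "ell2_cinner f f = 1" unfolding cinner_self by simp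
  have fe: "ell2_cinner f (e s) = 0" if "s < k" for s
    unfolding f_def cinner_scale_left using res0[OF that] by simp
  have ef: "ell2_cinner (e s) f = 0" if "s < k" for s
    using fe[OF that] cinner_commute[of "e s" f] by simp
  define g where "g = e(k := f)"
  have g: "g i = e i" if "i < k" for i using that unfolding g_def by simp
  have gk: "g k = f" unfolding g_def by simp
  have gsum: "(\<Sum>s<Suc k. ell2_cinner v (g s) *\<^sub>\<ell> g s) = (\<Sum>s<k. ell2_cinner v (e s) *\<^sub>\<ell> e s) + ell2_cinner v f *\<^sub>\<ell> f" for v
    by (simp add: g gk)
  have zero: "0 *\<^sub>\<ell> x = 0" for x by transfer simp
  have "w i = (\<Sum>s<Suc k. ell2_cinner (w i) (g s) *\<^sub>\<ell> g s)" if "i < Suc k" for i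
  proof (cases "i < k")
    case True
    have "ell2_cinner (w i) f = (\<Sum>s<k. ell2_cinner (w i) (e s) * ell2_cinner (e s) f)"
      by (subst span[OF True]) (simp add: cinner_sum_left cinner_scale_left)
    then have "ell2_cinner (w i) f = 0" using ef by simp
    then show ?thesis unfolding gsum using span[OF True] by (simp add: zero)
  next
    case False
    then have i: "i = k" using that by simp
    have wk: "w k = (\<Sum>s<k. ell2_cinner (w k) (e s) *\<^sub>\<ell> e s) + res (w k)" unfolding res_def by simp
    have "ell2_cinner (w k) f = ell2_cinner (res (w k)) f"
      by (subst wk) (simp add: cinner_add_left cinner_sum_left cinner_scale_left ef)
    moreover have "res (w k) = ell2_cinner (res (w k)) f *\<^sub>\<ell> f"
    proof (cases "res (w k) = 0")
      case True
      then show ?thesis by (simp add: zero)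
    next
      case False
      then have "res (w k) = res u" using u(3) by simp
      also have "\<dots> = (1 / c) *\<^sub>\<ell> f" unfolding f_def ell2_scale_scale using c0 by transfer simp
      finally have eq: "res (w k) = (1 / c) *\<^sub>\<ell> f" .
      show ?thesis unfolding eq cinner_scale_left ff by simp
    qed
    ultimately show ?thesis unfolding gsum i using wk by simp
  qed
  moreover have "ell2_cinner (g i) (g j) = (if i = j then 1 else 0)" if "i < Suc k" "j < Suc k" for i j
    using that orth ff fe ef by (auto simp: less_Suc_eq g gk)
  moreover have "tail m (g i) = g i" if "i < Suc k" for i
  proof (cases "i < k")
    case True
    then show ?thesis using tl g by simp
  next
    case False
    then show ?thesis using that rest[OF u(1)] by (simp add: less_Suc_eq gk f_def restr_vec_scale)
  qed
  ultimately show ?case by (intro exI[of _ g]) blast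
qed simp

text \<open>The shape matches \<open>tform\<close>, with matrices in place of operators, so that the
  two forms can be compared term by term.\<close>

lemma psd_block_toeplitz_real_form:
  fixes u :: "nat \<Rightarrow> nat \<Rightarrow> complex"
  assumes psd: "psd (Suc d * n) (block_toeplitz d n as)" and as: "as \<in> mat_tuples d n"
  shows "0 \<le> (\<Sum>i<Suc d. \<Sum>s<n. (cmod (u i s))\<^sup>2)
    + 2 * (\<Sum>i<Suc d. \<Sum>j<i. Re (\<Sum>r<n. \<Sum>s<n. (as ! (i - j - 1)) $$ (r, s) * u j s * cnj (u i r)))"
proof -
  define F where "F = (\<lambda>i j. \<Sum>r<n. \<Sum>s<n. toeplitz_entry n as i j $$ (r, s) * u j s * cnj (u i r))"
  have "(\<Sum>i<Suc d. \<Sum>j<Suc d. F i j) = complex_of_real ((\<Sum>i<Suc d. Re (F i i)) + 2 * (\<Sum>i<Suc d. \<Sum>j<i. Re (F i j)))"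
  proof (rule hermitian_double_sum)
    fix i j assume "i < Suc d" "j < Suc d"
    then have ij: "i \<le> d" "j \<le> d" by auto
    have "F j i = (\<Sum>r<n. \<Sum>s<n. cnj (toeplitz_entry n as i j $$ (s, r) * u j r * cnj (u i s)))"
      unfolding F_def
    proof (rule sum.cong[OF refl], rule sum.cong[OF refl])
      fix r s assume "r \<in> {..<n}" "s \<in> {..<n}"
      then show "toeplitz_entry n as j i $$ (r, s) * u i s * cnj (u j r) = cnj (toeplitz_entry n as i j $$ (s, r) * u j r * cnj (u i s))"
        using toeplitz_entry_adjoint[OF as ij(2,1), of r s] by simp
    qed
    also have "\<dots> = (\<Sum>s<n. \<Sum>r<n. cnj (toeplitz_entry n as i j $$ (s, r) * u j r * cnj (u i s)))"
      by (rule sum.swap)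
    finally show "F j i = cnj (F i j)" unfolding F_def by simp
  qed
  moreover have "0 \<le> (\<Sum>i<Suc d. \<Sum>j<Suc d. F i j)"
    using psd unfolding psd_block_toeplitz_iff F_def by (rule spec)
  moreover have "(\<Sum>i<Suc d. Re (F i i)) = (\<Sum>i<Suc d. \<Sum>s<n. (cmod (u i s))\<^sup>2)"
  proof (rule sum.cong[OF refl])
    fix i
    have "F i i = (\<Sum>r<n. \<Sum>s<n. if s = r then u i r * cnj (u i r) else 0)"
      unfolding F_def by (rule sum.cong[OF refl], rule sum.cong[OF refl]) (simp add: toeplitz_entry_def)
    also have "\<dots> = complex_of_real (\<Sum>s<n. (cmod (u i s))\<^sup>2)"
      unfolding of_real_sum complex_norm_square by simp
    finally show "Re (F i i) = (\<Sum>s<n. (cmod (u i s))\<^sup>2)" by simp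
  qed
  moreover have "(\<Sum>i<Suc d. \<Sum>j<i. Re (F i j))
    = (\<Sum>i<Suc d. \<Sum>j<i. Re (\<Sum>r<n. \<Sum>s<n. (as ! (i - j - 1)) $$ (r, s) * u j s * cnj (u i r)))"
    unfolding F_def by (rule sum.cong[OF refl], rule sum.cong[OF refl]) (simp add: toeplitz_entry_def)
  ultimately show ?thesis unfolding zero_le_complex_iff by simp
qed

theorem ess_matrix_range_imp_ess_nonneg:
  assumes xs: "set xs \<subseteq> BB" and len: "length xs = d"
    and sub: "ess_matrix_range xs \<subseteq> (SIGMA n:{1..}. {as \<in> mat_tuples d n. psd (Suc d * n) (block_toeplitz d n as)})"
  shows "ess_nonneg d (\<lambda>l. xs ! l)"
proof (rule ccontr)
  \<comment> \<open>This matrix size is chosen because a violating vector has \<open>Suc d\<close>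
    components, which span at most that many dimensions.\<close>
  let ?n = "Suc d"
  assume "\<not> ?thesis"
  then have "\<exists>eps. 0 < eps \<and> (\<forall>m. \<exists>v. \<not> - eps * nsq d (\<lambda>i. tail m (v i)) \<le> tform d (\<lambda>l. xs ! l) (\<lambda>i. tail m (v i)))"
    unfolding ess_nonneg_def by (simp only: not_all not_imp not_ex)
  then obtain eps where eps: "0 < eps"
    and neg: "\<forall>m. \<exists>v. \<not> - eps * nsq d (\<lambda>i. tail m (v i)) \<le> tform d (\<lambda>l. xs ! l) (\<lambda>i. tail m (v i))" by (elim exE conjE)
  obtain v' where v': "\<forall>m. \<not> - eps * nsq d (\<lambda>i. tail m (v' m i)) \<le> tform d (\<lambda>l. xs ! l) (\<lambda>i. tail m (v' m i))"
    using choice[OF neg] by (elim exE)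
  define v where "v = (\<lambda>m i. tail m (v' m i))"
  have v: "tform d (\<lambda>l. xs ! l) (v m) < - eps * nsq d (v m)" for m
    using v'[rule_format, of m] unfolding v_def by simp
  have vt: "tail m (v m i) = v m i" for m i
    unfolding v_def by (simp add: restr_vec_restr_vec)
  have ex: "\<forall>m. \<exists>e. (\<forall>i<?n. \<forall>j<?n. ell2_cinner (e i) (e j) = (if i = j then 1 else 0)) \<and> (\<forall>i<?n. tail m (e i) = e i)
    \<and> (\<forall>i<?n. v m i = (\<Sum>s<?n. ell2_cinner (v m i) (e s) *\<^sub>\<ell> e s))"
    by (rule allI, rule orthonormal_tail_family, rule vt)
  from choice[OF ex]
  obtain e where e: "\<forall>m. (\<forall>i<?n. \<forall>j<?n. ell2_cinner (e m i) (e m j) = (if i = j then 1 else 0)) \<and> (\<forall>i<?n. tail m (e m i) = e m i)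
    \<and> (\<forall>i<?n. v m i = (\<Sum>s<?n. ell2_cinner (v m i) (e m s) *\<^sub>\<ell> e m s))" by (elim exE)
  have orth: "ell2_cinner (e m i) (e m j) = (if i = j then 1 else 0)" if "i < ?n" "j < ?n" for m i j
    by (rule e[rule_format, THEN conjunct1, rule_format, OF that])
  have et: "tail m (e m i) = e m i" if "i < ?n" for m i
    by (rule e[rule_format, THEN conjunct2, THEN conjunct1, rule_format, OF that])
  have span: "v m i = (\<Sum>s<?n. ell2_cinner (v m i) (e m s) *\<^sub>\<ell> e m s)" if "i < ?n" for m i
    by (rule e[rule_format, THEN conjunct2, THEN conjunct2, rule_format, OF that])
  have "\<exists>\<phi>. ucp BB ?n \<phi> \<and> (\<forall>a\<in>KK. \<phi> a = 0\<^sub>m ?n ?n) \<and>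
    (\<forall>X eps M. finite X \<longrightarrow> 0 < eps \<longrightarrow> (\<exists>m\<ge>M. \<forall>a\<in>X. \<forall>i<?n. \<forall>j<?n.
      cmod (\<phi> a $$ (i, j) - ell2_cinner (blinfun_apply a (e m j)) (e m i)) < eps))"
    by (rule cluster_ucp) (rule orth et; assumption)+
  then obtain \<phi> where \<phi>: "ucp BB ?n \<phi>" "\<forall>a\<in>KK. \<phi> a = 0\<^sub>m ?n ?n"
    and approx: "\<forall>X eps M. finite X \<longrightarrow> 0 < eps \<longrightarrow> (\<exists>m\<ge>M. \<forall>a\<in>X. \<forall>i<?n. \<forall>j<?n.
      cmod (\<phi> a $$ (i, j) - ell2_cinner (blinfun_apply a (e m j)) (e m i)) < eps)"
    by (elim exE conjE)
  have "ucp (cstar (op_system xs)) ?n \<phi>"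
    by (rule ucp_mono[OF \<phi>(1) cstar_op_system_subset_BB[OF xs]])
  then have "(?n, map \<phi> xs) \<in> ess_matrix_range xs"
    unfolding ess_matrix_range_def using \<phi>(2) by auto
  then have tup: "map \<phi> xs \<in> mat_tuples d ?n" and psd: "psd (Suc d * ?n) (block_toeplitz d ?n (map \<phi> xs))"
    using sub by auto
  \<comment> \<open>Errors arise in \<open>?n\<close> squared matrix entries for each of at most
    \<open>?n\<close> squared block positions, hence the fourth power; the factor 2 in
    \<open>tform\<close> then turns \<open>eps / 2\<close> into \<open>eps\<close>.\<close>
  define eta where "eta = eps / (2 * (real ?n)^4)"
  have eta: "0 < eta" unfolding eta_def using eps by (intro divide_pos_pos) auto
  from approx[THEN spec[of _ "set xs"], THEN spec[of _ eta], THEN spec[of _ 0], rule_format, OF finite_set eta]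
  obtain m where m': "\<forall>a\<in>set xs. \<forall>i<?n. \<forall>j<?n. cmod (\<phi> a $$ (i, j) - ell2_cinner (blinfun_apply a (e m j)) (e m i)) < eta"
    by (elim exE conjE)
  have m: "cmod (\<phi> a $$ (r, s) - ell2_cinner (blinfun_apply a (e m s)) (e m r)) < eta"
    if "a \<in> set xs" "r < ?n" "s < ?n" for a r s
    by (rule m'[rule_format, OF that])
  \<comment> \<open>Coefficients of the violating vectors in the orthonormal family. The matrix form
    at \<open>u\<close> must be nonnegative, yet it exceeds \<open>tform\<close> at
    \<open>v m\<close> by at most \<open>eps * nsq d (v m)\<close>, and \<open>tform\<close> is
    below minus that amount.\<close>
  define u where "u = (\<lambda>i s. ell2_cinner (v m i) (e m s))"
  have vm: "v m i = (\<Sum>s<?n. u i s *\<^sub>\<ell> e m s)" if "i < ?n" for i unfolding u_def by (rule span[OF that])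
  have normv: "(norm (v m i))\<^sup>2 = (\<Sum>s<?n. (cmod (u i s))\<^sup>2)" if i: "i < ?n" for i
  proof -
    have "complex_of_real ((norm (v m i))\<^sup>2) = ell2_cinner (v m i) (v m i)" by (simp only: cinner_self)
    also have "\<dots> = (\<Sum>s<?n. cnj (u i s) * ell2_cinner (v m i) (e m s))"
      by (subst (2) vm[OF i]) (simp add: cinner_sum_right cinner_scale_right del: sum.lessThan_Suc)
    also have "\<dots> = complex_of_real (\<Sum>s<?n. (cmod (u i s))\<^sup>2)"
      unfolding of_real_sum complex_norm_square u_def by (simp only: mult.commute)
    finally show ?thesis unfolding of_real_eq_iff .
  qed
  have nsq: "nsq d (v m) = (\<Sum>i<?n. \<Sum>s<?n. (cmod (u i s))\<^sup>2)"
    unfolding nsq_def by (rule sum.cong[OF refl]) (use normv in simp)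
  have ubound: "cmod (u i s) \<le> norm (v m i)" if "s < ?n" for i s
  proof -
    have "complex_of_real ((norm (e m s))\<^sup>2) = complex_of_real 1" unfolding cinner_self[symmetric] using orth that by simp
    then have "(norm (e m s))\<^sup>2 = 1" unfolding of_real_eq_iff .
    then have "norm (e m s) = 1" using power2_eq_imp_eq[of "norm (e m s)" 1] by simp
    then show ?thesis unfolding u_def using cmod_cinner_le[of "v m i" "e m s"] by simp
  qed
  define G where "G = (\<lambda>i j. \<Sum>r<?n. \<Sum>s<?n. (map \<phi> xs ! (i - j - 1)) $$ (r, s) * u j s * cnj (u i r))"
  have diff: "Re (G i j) \<le> inner (blinfun_apply (xs ! (i - j - 1)) (v m j)) (v m i) + (real ?n)\<^sup>2 * (eta * nsq d (v m))"
    if ij: "i < ?n" "j < i" for i j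
  proof -
    let ?a = "xs ! (i - j - 1)"
    have l: "i - j - 1 < d" using ij by simp
    then have a: "?a \<in> set xs" "?a \<in> BB" using xs len by auto
    have "ell2_cinner (blinfun_apply ?a (v m j)) (v m i)
      = ell2_cinner (blinfun_apply ?a (\<Sum>s<?n. u j s *\<^sub>\<ell> e m s)) (\<Sum>r<?n. u i r *\<^sub>\<ell> e m r)"
      using ij vm[of i] vm[of j] by simp
    also have "\<dots> = (\<Sum>r<?n. \<Sum>s<?n. cnj (u i r) * (u j s * ell2_cinner (blinfun_apply ?a (e m s)) (e m r)))"
      unfolding blinfun.sum_right BB_scale[OF a(2)] cinner_sum_right
      by (simp add: cinner_sum_left cinner_scale_left cinner_scale_right sum_distrib_left del: sum.lessThan_Suc)
    also have "\<dots> = (\<Sum>r<?n. \<Sum>s<?n. ell2_cinner (blinfun_apply ?a (e m s)) (e m r) * u j s * cnj (u i r))"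
      by (rule sum.cong[OF refl], rule sum.cong[OF refl]) (simp add: mult_ac)
    finally have "G i j - ell2_cinner (blinfun_apply ?a (v m j)) (v m i)
      = (\<Sum>r<?n. \<Sum>s<?n. (\<phi> ?a $$ (r, s) - ell2_cinner (blinfun_apply ?a (e m s)) (e m r)) * (u j s * cnj (u i r)))"
      unfolding G_def using l len by (simp add: sum_subtractf[symmetric] left_diff_distrib mult.assoc del: sum.lessThan_Suc)
    then have "cmod (G i j - ell2_cinner (blinfun_apply ?a (v m j)) (v m i))
      \<le> (\<Sum>r<?n. cmod (\<Sum>s<?n. (\<phi> ?a $$ (r, s) - ell2_cinner (blinfun_apply ?a (e m s)) (e m r)) * (u j s * cnj (u i r))))"
      by (simp only: norm_sum)
    also have "\<dots> \<le> (\<Sum>r<?n. \<Sum>s<?n. eta * nsq d (v m))"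
    proof (intro sum_mono order_trans[OF norm_sum])
      fix r s assume rs: "r \<in> {..<?n}" "s \<in> {..<?n}"
      have "cmod ((\<phi> ?a $$ (r, s) - ell2_cinner (blinfun_apply ?a (e m s)) (e m r)) * (u j s * cnj (u i r)))
        = cmod (\<phi> ?a $$ (r, s) - ell2_cinner (blinfun_apply ?a (e m s)) (e m r)) * (cmod (u j s) * cmod (u i r))"
        by (simp only: norm_mult complex_mod_cnj)
      also have "\<dots> \<le> eta * (norm (v m j) * norm (v m i))"
        using m[OF a(1), of r s] rs ubound eta by (intro mult_mono) (auto intro: less_imp_le)
      also have "\<dots> \<le> eta * nsq d (v m)" using eta ij by (intro mult_left_mono norm_mult_le_nsq) auto
      finally show "cmod ((\<phi> ?a $$ (r, s) - ell2_cinner (blinfun_apply ?a (e m s)) (e m r)) * (u j s * cnj (u i r))) \<le> eta * nsq d (v m)" .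
    qed
    also have "\<dots> = (real ?n)\<^sup>2 * (eta * nsq d (v m))" by (simp add: power2_eq_square del: sum.lessThan_Suc)
    finally have "Re (G i j - ell2_cinner (blinfun_apply ?a (v m j)) (v m i)) \<le> (real ?n)\<^sup>2 * (eta * nsq d (v m))"
      using complex_Re_le_cmod order_trans by blast
    then show ?thesis by (simp add: Re_cinner)
  qed
  have eta2: "0 \<le> eta * nsq d (v m)" using eta nsq_nonneg by simp
  have "(\<Sum>i<?n. \<Sum>j<i. Re (G i j)) \<le> (\<Sum>i<?n. \<Sum>j<i. inner (blinfun_apply (xs ! (i - j - 1)) (v m j)) (v m i) + (real ?n)\<^sup>2 * (eta * nsq d (v m)))"
    by (intro sum_mono diff) auto
  also have "\<dots> = tcross d (\<lambda>l. xs ! l) (v m) + (\<Sum>i<?n. real i * ((real ?n)\<^sup>2 * (eta * nsq d (v m))))"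
    unfolding tcross_def by (simp add: sum.distrib del: sum.lessThan_Suc)
  also have "(\<Sum>i<?n. real i * ((real ?n)\<^sup>2 * (eta * nsq d (v m)))) \<le> (\<Sum>i<?n. real ?n * ((real ?n)\<^sup>2 * (eta * nsq d (v m))))"
    using eta2 by (intro sum_mono mult_right_mono) auto
  also have "\<dots> = (real ?n)^4 * (eta * nsq d (v m))" by (simp add: power4_eq_xxxx power2_eq_square del: sum.lessThan_Suc)
  also have "\<dots> = eps / 2 * nsq d (v m)" unfolding eta_def by simp
  finally have "2 * (\<Sum>i<?n. \<Sum>j<i. Re (G i j)) \<le> 2 * tcross d (\<lambda>l. xs ! l) (v m) + eps * nsq d (v m)" by simp
  moreover have "0 \<le> nsq d (v m) + 2 * (\<Sum>i<?n. \<Sum>j<i. Re (G i j))"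
    using psd_block_toeplitz_real_form[OF psd tup, of u] unfolding nsq G_def .
  moreover have "nsq d (v m) + 2 * tcross d (\<lambda>l. xs ! l) (v m) < - eps * nsq d (v m)"
    using v[of m] unfolding tform_def .
  ultimately show False by simp
qed

section \<open>The absolute value of a self-adjoint operator\<close>

text \<open>Phrased by inner products rather than by \<open>op_adj\<close>, which makes stability
  under norm limits immediate.\<close>

definition selfadj :: "op \<Rightarrow> bool" where
  "selfadj a \<longleftrightarrow> (\<forall>v w. ell2_cinner (blinfun_apply a v) w = ell2_cinner v (blinfun_apply a w))"

lemma selfadjD: "selfadj a \<Longrightarrow> ell2_cinner (blinfun_apply a v) w = ell2_cinner v (blinfun_apply a w)"
  unfolding selfadj_def by blast

lemma selfadj_inner: "selfadj a \<Longrightarrow> inner (blinfun_apply a v) w = inner v (blinfun_apply a w)"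
  unfolding Re_cinner[symmetric] by (simp add: selfadjD)

lemma closed_selfadj: "closed {a. selfadj a}"
proof -
  have "{a. selfadj a} = (\<Inter>v. \<Inter>w. {a. ell2_cinner (blinfun_apply a v) w - ell2_cinner v (blinfun_apply a w) = 0})"
    unfolding selfadj_def by auto
  moreover have "continuous_on UNIV (\<lambda>a. ell2_cinner (blinfun_apply a v) w - ell2_cinner v (blinfun_apply a w))" for v w
    by (intro continuous_on_diff bounded_linear.continuous_on[OF bounded_linear_cinner_left]
        bounded_linear.continuous_on[OF bounded_linear_cinner_right]
        bounded_linear.continuous_on[OF blinfun.bounded_linear_left] continuous_on_id)
  then have "closed {a. ell2_cinner (blinfun_apply a v) w - ell2_cinner v (blinfun_apply a w) = 0}" for v w
    by (intro closed_Collect_eq continuous_on_const)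
  ultimately show ?thesis by (simp only:) (intro closed_INT ballI)
qed

definition commute_op :: "op \<Rightarrow> op \<Rightarrow> bool" where
  "commute_op a b \<longleftrightarrow> a o\<^sub>L b = b o\<^sub>L a"

lemma commute_opD: "commute_op a b \<Longrightarrow> blinfun_apply a (blinfun_apply b v) = blinfun_apply b (blinfun_apply a v)"
  unfolding commute_op_def by (metis blinfun_apply_blinfun_compose)

lemma commute_opI: "(\<And>v. blinfun_apply a (blinfun_apply b v) = blinfun_apply b (blinfun_apply a v)) \<Longrightarrow> commute_op a b"
  unfolding commute_op_def by (rule blinfun_eqI) simp

lemma closed_commute_op: "closed {a. commute_op a b}"
  unfolding commute_op_def
  by (intro closed_Collect_eq bounded_linear.continuous_on[OF bounded_bilinear.bounded_linear_left[OF bounded_bilinear_blinfun_compose]]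
      bounded_linear.continuous_on[OF bounded_bilinear.bounded_linear_right[OF bounded_bilinear_blinfun_compose]] continuous_on_id)

lemma cstar_subalgebraD:
  assumes "is_cstar_subalgebra A"
  shows "A \<subseteq> BB" "closed A" "a \<in> A \<Longrightarrow> b \<in> A \<Longrightarrow> a + b \<in> A" "a \<in> A \<Longrightarrow> r *\<^sub>R a \<in> A"
    "a \<in> A \<Longrightarrow> b \<in> A \<Longrightarrow> a - b \<in> A" "a \<in> A \<Longrightarrow> b \<in> A \<Longrightarrow> a o\<^sub>L b \<in> A" "a \<in> A \<Longrightarrow> op_adj a \<in> A"
    "a \<in> A \<Longrightarrow> op_scale c a \<in> A" "0 \<in> A"
proof -
  have sub: "op.subspace A" using assms unfolding is_cstar_subalgebra_def by simp
  show "A \<subseteq> BB" "closed A" "a \<in> A \<Longrightarrow> b \<in> A \<Longrightarrow> a o\<^sub>L b \<in> A" "a \<in> A \<Longrightarrow> op_adj a \<in> A"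
    using assms unfolding is_cstar_subalgebra_def by simp_all
  show "a \<in> A \<Longrightarrow> b \<in> A \<Longrightarrow> a + b \<in> A" by (rule op.subspace_add[OF sub])
  show "a \<in> A \<Longrightarrow> b \<in> A \<Longrightarrow> a - b \<in> A" by (rule op.subspace_diff[OF sub])
  show "a \<in> A \<Longrightarrow> op_scale c a \<in> A" by (rule op.subspace_scale[OF sub])
  show "0 \<in> A" by (rule op.subspace_0[OF sub])
  have "r *\<^sub>R a = op_scale (complex_of_real r) a"
    by (rule blinfun_eqI) (simp add: op_scale_apply scaleR_eq_scale blinfun.scaleR_left)
  then show "a \<in> A \<Longrightarrow> r *\<^sub>R a \<in> A" using op.subspace_scale[OF sub] by simp
qed

text \<open>The square root of \<open>b\<^sup>2 = 1 - c\<close> is \<open>1 - y\<close>, where \<open>y\<close> is the limit of the iteration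
  \<open>y\<^sub>n\<^sub>+\<^sub>1 = (c + y\<^sub>n\<^sup>2) / 2\<close>; its increments are dominated by those of the same scalar iteration
  with \<open>c = 1\<close>.\<close>

primrec sqrt_iter :: "op \<Rightarrow> nat \<Rightarrow> op" where
  "sqrt_iter c 0 = 0"
| "sqrt_iter c (Suc n) = (1 / 2) *\<^sub>R (c + (sqrt_iter c n o\<^sub>L sqrt_iter c n))"

primrec sqrt_bound :: "nat \<Rightarrow> real" where
  "sqrt_bound 0 = 0"
| "sqrt_bound (Suc n) = (1 + (sqrt_bound n)\<^sup>2) / 2"

lemma sqrt_bound_range: "0 \<le> sqrt_bound n \<and> sqrt_bound n \<le> 1"
proof (induction n)
  case (Suc n)
  then have "(sqrt_bound n)\<^sup>2 \<le> 1" by (simp add: power_le_one)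
  then show ?case by simp
qed simp

lemma sqrt_iter_commute:
  assumes "commute_op a c"
  shows "commute_op a (sqrt_iter c n)"
proof (induction n)
  case 0
  show ?case by (rule commute_opI) simp
next
  case (Suc n)
  show ?case
    by (rule commute_opI)
      (simp add: blinfun.scaleR_left blinfun.scaleR_right blinfun.add_left blinfun.add_right
        commute_opD[OF assms] commute_opD[OF Suc])
qed

lemma commute_op_sym: "commute_op a b \<Longrightarrow> commute_op b a"
  unfolding commute_op_def by simp

lemma sqrt_iter_commute_iter: "commute_op (sqrt_iter c m) (sqrt_iter c n)"
  by (rule sqrt_iter_commute, rule commute_op_sym, rule sqrt_iter_commute) (simp add: commute_op_def)

lemma sqrt_iter_selfadj: "selfadj c \<Longrightarrow> selfadj (sqrt_iter c n)"
proof (induction n)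
  case (Suc n)
  then show ?case
    unfolding selfadj_def
    by (simp add: blinfun.scaleR_left blinfun.add_left scaleR_eq_scale cinner_scale_left cinner_scale_right
        cinner_add_left cinner_add_right)
qed (simp add: selfadj_def)

lemma sqrt_iter_norm:
  assumes "norm c \<le> 1"
  shows "norm (sqrt_iter c n) \<le> sqrt_bound n"
proof (induction n)
  case (Suc n)
  have "norm (sqrt_iter c n o\<^sub>L sqrt_iter c n) \<le> norm (sqrt_iter c n) * norm (sqrt_iter c n)"
    by (rule norm_blinfun_compose)
  also have "\<dots> \<le> (sqrt_bound n)\<^sup>2" unfolding power2_eq_square using Suc by (intro mult_mono) (auto intro: order_trans[OF norm_ge_zero])
  finally have "norm (c + (sqrt_iter c n o\<^sub>L sqrt_iter c n)) \<le> 1 + (sqrt_bound n)\<^sup>2"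
    using assms norm_triangle_ineq[of c "sqrt_iter c n o\<^sub>L sqrt_iter c n"] by linarith
  then show ?case by simp
qed simp

text \<open>The iterates commute, so the difference of their squares factors as for scalars; the
  scalar iteration satisfies the same recursion with equality.\<close>

lemma sqrt_iter_increment:
  assumes "norm c \<le> 1"
  shows "norm (sqrt_iter c (Suc n) - sqrt_iter c n) \<le> sqrt_bound (Suc n) - sqrt_bound n"
proof (induction n)
  case 0
  then show ?case using assms by simp
next
  case (Suc n)
  let ?y = "sqrt_iter c (Suc n)" and ?z = "sqrt_iter c n"
  have eq: "sqrt_iter c (Suc (Suc n)) - sqrt_iter c (Suc n) = (1 / 2) *\<^sub>R ((?y - ?z) o\<^sub>L (?y + ?z))"
  proof (rule blinfun_eqI)
    fix v
    have cm: "blinfun_apply ?y (blinfun_apply ?z v) = blinfun_apply ?z (blinfun_apply ?y v)"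
      by (rule commute_opD[OF sqrt_iter_commute_iter])
    have "blinfun_apply (sqrt_iter c (Suc (Suc n)) - ?y) v
      = (1 / 2) *\<^sub>R (blinfun_apply ?y (blinfun_apply ?y v)) - (1 / 2) *\<^sub>R (blinfun_apply ?z (blinfun_apply ?z v))"
      unfolding sqrt_iter.simps(2)[of c "Suc n"] by (subst (3) sqrt_iter.simps(2))
        (simp only: blinfun.diff_left blinfun.scaleR_left blinfun.add_left blinfun_apply_blinfun_compose scaleR_add_right, simp)
    also have "\<dots> = blinfun_apply ((1 / 2) *\<^sub>R ((?y - ?z) o\<^sub>L (?y + ?z))) v"
      unfolding blinfun.scaleR_left blinfun_apply_blinfun_compose blinfun.diff_left blinfun.add_left blinfun.add_right
        cm scaleR_diff_right[symmetric] by (simp only: scaleR_diff_right scaleR_add_right) simp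
    finally show "blinfun_apply (sqrt_iter c (Suc (Suc n)) - sqrt_iter c (Suc n)) v
      = blinfun_apply ((1 / 2) *\<^sub>R ((?y - ?z) o\<^sub>L (?y + ?z))) v" .
  qed
  have "norm ((?y - ?z) o\<^sub>L (?y + ?z)) \<le> norm (?y - ?z) * norm (?y + ?z)" by (rule norm_blinfun_compose)
  also have "\<dots> \<le> (sqrt_bound (Suc n) - sqrt_bound n) * (sqrt_bound (Suc n) + sqrt_bound n)"
  proof (rule mult_mono[OF Suc.IH])
    show "norm (?y + ?z) \<le> sqrt_bound (Suc n) + sqrt_bound n"
      using norm_triangle_ineq[of ?y ?z] sqrt_iter_norm[OF assms, of "Suc n"] sqrt_iter_norm[OF assms, of n] by linarith
    show "0 \<le> sqrt_bound (Suc n) - sqrt_bound n" using Suc.IH norm_ge_zero order_trans by blast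
  qed simp
  finally have "norm (sqrt_iter c (Suc (Suc n)) - sqrt_iter c (Suc n)) \<le> ((sqrt_bound (Suc n) - sqrt_bound n) * (sqrt_bound (Suc n) + sqrt_bound n)) / 2"
    unfolding eq by simp
  also have "\<dots> = (1 + (sqrt_bound (Suc n))\<^sup>2) / 2 - (1 + (sqrt_bound n)\<^sup>2) / 2"
    by (simp only: power2_eq_square) (simp add: field_simps)
  finally show ?case by (simp only: sqrt_bound.simps(2))
qed

text \<open>\<open>s\<close> is the absolute value of \<open>b\<close>, the square root of
  \<open>b\<close> squared; it stays in the algebra because the iterates do. Its positivity is
  recorded as the bound on \<open>id_blinfun - s\<close>, the form in which the iteration delivers
  it.\<close>

lemma abs_operator:
  assumes A: "is_cstar_subalgebra A" "id_blinfun \<in> A" and b: "b \<in> A" "selfadj b" "norm b \<le> 1"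
  obtains s where "s \<in> A" "selfadj s" "commute_op s b"
    "\<And>v. blinfun_apply s (blinfun_apply s v) = blinfun_apply b (blinfun_apply b v)"
    "norm (id_blinfun - s) \<le> 1"
proof -
  note AD = cstar_subalgebraD[OF A(1)]
  define c where "c = id_blinfun - (b o\<^sub>L b)"
  have cA: "c \<in> A" unfolding c_def by (intro AD(5) AD(6) A(2) b(1))
  have cs: "selfadj c" unfolding selfadj_def c_def
    by (simp add: blinfun.diff_left cinner_diff_left cinner_diff_right selfadjD[OF b(2)])
  have bc: "commute_op b c" by (rule commute_opI) (simp add: c_def blinfun.diff_left blinfun.diff_right)
  have bnorm: "norm (blinfun_apply b v) \<le> norm v" for v
    using norm_blinfun[of b v] b(3) by (meson mult_left_le_one_le norm_ge_zero order_trans)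
  have cnorm: "norm c \<le> 1"
  proof (rule norm_op_leI)
    fix v
    let ?w = "blinfun_apply b v"
    \<comment> \<open>The middle term equals \<open>- 2 * (norm ?w)\<^sup>2\<close> and outweighs
      the last one, which is at most \<open>(norm ?w)\<^sup>2\<close>.\<close>
    have "(norm (blinfun_apply c v))\<^sup>2 = (norm v)\<^sup>2 - 2 * inner v (blinfun_apply b ?w) + (norm (blinfun_apply b ?w))\<^sup>2"
      unfolding c_def by (simp add: blinfun.diff_left power2_norm_eq_inner inner_diff_left inner_diff_right inner_commute)
    also have "inner v (blinfun_apply b ?w) = (norm ?w)\<^sup>2"
      using selfadj_inner[OF b(2), of v ?w] by (simp add: power2_norm_eq_inner)
    also have "(norm (blinfun_apply b ?w))\<^sup>2 \<le> (norm ?w)\<^sup>2" using bnorm by (intro power_mono) auto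
    finally have "(norm (blinfun_apply c v))\<^sup>2 \<le> (norm v)\<^sup>2" using zero_le_power2[of "norm ?w"] by linarith
    then show "norm (blinfun_apply c v) \<le> 1 * norm v" using power2_le_imp_le by simp
  qed simp
  define y where "y = sqrt_iter c"
  have inc: "norm (y (Suc n) - y n) \<le> sqrt_bound (Suc n) - sqrt_bound n" for n
    unfolding y_def by (rule sqrt_iter_increment[OF cnorm])
  have "summable (\<lambda>n. sqrt_bound (Suc n) - sqrt_bound n)"
  proof (rule summableI_nonneg_bounded[where x = 1])
    show "0 \<le> sqrt_bound (Suc n) - sqrt_bound n" for n using inc[of n] norm_ge_zero order_trans by blast
    show "(\<Sum>i<n. sqrt_bound (Suc i) - sqrt_bound i) \<le> 1" for n
      unfolding sum_lessThan_telescope using sqrt_bound_range[of n] by simp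
  qed
  then have "summable (\<lambda>n. y (Suc n) - y n)" by (rule summable_comparison_test') (rule inc)
  then have "convergent (\<lambda>n. (\<Sum>i<n. y (Suc i) - y i) + y 0)"
    unfolding summable_iff_convergent by (intro convergent_add convergent_const)
  then have "convergent y" unfolding sum_lessThan_telescope by simp
  then obtain z where z: "y \<longlonglongrightarrow> z" unfolding convergent_def by blast
  have yA: "y n \<in> A" for n
  proof (induction n)
    case 0
    show ?case unfolding y_def using AD(9) by simp
  next
    case (Suc n)
    then show ?case unfolding y_def sqrt_iter.simps by (intro AD(4) AD(3) AD(6) cA)
  qed
  have zA: "z \<in> A" by (rule closed_sequentially[OF AD(2) _ z]) (rule yA)
  have zs: "selfadj z"
    using closed_sequentially[OF closed_selfadj _ z] sqrt_iter_selfadj[OF cs] unfolding y_def by auto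
  have zb: "commute_op z b"
    using closed_sequentially[OF closed_commute_op _ z, of b] sqrt_iter_commute[OF bc] commute_op_sym unfolding y_def by auto
  have zn: "norm z \<le> 1"
  proof (rule Lim_norm_ubound[OF sequentially_bot z])
    have "norm (y n) \<le> 1" for n
      unfolding y_def using sqrt_iter_norm[OF cnorm, of n] sqrt_bound_range[of n] by linarith
    then show "\<forall>\<^sub>F n in sequentially. norm (y n) \<le> 1" by simp
  qed
  have "(\<lambda>n. y (Suc n)) \<longlonglongrightarrow> (1 / 2) *\<^sub>R (c + (z o\<^sub>L z))"
    unfolding y_def sqrt_iter.simps unfolding y_def[symmetric]
    by (intro tendsto_scaleR tendsto_add tendsto_const bounded_bilinear.tendsto[OF bounded_bilinear_blinfun_compose] z)
  then have fixpt: "z = (1 / 2) *\<^sub>R (c + (z o\<^sub>L z))" using LIMSEQ_unique[OF LIMSEQ_Suc[OF z]] by blast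
  \<comment> \<open>The fixed point equation in the form that says that
    \<open>id_blinfun - z\<close> and \<open>b\<close> have the same square.\<close>
  have zz: "2 *\<^sub>R blinfun_apply z v = v - blinfun_apply b (blinfun_apply b v) + blinfun_apply z (blinfun_apply z v)" for v
  proof -
    have "2 *\<^sub>R blinfun_apply z v = 2 *\<^sub>R blinfun_apply ((1 / 2) *\<^sub>R (c + (z o\<^sub>L z))) v" using fixpt by simp
    then show ?thesis by (simp add: c_def blinfun.scaleR_left blinfun.add_left blinfun.diff_left)
  qed
  show ?thesis
  proof (rule that[of "id_blinfun - z"])
    show "id_blinfun - z \<in> A" by (rule AD(5)[OF A(2) zA])
    show "selfadj (id_blinfun - z)"
      unfolding selfadj_def by (simp add: blinfun.diff_left cinner_diff_left cinner_diff_right selfadjD[OF zs])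
    show "commute_op (id_blinfun - z) b"
      by (rule commute_opI) (simp add: blinfun.diff_left blinfun.diff_right commute_opD[OF zb])
    show "blinfun_apply (id_blinfun - z) (blinfun_apply (id_blinfun - z) v) = blinfun_apply b (blinfun_apply b v)" for v
    proof -
      have "blinfun_apply (id_blinfun - z) (blinfun_apply (id_blinfun - z) v)
        = v - 2 *\<^sub>R blinfun_apply z v + blinfun_apply z (blinfun_apply z v)"
        by (simp add: blinfun.diff_left blinfun.diff_right scaleR_2)
      then show ?thesis unfolding zz by simp
    qed
    show "norm (id_blinfun - (id_blinfun - z)) \<le> 1" using zn by simp
  qed
qed

text \<open>Self-adjointness turns smallness on far inputs into smallness of far outputs: the tail
  of the output is tested against itself.\<close>

lemma compact_of_tail_small:
  assumes BB: "n \<in> BB" and n: "selfadj n" and small: "\<And>e. 0 < e \<Longrightarrow> \<exists>m. \<forall>v. norm (blinfun_apply n (tail m v)) \<le> e * norm v"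
  shows "n \<in> KK"
  unfolding KK_iff
proof (intro conjI allI impI BB)
  fix e :: real assume "0 < e"
  then obtain m where m: "\<And>v. norm (blinfun_apply n (tail m v)) \<le> e * norm v" using small by blast
  have "norm (tail m (blinfun_apply n v)) \<le> e * norm v" for v
  proof -
    let ?t = "tail m (blinfun_apply n v)"
    have tt: "tail m ?t = ?t" by (simp add: restr_vec_restr_vec)
    have "norm ?t * norm ?t = inner ?t ?t" by (simp add: power2_norm_eq_inner[symmetric] power2_eq_square)
    also have "\<dots> = inner (blinfun_apply n v) (tail m ?t)"
      unfolding Re_cinner[symmetric] cinner_restr_vec ..
    also have "\<dots> = inner ?t (blinfun_apply n v)" unfolding tt by (rule inner_commute)
    also have "\<dots> = inner (blinfun_apply n (tail m ?t)) v" unfolding tt selfadj_inner[OF n] ..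
    also have "\<dots> \<le> (e * norm ?t) * norm v"
      using norm_cauchy_schwarz[of "blinfun_apply n (tail m ?t)" v] m[of ?t] by (meson mult_right_mono norm_ge_zero order_trans)
    finally show ?thesis
      by (cases "norm ?t = 0") (use \<open>0 < e\<close> in \<open>auto simp: mult_le_cancel_right mult.commute mult.left_commute\<close>)
  qed
  then show "\<exists>m. \<forall>v. norm (tail m (blinfun_apply n v)) \<le> e * norm v" by blast
qed

text \<open>Here \<open>n = |b| - b\<close> is twice the negative part, so that \<open>b n = - |b| n\<close> and \<open>n\<^sup>2 = 2 |b| n\<close>.\<close>

lemma negative_part_compact:
  assumes b: "b \<in> BB" "selfadj b" "norm b \<le> 1"
    and s: "s \<in> BB" "selfadj s" "commute_op s b" "norm (id_blinfun - s) \<le> 1"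
      "\<And>v. blinfun_apply s (blinfun_apply s v) = blinfun_apply b (blinfun_apply b v)"
    and ess: "\<And>e. 0 < e \<Longrightarrow> \<exists>m. \<forall>v. - e * (norm (tail m v))\<^sup>2 \<le> inner (blinfun_apply b (tail m v)) (tail m v)"
  shows "s - b \<in> KK" "\<And>w. (norm (blinfun_apply s w))\<^sup>2 \<le> 2 * inner (blinfun_apply s w) w"
proof -
  define n where "n = s - b"
  have nBB: "n \<in> BB" unfolding n_def using b s by (intro BB_closed_intros)
  have ns: "selfadj n"
    unfolding selfadj_def n_def by (simp add: blinfun.diff_left cinner_diff_left cinner_diff_right selfadjD[OF b(2)] selfadjD[OF s(2)])
  have bn: "norm (blinfun_apply b v) \<le> norm v" for v
    using norm_blinfun[of b v] b(3) by (meson mult_left_le_one_le norm_ge_zero order_trans)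
  have yn: "norm (v - blinfun_apply s v) \<le> norm v" for v
    using norm_blinfun[of "id_blinfun - s" v] s(4)
    by (simp add: blinfun.diff_left) (meson mult_left_le_one_le norm_ge_zero order_trans)
  have sn: "norm (blinfun_apply s v) \<le> 2 * norm v" for v
    using norm_triangle_ineq4[of v "v - blinfun_apply s v"] yn[of v] by simp
  have nn: "norm (blinfun_apply n v) \<le> 3 * norm v" for v
    unfolding n_def using norm_triangle_ineq4[of "blinfun_apply s v" "blinfun_apply b v"] sn[of v] bn[of v]
    by (simp add: blinfun.diff_left)
  \<comment> \<open>Expanding the squared norm of \<open>w\<close> minus its image, which is at most
    that of \<open>w\<close>, gives a quantitative positivity of \<open>s\<close>.\<close>
  show spos: "(norm (blinfun_apply s w))\<^sup>2 \<le> 2 * inner (blinfun_apply s w) w" for w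
  proof -
    have "(norm (w - blinfun_apply s w))\<^sup>2 \<le> (norm w)\<^sup>2" using yn by (intro power_mono) auto
    then show ?thesis by (simp add: power2_norm_eq_inner inner_diff_left inner_diff_right inner_commute)
  qed
  have sb: "blinfun_apply s (blinfun_apply b v) = blinfun_apply b (blinfun_apply s v)" for v
    by (rule commute_opD[OF s(3)])
  have bnv: "blinfun_apply b (blinfun_apply n v) = - blinfun_apply s (blinfun_apply n v)" for v
    unfolding n_def by (simp add: blinfun.diff_left blinfun.diff_right s(5) sb)
  have nnv: "blinfun_apply n (blinfun_apply n v) = 2 *\<^sub>R blinfun_apply s (blinfun_apply n v)" for v
    unfolding n_def by (simp add: blinfun.diff_left blinfun.diff_right s(5) sb scaleR_2)
  have "\<exists>m. \<forall>v. norm (blinfun_apply n (tail m v)) \<le> dl * norm v" if dl: "0 < dl" for dl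
  proof -
    \<comment> \<open>The form of \<open>b\<close> at \<open>w\<close> below loses 9 + 3 + 3 = 15
      times \<open>e\<close>; the factor 2 in \<open>spos\<close> and the factor 4 from squaring
      \<open>nnv\<close> make this 120.\<close>
    define e where "e = dl ^ 4 / 120"
    have e: "0 < e" unfolding e_def using dl by simp
    obtain p where p: "\<And>v. - e * (norm (tail p v))\<^sup>2 \<le> inner (blinfun_apply b (tail p v)) (tail p v)" using ess[OF e] by blast
    obtain m where m: "\<And>u w. cmod (ell2_cinner (blinfun_apply n (tail m u)) (init p w)) \<le> e * norm u * norm w"
      using cinner_init_tail_small[OF nBB e, of p] by blast
    have "norm (blinfun_apply n (tail m v)) \<le> dl * norm v" for v
    proof -
      define u where "u = tail m v"
      \<comment> \<open>On the range of \<open>n\<close> the form of \<open>b\<close> is minus that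
        of \<open>s\<close>, hence at most 0. For \<open>u\<close> far out, \<open>w\<close> is
        nearly supported from \<open>p\<close> on, where the form of \<open>b\<close> is nearly
        nonnegative. So the form of \<open>s\<close> at \<open>w\<close> is small, and with it the
        images of \<open>w\<close> under \<open>s\<close> and \<open>n\<close>.\<close>
      define w where "w = blinfun_apply n u"
      define i where "i = init p w"
      define t where "t = tail p w"
      have uv: "norm u \<le> norm v" unfolding u_def by (rule norm_restr_vec_le)
      have wv: "norm w \<le> 3 * norm v" unfolding w_def using nn[of u] uv by linarith
      have tv: "norm t \<le> 3 * norm v" unfolding t_def using norm_restr_vec_le[of "{p..}" w] wv by linarith
      have wit: "w = i + t" unfolding i_def t_def init_plus_tail ..
      have iv: "norm i \<le> e * norm v"
      proof -
        have "norm i * norm i = cmod (ell2_cinner i i)"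
          unfolding cinner_self norm_of_real by (simp add: power2_eq_square)
        also have "\<dots> = cmod (ell2_cinner w (init p i))"
          unfolding i_def cinner_restr_vec ..
        also have "\<dots> \<le> e * norm v * norm i" unfolding w_def u_def by (rule m)
        finally show ?thesis using e by (cases "norm i = 0") (auto simp: mult_le_cancel_right)
      qed
      have "inner (blinfun_apply b w) w = inner (blinfun_apply b t) t + inner (blinfun_apply b t) i + inner (blinfun_apply b i) w"
        unfolding wit by (simp add: blinfun.add_right inner_add_left inner_add_right)
      moreover have "- (9 * e * (norm v)\<^sup>2) \<le> inner (blinfun_apply b t) t"
      proof -
        have "(norm t)\<^sup>2 \<le> (3 * norm v)\<^sup>2" using tv by (intro power_mono) auto
        then have "e * (norm t)\<^sup>2 \<le> e * (9 * (norm v)\<^sup>2)" using e by (intro mult_left_mono) (auto simp: power_mult_distrib)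
        then show ?thesis using p[of w] unfolding t_def by simp
      qed
      moreover have "- (3 * e * (norm v)\<^sup>2) \<le> inner (blinfun_apply b t) i"
      proof -
        have "\<bar>inner (blinfun_apply b t) i\<bar> \<le> norm (blinfun_apply b t) * norm i" by (rule Cauchy_Schwarz_ineq2)
        also have "\<dots> \<le> (3 * norm v) * (e * norm v)"
          using order_trans[OF bn tv] iv by (intro mult_mono) auto
        finally show ?thesis by (simp add: power2_eq_square mult_ac)
      qed
      moreover have "- (3 * e * (norm v)\<^sup>2) \<le> inner (blinfun_apply b i) w"
      proof -
        have "\<bar>inner (blinfun_apply b i) w\<bar> \<le> norm (blinfun_apply b i) * norm w" by (rule Cauchy_Schwarz_ineq2)
        also have "\<dots> \<le> (e * norm v) * (3 * norm v)"
          using order_trans[OF bn iv] wv e by (intro mult_mono) auto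
        finally show ?thesis by (simp add: power2_eq_square mult_ac)
      qed
      ultimately have bw: "- (15 * e * (norm v)\<^sup>2) \<le> inner (blinfun_apply b w) w" by linarith
      have "blinfun_apply b w = - blinfun_apply s w" unfolding w_def by (rule bnv)
      then have sw: "inner (blinfun_apply s w) w \<le> 15 * e * (norm v)\<^sup>2" using bw by simp
      have nw: "(norm (blinfun_apply n w))\<^sup>2 \<le> dl ^ 4 * (norm v)\<^sup>2"
      proof -
        have "(norm (blinfun_apply n w))\<^sup>2 = 4 * (norm (blinfun_apply s w))\<^sup>2"
          unfolding w_def nnv by (simp add: power_mult_distrib)
        also have "\<dots> \<le> 120 * e * (norm v)\<^sup>2" using spos[of w] sw by linarith
        finally show ?thesis unfolding e_def by simp
      qed
      \<comment> \<open>Self-adjointness moves \<open>n\<close> from \<open>u\<close> onto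
        \<open>w\<close>, so a bound on the image of \<open>w\<close> bounds the fourth power of
        \<open>norm w\<close>; this is the origin of \<open>dl ^ 4\<close>.\<close>
      have "(norm w)\<^sup>2 = inner (blinfun_apply n w) u"
        unfolding power2_norm_eq_inner using selfadj_inner[OF ns, of w u] w_def by simp
      also have "\<dots> \<le> norm (blinfun_apply n w) * norm u" by (rule norm_cauchy_schwarz)
      also have "\<dots> \<le> norm (blinfun_apply n w) * norm v" using uv by (intro mult_left_mono) auto
      finally have "((norm w)\<^sup>2)\<^sup>2 \<le> (norm (blinfun_apply n w) * norm v)\<^sup>2" by (intro power_mono) auto
      also have "\<dots> \<le> (dl ^ 4 * (norm v)\<^sup>2) * (norm v)\<^sup>2"
        unfolding power_mult_distrib using nw by (intro mult_right_mono) auto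
      also have "\<dots> = ((dl * norm v)\<^sup>2)\<^sup>2" by (simp add: power_mult_distrib flip: power_mult power_add)
      finally have "(norm w)\<^sup>2 \<le> (dl * norm v)\<^sup>2" by (rule power2_le_imp_le) simp
      then have "norm w \<le> dl * norm v" by (rule power2_le_imp_le) (use dl in simp)
      then show ?thesis unfolding w_def u_def .
    qed
    then show ?thesis by blast
  qed
  then show "s - b \<in> KK" using compact_of_tail_small[OF nBB ns] unfolding n_def by blast
qed

text \<open>After normalization, \<open>b\<close> differs from its absolute value \<open>s\<close>
  by a compact operator that lies in \<open>A\<close>, where the map kills compact elements. Its
  value is therefore that at the positive operator \<open>s\<close>: positivity in the quotient,
  obtained inside the algebra.\<close>

lemma essential_state_nonneg:
  assumes A: "is_cstar_subalgebra A" "id_blinfun \<in> A"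
    and \<phi>: "ucp A 1 \<phi>" "\<And>a. a \<in> A \<Longrightarrow> a \<in> KK \<Longrightarrow> \<phi> a = 0\<^sub>m 1 1"
    and b: "b \<in> A" "selfadj b"
    and ess: "\<And>e. 0 < e \<Longrightarrow> \<exists>m. \<forall>v. - e * (norm (tail m v))\<^sup>2 \<le> inner (blinfun_apply b (tail m v)) (tail m v)"
  shows "0 \<le> \<phi> b $$ (0, 0)"
proof -
  note AD = cstar_subalgebraD[OF A(1)]
  \<comment> \<open>Normalizes \<open>b\<close> to norm at most 1; the added 1 keeps
    \<open>r\<close> positive for \<open>b = 0\<close>.\<close>
  define r where "r = norm b + 1"
  have r: "0 < r" unfolding r_def using norm_ge_zero[of b] by linarith
  define b' where "b' = (1 / r) *\<^sub>R b"
  have b'A: "b' \<in> A" unfolding b'_def by (rule AD(4)[OF b(1)])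
  have b's: "selfadj b'" unfolding b'_def selfadj_def
    by (simp add: blinfun.scaleR_left scaleR_eq_scale cinner_scale_left cinner_scale_right selfadjD[OF b(2)])
  have b'n: "norm b' \<le> 1" unfolding b'_def using r r_def by (simp add: divide_le_eq)
  have b'ess: "\<exists>m. \<forall>v. - e * (norm (tail m v))\<^sup>2 \<le> inner (blinfun_apply b' (tail m v)) (tail m v)" if "0 < e" for e
  proof -
    have "0 < e * r" using that r by simp
    then obtain m where m: "\<And>v. - (e * r) * (norm (tail m v))\<^sup>2 \<le> inner (blinfun_apply b (tail m v)) (tail m v)" using ess by blast
    have "- e * (norm (tail m v))\<^sup>2 \<le> inner (blinfun_apply b' (tail m v)) (tail m v)" for v
      using m[of v] r unfolding b'_def by (simp add: blinfun.scaleR_left field_simps)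
    then show ?thesis by blast
  qed
  obtain s where s: "s \<in> A" "selfadj s" "commute_op s b'"
    "\<And>v. blinfun_apply s (blinfun_apply s v) = blinfun_apply b' (blinfun_apply b' v)" "norm (id_blinfun - s) \<le> 1"
    using abs_operator[OF A b'A b's b'n] by blast
  have BB: "b' \<in> BB" "s \<in> BB" using AD(1) b'A s(1) by auto
  have nK: "s - b' \<in> KK" and spos: "\<And>w. (norm (blinfun_apply s w))\<^sup>2 \<le> 2 * inner (blinfun_apply s w) w"
    using negative_part_compact[OF BB(1) b's b'n BB(2) s(2,3,5,4) b'ess] by blast+
  have nA: "s - b' \<in> A" by (rule AD(5)[OF s(1) b'A])
  have "op_block_psd 1 (\<lambda>_ _. s)"
    unfolding op_block_psd_def
  proof
    fix v :: "nat \<Rightarrow> ell2"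
    have "Im (ell2_cinner (blinfun_apply s (v 0)) (v 0)) = 0"
      using selfadjD[OF s(2), of "v 0" "v 0"] cinner_commute[of "v 0" "blinfun_apply s (v 0)"]
      by (metis Reals_cnj_iff complex_is_Real_iff)
    moreover have "0 \<le> Re (ell2_cinner (blinfun_apply s (v 0)) (v 0))"
      unfolding Re_cinner using spos[of "v 0"] zero_le_power2[of "norm (blinfun_apply s (v 0))"] by linarith
    ultimately show "0 \<le> (\<Sum>i<1. \<Sum>j<1. ell2_cinner (blinfun_apply s (v j)) (v i))" by (simp add: zero_le_complex_iff)
  qed
  then have "psd (1 * 1) (block_mat 1 1 (\<lambda>i j. \<phi> s))" using ucpD(5)[OF \<phi>(1), of 1 "\<lambda>_ _. s"] s(1) by simp
  then have "0 \<le> (\<Sum>i<1::nat. \<Sum>j<1::nat. \<Sum>r<1::nat. \<Sum>t<1::nat. \<phi> s $$ (r, t) * 1 * cnj 1)"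
    unfolding psd_block_mat_iff by (rule spec[of _ "\<lambda>_ _. 1"])
  then have ps: "0 \<le> \<phi> s $$ (0, 0)" by simp
  have "b = op_scale (complex_of_real r) b'"
    by (rule blinfun_eqI) (use r in \<open>simp add: op_scale_apply scaleR_eq_scale[symmetric] b'_def blinfun.scaleR_left\<close>)
  then have pb: "\<phi> b = complex_of_real r \<cdot>\<^sub>m \<phi> b'" using ucpD(3)[OF \<phi>(1) b'A] by simp
  have "\<phi> s = \<phi> b' + \<phi> (s - b')" using ucpD(2)[OF \<phi>(1) b'A nA] by simp
  also have "\<phi> (s - b') = 0\<^sub>m 1 1" by (rule \<phi>(2)[OF nA nK])
  finally have "\<phi> s = \<phi> b'" using ucpD(1)[OF \<phi>(1) b'A] by simp
  then have "\<phi> b $$ (0, 0) = complex_of_real r * \<phi> s $$ (0, 0)"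
    unfolding pb using ucpD(1)[OF \<phi>(1) b'A] by simp
  moreover have "0 \<le> complex_of_real r" using r by (simp add: zero_le_complex_iff)
  ultimately show ?thesis using ps by simp
qed

section \<open>Smith-Ward geometry\<close>

text \<open>The 2 by 2 operator matrix with \<open>norm a\<close> on the diagonal and
  \<open>a\<close> and \<open>op_adj a\<close> off it is positive, so its image is psd and hence
  Hermitian.\<close>

lemma ucp_adjoint:
  assumes \<phi>: "ucp A n \<phi>" and A: "is_cstar_subalgebra A" "id_blinfun \<in> A" and a: "a \<in> A" and rs: "r < n" "s < n"
  shows "\<phi> (op_adj a) $$ (r, s) = cnj (\<phi> a $$ (s, r))"
proof -
  note AD = cstar_subalgebraD[OF A(1)]
  define f where "f = (\<lambda>i j :: nat. if i = j then norm a *\<^sub>R id_blinfun else if j < i then a else op_adj a)"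
  have aBB: "a \<in> BB" using a AD(1) by blast
  have "op_block_psd 2 f"
    unfolding op_block_psd_def
  proof
    fix v :: "nat \<Rightarrow> ell2"
    define q where "q = ell2_cinner (blinfun_apply a (v 0)) (v 1)"
    have q': "ell2_cinner (blinfun_apply (op_adj a) (v 1)) (v 0) = cnj q"
      unfolding q_def op_adj(3)[OF aBB] by (rule cinner_commute)
    have "(\<Sum>i<2. \<Sum>j<2. ell2_cinner (blinfun_apply (f i j) (v j)) (v i))
      = complex_of_real (norm a * (norm (v 0))\<^sup>2 + norm a * (norm (v 1))\<^sup>2) + (q + cnj q)"
      by (simp add: numeral_2_eq_2 f_def q_def[symmetric, simplified] q'[simplified] blinfun.scaleR_left scaleR_eq_scale
          cinner_scale_left cinner_self)
    also have "\<dots> = complex_of_real (norm a * (norm (v 0))\<^sup>2 + norm a * (norm (v 1))\<^sup>2 + 2 * Re q)"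
      by (simp add: complex_add_cnj)
    finally have eq: "(\<Sum>i<2. \<Sum>j<2. ell2_cinner (blinfun_apply (f i j) (v j)) (v i))
      = complex_of_real (norm a * (norm (v 0))\<^sup>2 + norm a * (norm (v 1))\<^sup>2 + 2 * Re q)" .
    have "\<bar>Re q\<bar> \<le> norm a * norm (v 0) * norm (v 1)"
      using order_trans[OF abs_Re_le_cmod order_trans[OF cmod_cinner_le mult_right_mono[OF norm_blinfun norm_ge_zero]]]
      unfolding q_def .
    moreover have "2 * (norm (v 0) * norm (v 1)) \<le> (norm (v 0))\<^sup>2 + (norm (v 1))\<^sup>2"
      using sum_squares_bound[of "norm (v 0)" "norm (v 1)"] by simp
    then have "norm a * (2 * (norm (v 0) * norm (v 1))) \<le> norm a * ((norm (v 0))\<^sup>2 + (norm (v 1))\<^sup>2)"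
      by (intro mult_left_mono) auto
    ultimately have "0 \<le> norm a * (norm (v 0))\<^sup>2 + norm a * (norm (v 1))\<^sup>2 + 2 * Re q"
      by (simp add: distrib_left)
    then show "0 \<le> (\<Sum>i<2. \<Sum>j<2. ell2_cinner (blinfun_apply (f i j) (v j)) (v i))"
      unfolding eq zero_le_complex_iff by simp
  qed
  moreover have "f i j \<in> A" for i j
    unfolding f_def using AD(4)[OF A(2)] AD(7)[OF a] a by simp
  ultimately have psd: "psd (2 * n) (block_mat 2 n (\<lambda>i j. \<phi> (f i j)))" using ucpD(5)[OF \<phi>] by blast
  have "block_mat 2 n (\<lambda>i j. \<phi> (f i j)) $$ (0 * n + r, 1 * n + s) = cnj (block_mat 2 n (\<lambda>i j. \<phi> (f i j)) $$ (1 * n + s, 0 * n + r))"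
    by (rule psd_hermitian[OF psd]) (use rs in auto)
  then show ?thesis
    using block_mat_index[of 0 2 1 r n s "\<lambda>i j. \<phi> (f i j)"] block_mat_index[of 1 2 0 s n r "\<lambda>i j. \<phi> (f i j)"] rs
    by (simp add: f_def)
qed

lemma tform_cong: "(\<And>l. l < d \<Longrightarrow> x l = y l) \<Longrightarrow> tform d x v = tform d y v"
  unfolding tform_def tcross_def
  by (intro arg_cong2[where f = "(+)"] arg_cong2[where f = "(*)"] refl sum.cong) auto

text \<open>\<open>essential_state_nonneg\<close> read contrapositively: the element
  \<open>b\<close>, equal to \<open>1 - t\<close> minus the real part of \<open>cnj z\<close> times
  \<open>a\<close>, is sent to \<open>- t\<close>, so its form must be negative at some vector of
  every tail.\<close>

lemma essential_vector:
  assumes A: "is_cstar_subalgebra A" "id_blinfun \<in> A" and a: "a \<in> A"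
    and \<phi>: "ucp A 1 \<phi>" "\<And>a. a \<in> A \<Longrightarrow> a \<in> KK \<Longrightarrow> \<phi> a = 0\<^sub>m 1 1"
    and z: "cmod z = 1" "\<phi> a $$ (0, 0) = z" and t: "0 < t"
  shows "\<exists>u. tail m u = u \<and> norm u = 1 \<and> 1 - t < Re (cnj z * ell2_cinner (blinfun_apply a u) u)"
proof -
  note AD = cstar_subalgebraD[OF A(1)]
  have aBB: "a \<in> BB" using a AD(1) by blast
  define b where "b = op_scale (complex_of_real (1 - t)) id_blinfun
    + op_scale (- 1 / 2) (op_scale (cnj z) a + op_scale z (op_adj a))"
  have bA: "b \<in> A" unfolding b_def by (intro AD(3) AD(8) AD(7) A(2) a)
  have binner: "ell2_cinner (blinfun_apply b v) w = complex_of_real (1 - t) * ell2_cinner v w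
    - (cnj z * ell2_cinner (blinfun_apply a v) w + z * ell2_cinner v (blinfun_apply a w)) / 2" for v w
    unfolding b_def blinfun.add_left op_scale_apply cinner_add_left cinner_scale_left op_adj(3)[OF aBB]
      id_blinfun.rep_eq id_apply
    by (simp add: algebra_simps)
  have bs: "selfadj b"
    unfolding selfadj_def
  proof (intro allI)
    fix v w
    have "ell2_cinner v (blinfun_apply b w) = cnj (ell2_cinner (blinfun_apply b w) v)" by (rule cinner_commute)
    also have "\<dots> = ell2_cinner (blinfun_apply b v) w"
      unfolding binner using cinner_commute[of v w] cinner_commute[of v "blinfun_apply a w"] cinner_commute[of "blinfun_apply a v" w]
      by (simp add: add.commute)
    finally show "ell2_cinner (blinfun_apply b v) w = ell2_cinner v (blinfun_apply b w)" by simp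
  qed
  have "\<phi> b $$ (0, 0) = complex_of_real (1 - t) - (cnj z * z + z * cnj z) / 2"
  proof -
    have dims: "\<phi> x \<in> carrier_mat 1 1" if "x \<in> A" for x by (rule ucpD(1)[OF \<phi>(1) that])
    have d: "dim_row (\<phi> a) = 1" "dim_col (\<phi> a) = 1" "dim_row (\<phi> (op_adj a)) = 1" "dim_col (\<phi> (op_adj a)) = 1"
      using dims[OF a] dims[OF AD(7)[OF a]] by auto
    have in_A: "op_scale c x \<in> A" "x + y \<in> A" if "x \<in> A" "y \<in> A" for c x y
      by (rule AD(8)[OF that(1)], rule AD(3)[OF that])
    have adj: "\<phi> (op_adj a) $$ (0, 0) = cnj z"
      using ucp_adjoint[OF \<phi>(1) A a, of 0 0] z(2) by simp
    have "\<phi> b = complex_of_real (1 - t) \<cdot>\<^sub>m 1\<^sub>m 1 + (- 1 / 2) \<cdot>\<^sub>m (cnj z \<cdot>\<^sub>m \<phi> a + z \<cdot>\<^sub>m \<phi> (op_adj a))"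
      unfolding b_def using A(2) a AD(7)[OF a] in_A
      by (simp only: ucpD(2)[OF \<phi>(1)] ucpD(3)[OF \<phi>(1)] ucpD(4)[OF \<phi>(1)])
    then show ?thesis using d z(2) adj by simp
  qed
  also have "\<dots> = complex_of_real (- t)"
    using z(1) by (simp add: complex_norm_square[symmetric] mult.commute[of "cnj z"])
  finally have "\<not> 0 \<le> \<phi> b $$ (0, 0)" using t by (simp add: zero_le_complex_iff)
  then have "\<not> (\<forall>e>0. \<exists>m. \<forall>v. - e * (norm (tail m v))\<^sup>2 \<le> inner (blinfun_apply b (tail m v)) (tail m v))"
    using essential_state_nonneg[OF A \<phi> bA bs] by blast
  then have "\<exists>e. 0 < e \<and> (\<forall>m. \<exists>v. \<not> - e * (norm (tail m v))\<^sup>2 \<le> inner (blinfun_apply b (tail m v)) (tail m v))"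
    by (simp only: not_all not_imp not_ex)
  then obtain e where e: "0 < e"
    and neg: "\<forall>m. \<exists>v. \<not> - e * (norm (tail m v))\<^sup>2 \<le> inner (blinfun_apply b (tail m v)) (tail m v)" by (elim exE conjE)
  from neg[THEN spec[of _ m]] obtain v where "\<not> - e * (norm (tail m v))\<^sup>2 \<le> inner (blinfun_apply b (tail m v)) (tail m v)"
    by (elim exE)
  then have v: "inner (blinfun_apply b (tail m v)) (tail m v) < - e * (norm (tail m v))\<^sup>2" by simp
  define w where "w = tail m v"
  have "inner (blinfun_apply b w) w < 0"
  proof -
    have "0 \<le> e * (norm w)\<^sup>2" using e by simp
    then show ?thesis using v unfolding w_def by simp
  qed
  then have w0: "w \<noteq> 0" by auto
  define u where "u = (1 / norm w) *\<^sub>R w"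
  have "norm u = 1" unfolding u_def using w0 by simp
  moreover have "tail m u = u"
    unfolding u_def scaleR_eq_scale restr_vec_scale w_def by (simp add: restr_vec_restr_vec)
  moreover have "1 - t < Re (cnj z * ell2_cinner (blinfun_apply a u) u)"
  proof -
    have "inner (blinfun_apply b u) u = (1 / norm w) * ((1 / norm w) * inner (blinfun_apply b w) w)"
      unfolding u_def by (simp add: blinfun.scaleR_right)
    also have "\<dots> < 0" using w0 \<open>inner (blinfun_apply b w) w < 0\<close> by (simp add: mult_pos_neg divide_neg_pos)
    finally have "Re (ell2_cinner (blinfun_apply b u) u) < 0" unfolding Re_cinner .
    moreover have "Re (ell2_cinner (blinfun_apply b u) u) = 1 - t - Re (cnj z * ell2_cinner (blinfun_apply a u) u)"
      unfolding binner cinner_self \<open>norm u = 1\<close> cinner_commute[of u "blinfun_apply a u"]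
      by (simp add: field_simps)
    ultimately show ?thesis by simp
  qed
  ultimately show ?thesis by blast
qed

text \<open>Points of the circle are extreme in the disc: nonnegative terms with sum at most 0
  vanish, so every node of positive weight equals \<open>z\<close>, and this fixes all
  moments.\<close>

lemma circle_extreme:
  fixes z :: complex and p :: "nat \<Rightarrow> real"
  assumes z: "cmod z = 1" and w: "\<And>j. j < N \<Longrightarrow> cmod (w j) = 1" and p: "\<And>j. j < N \<Longrightarrow> 0 \<le> p j" "(\<Sum>j<N. p j) = 1"
    and ge: "1 \<le> Re (cnj z * (\<Sum>j<N. w j * complex_of_real (p j)))"
  shows "(\<Sum>j<N. w j ^ k * complex_of_real (p j)) = z ^ k"
proof -
  have nonneg: "0 \<le> (1 - Re (cnj z * w j)) * p j" if "j < N" for j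
    using complex_Re_le_cmod[of "cnj z * w j"] w[OF that] z p(1)[OF that] by (simp add: norm_mult)
  have "(\<Sum>j<N. (1 - Re (cnj z * w j)) * p j) = 1 - Re (cnj z * (\<Sum>j<N. w j * complex_of_real (p j)))"
    by (simp add: left_diff_distrib sum_subtractf p(2) sum_distrib_left mult.assoc[symmetric])
  then have "(\<Sum>j<N. (1 - Re (cnj z * w j)) * p j) \<le> 0" using ge by simp
  moreover have "0 \<le> (\<Sum>j<N. (1 - Re (cnj z * w j)) * p j)" by (rule sum_nonneg) (use nonneg in auto)
  ultimately have "(\<Sum>j<N. (1 - Re (cnj z * w j)) * p j) = 0" by simp
  then have zero: "(1 - Re (cnj z * w j)) * p j = 0" if "j < N" for j
    using sum_nonneg_eq_0_iff[of "{..<N}" "\<lambda>j. (1 - Re (cnj z * w j)) * p j"] nonneg that by auto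
  have "w j ^ k * complex_of_real (p j) = z ^ k * complex_of_real (p j)" if j: "j < N" for j
  proof (cases "p j = 0")
    case False
    then have re: "Re (cnj z * w j) = 1" using zero[OF j] by simp
    have "(Re (cnj z * w j))\<^sup>2 + (Im (cnj z * w j))\<^sup>2 = (cmod (cnj z * w j))\<^sup>2" by (rule cmod_power2[symmetric])
    also have "cmod (cnj z * w j) = 1" unfolding norm_mult complex_mod_cnj z w[OF j] by simp
    finally have "(Im (cnj z * w j))\<^sup>2 = 0" unfolding re by simp
    then have "cnj z * w j = 1" using re by (simp add: complex_eq_iff)
    then have "z * (cnj z * w j) = z" by simp
    moreover have "z * cnj z = 1" using z by (simp add: complex_norm_square[symmetric])
    ultimately have "w j = z" by (simp add: mult.assoc[symmetric])
    then show ?thesis by simp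
  qed simp
  then have "(\<Sum>j<N. w j ^ k * complex_of_real (p j)) = (\<Sum>j<N. z ^ k * complex_of_real (p j))"
    by (intro sum.cong refl) auto
  also have "\<dots> = z ^ k * complex_of_real (\<Sum>j<N. p j)" by (simp add: sum_distrib_left)
  finally show ?thesis using p(2) by simp
qed

text \<open>The given map on the algebra of \<open>xs\<close> only serves to produce vectors on
  which \<open>xs ! 0\<close> is nearly \<open>z\<close>; the new state lives on all of
  \<open>BB\<close>, hence also on the algebra of the perturbed tuple. Positivity of the Toeplitz
  form supplies a representing measure on the circle, and its mean \<open>z\<close> determines the
  values at the other entries.\<close>

lemma circle_state:
  assumes xs: "set xs \<subseteq> BB" "length xs = d" and k: "\<And>l. l < d \<Longrightarrow> k l \<in> KK"
    and pos: "\<And>v. 0 \<le> tform d (\<lambda>l. xs ! l + k l) v" and z: "cmod z = 1"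
    and ess: "(1, map (\<lambda>l. mat 1 1 (\<lambda>_. z ^ Suc l)) [0..<d]) \<in> ess_matrix_range xs"
  shows "\<exists>\<psi>. ucp BB 1 \<psi> \<and> (\<forall>l<d. \<psi> (xs ! l + k l) $$ (0, 0) = z ^ Suc l)"
proof (cases d)
  case 0
  \<comment> \<open>Without a first entry any state on \<open>BB\<close> will do; the basis vectors
    provide one.\<close>
  have "\<exists>\<psi>. ucp BB 1 \<psi> \<and> (\<forall>a\<in>KK. \<psi> a = 0\<^sub>m 1 1) \<and>
    (\<forall>X eps M. finite X \<longrightarrow> 0 < eps \<longrightarrow> (\<exists>m\<ge>M. \<forall>a\<in>X. \<forall>i<1. \<forall>j<1.
      cmod (\<psi> a $$ (i, j) - ell2_cinner (blinfun_apply a (basis_vec m)) (basis_vec m)) < eps))"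
  proof (rule cluster_ucp[where e = "\<lambda>m _. basis_vec m"])
    show "tail m (basis_vec m) = basis_vec m" for m
      by (rule ell2_coord_eqI) (auto simp: coord_restr_vec coord_basis_vec)
  qed (simp add: coord_basis_vec)
  then show ?thesis using 0 by blast
next
  case (Suc d')
  obtain \<phi> where \<phi>: "ucp (cstar (op_system xs)) 1 \<phi>" "\<forall>a \<in> cstar (op_system xs) \<inter> KK. \<phi> a = 0\<^sub>m 1 1"
    and eq: "map (\<lambda>l. mat 1 1 (\<lambda>_. z ^ Suc l)) [0..<d] = map \<phi> xs"
    using ess unfolding ess_matrix_range_def by auto
  have d0: "0 < d" using Suc by simp
  have "\<phi> (xs ! 0) = map \<phi> xs ! 0" using xs(2) d0 by simp
  also have "\<dots> = mat 1 1 (\<lambda>_. z)" unfolding eq[symmetric] using d0 by simp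
  finally have \<phi>0: "\<phi> (xs ! 0) $$ (0, 0) = z" by simp
  have A: "is_cstar_subalgebra (cstar (op_system xs))"
    by (rule cstar_is_subalgebra[OF op_system_subset_BB[OF xs(1)]])
  have x0: "xs ! 0 \<in> cstar (op_system xs)"
    using cstar_op_system_superset(2)[of xs] nth_mem[of 0 xs] xs(2) d0 by auto
  have "\<forall>m. \<exists>u. tail m u = u \<and> norm u = 1 \<and> 1 - 1 / real (Suc m) < Re (cnj z * ell2_cinner (blinfun_apply (xs ! 0) u) u)"
    using essential_vector[OF A cstar_op_system_superset(1) x0 \<phi>(1) _ z \<phi>0] \<phi>(2) by simp
  from choice[OF this] obtain u where u: "\<forall>m. tail m (u m) = u m \<and> norm (u m) = 1 \<and>
      1 - 1 / real (Suc m) < Re (cnj z * ell2_cinner (blinfun_apply (xs ! 0) (u m)) (u m))" by (elim exE)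
  have "\<exists>\<psi>. ucp BB 1 \<psi> \<and> (\<forall>a\<in>KK. \<psi> a = 0\<^sub>m 1 1) \<and>
    (\<forall>X eps M. finite X \<longrightarrow> 0 < eps \<longrightarrow> (\<exists>m\<ge>M. \<forall>a\<in>X. \<forall>i<1. \<forall>j<1.
      cmod (\<psi> a $$ (i, j) - ell2_cinner (blinfun_apply a (u m)) (u m)) < eps))"
    by (rule cluster_ucp[where e = "\<lambda>m _. u m"]) (use u in \<open>simp_all add: cinner_self\<close>)
  then obtain \<psi> where \<psi>: "ucp BB 1 \<psi>" "\<forall>a\<in>KK. \<psi> a = 0\<^sub>m 1 1"
    and approx: "\<forall>X eps M. finite X \<longrightarrow> 0 < eps \<longrightarrow> (\<exists>m\<ge>M. \<forall>a\<in>X. \<forall>i<1. \<forall>j<1.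
      cmod (\<psi> a $$ (i, j) - ell2_cinner (blinfun_apply a (u m)) (u m)) < eps)" by (elim exE conjE)
  \<comment> \<open>The cluster value inherits the lower bounds \<open>1 - 1 / real (Suc m)\<close>,
    which tend to 1.\<close>
  have ge: "1 \<le> Re (cnj z * \<psi> (xs ! 0) $$ (0, 0))"
  proof (rule field_le_epsilon)
    fix eps :: real assume eps: "0 < eps"
    obtain M where M: "1 / real (Suc M) < eps / 2" using nat_approx_posE[of "eps / 2"] eps by auto
    have "0 < eps / 2" using eps by simp
    from approx[THEN spec[of _ "{xs ! 0}"], THEN spec[of _ "eps / 2"], THEN spec[of _ M], rule_format, OF _ this]
    obtain m where m: "M \<le> m" "cmod (\<psi> (xs ! 0) $$ (0, 0) - ell2_cinner (blinfun_apply (xs ! 0) (u m)) (u m)) < eps / 2"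
      by auto
    let ?q = "ell2_cinner (blinfun_apply (xs ! 0) (u m)) (u m)"
    have "1 / real (Suc m) \<le> 1 / real (Suc M)" using m(1) by (intro divide_left_mono) auto
    then have "1 - eps / 2 < Re (cnj z * ?q)" using u[rule_format, of m] M by linarith
    moreover have "Re (cnj z * (?q - \<psi> (xs ! 0) $$ (0, 0))) \<le> cmod (cnj z * (?q - \<psi> (xs ! 0) $$ (0, 0)))"
      by (rule complex_Re_le_cmod)
    moreover have "cmod (cnj z * (?q - \<psi> (xs ! 0) $$ (0, 0))) < eps / 2"
      unfolding norm_mult complex_mod_cnj z using m(2) by (simp add: norm_minus_commute)
    moreover have "Re (cnj z * (?q - \<psi> (xs ! 0) $$ (0, 0))) = Re (cnj z * ?q) - Re (cnj z * \<psi> (xs ! 0) $$ (0, 0))"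
      by (simp only: right_diff_distrib minus_complex.sel)
    ultimately show "1 \<le> Re (cnj z * \<psi> (xs ! 0) $$ (0, 0)) + eps" by linarith
  qed
  define ys where "ys = map (\<lambda>l. xs ! l + k l) [0..<d]"
  have ysl: "ys ! l = xs ! l + k l" if "l < d" for l unfolding ys_def using that by simp
  have xBB: "xs ! l \<in> BB" if "l < d" for l using xs that nth_mem by blast
  have yBB: "xs ! l + k l \<in> BB" if "l < d" for l using xBB[OF that] KK_BB[OF k[OF that]] by (rule BB_closed_intros(3))
  have lenys: "length ys = d" unfolding ys_def by simp
  have setys: "set ys \<subseteq> BB" unfolding ys_def using yBB by auto
  have posy: "0 \<le> tform d (\<lambda>l. ys ! l) v" for v
    using pos[of v] tform_cong[of d "\<lambda>l. ys ! l" "\<lambda>l. xs ! l + k l" v] ysl by simp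
  have psd: "psd (Suc d * 1) (block_toeplitz d 1 (map \<psi> ys))" and tup: "map \<psi> ys \<in> mat_tuples d 1"
    using ucp_block_toeplitz_psd[OF \<psi>(1) _ lenys BB_closed_intros(1) setys _ posy] setys lenys op_adj(1)
    by (auto simp: subset_iff)
  obtain w y where w: "\<And>j. j < Suc d * 1 \<Longrightarrow> cmod (w j) = 1"
    and y1: "\<And>r s. r < 1 \<Longrightarrow> s < 1 \<Longrightarrow> (\<Sum>j<Suc d * 1. cnj (y j r) * y j s) = (if r = s then 1 else 0)"
    and yl: "\<And>l r s. l < d \<Longrightarrow> r < 1 \<Longrightarrow> s < 1 \<Longrightarrow>
      (map \<psi> ys ! l) $$ (r, s) = (\<Sum>j<Suc d * 1. w j ^ Suc l * (cnj (y j r) * y j s))"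
    using block_toeplitz_moments[OF psd tup] by blast
  define p where "p = (\<lambda>j. (cmod (y j 0))\<^sup>2)"
  have yp: "cnj (y j 0) * y j 0 = complex_of_real (p j)" for j
    unfolding p_def complex_norm_square by (rule mult.commute)
  have p1: "(\<Sum>j<Suc d * 1. p j) = 1"
  proof -
    have "complex_of_real (\<Sum>j<Suc d * 1. p j) = 1" unfolding of_real_sum yp[symmetric] using y1[of 0 0] by simp
    then show ?thesis unfolding of_real_eq_1_iff .
  qed
  have \<psi>y: "\<psi> (xs ! l + k l) $$ (0, 0) = (\<Sum>j<Suc d * 1. w j ^ Suc l * complex_of_real (p j))" if l: "l < d" for l
    using yl[OF l, of 0 0] ysl[OF l] l lenys unfolding yp by simp
  \<comment> \<open>The vectors control \<open>xs ! 0\<close> while the measure represents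
    \<open>xs ! 0 + k 0\<close>; the values agree because the new state vanishes on
    \<open>KK\<close>.\<close>
  have "\<psi> (xs ! 0 + k 0) = \<psi> (xs ! 0) + 0\<^sub>m 1 1"
    using ucpD(2)[OF \<psi>(1) xBB[OF d0] KK_BB[OF k[OF d0]]] \<psi>(2) k[OF d0] by simp
  then have "\<psi> (xs ! 0) $$ (0, 0) = (\<Sum>j<Suc d * 1. w j * complex_of_real (p j))"
    using \<psi>y[OF d0] ucpD(1)[OF \<psi>(1) xBB[OF d0]] by simp
  then have ge': "1 \<le> Re (cnj z * (\<Sum>j<Suc d * 1. w j * complex_of_real (p j)))" using ge by simp
  have "0 \<le> p j" for j unfolding p_def by simp
  then have "(\<Sum>j<Suc d * 1. w j ^ Suc l * complex_of_real (p j)) = z ^ Suc l" for l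
    by (intro circle_extreme[OF z w _ p1 ge'])
  then show ?thesis using \<psi>(1) \<psi>y by (intro exI[of _ \<psi>]) simp
qed

text \<open>The block form of the combined map at \<open>u\<close> splits into forms of the states
  \<open>\<psi> t\<close> at the contracted vectors \<open>w t\<close>, so complete positivity of
  each state carries over; the condition on \<open>y\<close> gives the unit.\<close>

lemma ucp_combination:
  fixes y :: "nat \<Rightarrow> nat \<Rightarrow> complex"
  assumes \<psi>: "\<And>t. t < N \<Longrightarrow> ucp A 1 (\<psi> t)"
    and y: "\<And>r s. r < n \<Longrightarrow> s < n \<Longrightarrow> (\<Sum>t<N. cnj (y t r) * y t s) = (if r = s then 1 else 0)"
  shows "ucp A n (\<lambda>a. mat n n (\<lambda>(r, s). \<Sum>t<N. \<psi> t a $$ (0, 0) * (cnj (y t r) * y t s)))"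
    (is "ucp A n ?\<phi>")
proof -
  have dims: "dim_row (\<psi> t a) = 1" "dim_col (\<psi> t a) = 1" if "t < N" "a \<in> A" for t a
    using ucpD(1)[OF \<psi>[OF that(1)] that(2)] by auto
  show ?thesis
    unfolding ucp_def
  proof (intro conjI ballI allI impI)
    fix a assume a: "a \<in> A"
    show "?\<phi> a \<in> carrier_mat n n" by simp
    fix b assume b: "b \<in> A"
    have "\<psi> t (a + b) $$ (0, 0) = \<psi> t a $$ (0, 0) + \<psi> t b $$ (0, 0)" if "t < N" for t
      using ucpD(2)[OF \<psi>[OF that] a b] dims[OF that b] by simp
    then show "?\<phi> (a + b) = ?\<phi> a + ?\<phi> b"
      by (intro eq_matI) (auto simp: distrib_right sum.distrib)
  next
    fix c a assume a: "a \<in> A"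
    have "\<psi> t (op_scale c a) $$ (0, 0) = c * \<psi> t a $$ (0, 0)" if "t < N" for t
      using ucpD(3)[OF \<psi>[OF that] a] dims[OF that a] by simp
    then show "?\<phi> (op_scale c a) = c \<cdot>\<^sub>m ?\<phi> a"
      by (intro eq_matI) (auto simp: sum_distrib_left mult.assoc)
  next
    have "\<psi> t id_blinfun $$ (0, 0) = 1" if "t < N" for t using ucpD(4)[OF \<psi>[OF that]] by simp
    then show "?\<phi> id_blinfun = 1\<^sub>m n" by (intro eq_matI) (auto simp: y)
  next
    fix k and a :: "nat \<Rightarrow> nat \<Rightarrow> op"
    assume a: "\<forall>i<k. \<forall>j<k. a i j \<in> A" "op_block_psd k a"
    show "psd (k * n) (block_mat k n (\<lambda>i j. ?\<phi> (a i j)))"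
      unfolding psd_block_mat_iff
    proof
      fix u :: "nat \<Rightarrow> nat \<Rightarrow> complex"
      define w where "w = (\<lambda>t j. \<Sum>s<n. y t s * u j s)"
      have entry: "(\<Sum>r<n. \<Sum>s<n. ?\<phi> (a i j) $$ (r, s) * u j s * cnj (u i r))
        = (\<Sum>t<N. \<psi> t (a i j) $$ (0, 0) * w t j * cnj (w t i))" for i j
      proof -
        have "(\<Sum>r<n. \<Sum>s<n. ?\<phi> (a i j) $$ (r, s) * u j s * cnj (u i r))
          = (\<Sum>r<n. \<Sum>s<n. \<Sum>t<N. \<psi> t (a i j) $$ (0, 0) * (y t s * u j s) * cnj (y t r * u i r))"
          by (rule sum.cong[OF refl], rule sum.cong[OF refl]) (simp add: sum_distrib_left sum_distrib_right mult_ac)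
        also have "\<dots> = (\<Sum>t<N. \<Sum>r<n. \<Sum>s<n. \<psi> t (a i j) $$ (0, 0) * (y t s * u j s) * cnj (y t r * u i r))"
          by (rule sum_swap_triple)
        finally show ?thesis unfolding w_def mult_sum_cnj_sum .
      qed
      have "(\<Sum>i<k. \<Sum>j<k. \<Sum>r<n. \<Sum>s<n. ?\<phi> (a i j) $$ (r, s) * u j s * cnj (u i r))
        = (\<Sum>t<N. \<Sum>i<k. \<Sum>j<k. \<psi> t (a i j) $$ (0, 0) * w t j * cnj (w t i))"
        unfolding entry by (rule sum_swap_triple)
      also have "0 \<le> \<dots>"
      proof (rule sum_nonneg)
        fix t assume "t \<in> {..<N}"
        then have "psd (k * 1) (block_mat k 1 (\<lambda>i j. \<psi> t (a i j)))"
          by (intro ucpD(5)[OF \<psi>]) (use a in auto)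
        then have "0 \<le> (\<Sum>i<k. \<Sum>j<k. \<Sum>r<1::nat. \<Sum>s<1::nat. \<psi> t (a i j) $$ (r, s) * w t j * cnj (w t i))"
          unfolding psd_block_mat_iff by (rule spec[of _ "\<lambda>j _. w t j"])
        then show "0 \<le> (\<Sum>i<k. \<Sum>j<k. \<psi> t (a i j) $$ (0, 0) * w t j * cnj (w t i))" by simp
      qed
      finally show "0 \<le> (\<Sum>i<k. \<Sum>j<k. \<Sum>r<n. \<Sum>s<n. ?\<phi> (a i j) $$ (r, s) * u j s * cnj (u i r))" .
    qed
  qed
qed

text \<open>A single node of weight 1. When the essential matrix range is the set on the right,
  these level-one points yield the maps from which the states at the nodes are built.\<close>

lemma circle_point_psd_block_toeplitz:
  assumes z: "cmod z = 1"
  shows "(1, map (\<lambda>l. mat 1 1 (\<lambda>_. z ^ Suc l)) [0..<d])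
    \<in> (SIGMA n:{1..}. {as \<in> mat_tuples d n. psd (Suc d * n) (block_toeplitz d n as)})"
proof -
  let ?as = "map (\<lambda>l. mat 1 1 (\<lambda>_. z ^ Suc l)) [0..<d]"
  have as: "?as \<in> mat_tuples d 1" unfolding mat_tuples_def by auto
  have "psd (Suc d * 1) (block_toeplitz d 1 ?as)"
  proof (rule min_circle_imp_psd[OF as, of 1 "\<lambda>_. 1\<^sub>m 1" "\<lambda>_. map (\<lambda>l. z ^ l) [1..<Suc d]"])
    have "psd 1 (1\<^sub>m 1)" unfolding psd_iff_sum
      by (auto simp: zero_le_complex_iff mult.commute[of _ "cnj _"] complex_mult_cnj)
    moreover have "map (\<lambda>l. z ^ l) [1..<Suc d] \<in> conv_tuples d (circle_curve d)"
      using circle_curve_subset_conv[of d] z unfolding circle_curve_def by blast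
    ultimately show "psd 1 (1\<^sub>m 1) \<and> map (\<lambda>l. z ^ l) [1..<Suc d] \<in> conv_tuples d (circle_curve d)" ..
    show "mat_sum 1 1 (\<lambda>_. 1\<^sub>m 1) = (1\<^sub>m 1 :: complex mat)" by (rule eq_matI) (auto simp: mat_sum_def)
    show "?as ! l = mat_sum 1 1 (\<lambda>j. map (\<lambda>l. z ^ l) [1..<Suc d] ! l \<cdot>\<^sub>m 1\<^sub>m 1)" if "l < d" for l
      using that by (intro eq_matI) (auto simp: mat_sum_def simp del: upt_Suc)
  qed
  then show ?thesis using as by simp
qed

theorem smith_ward_geometry_min_circle:
  "smith_ward_geometry d (min_matrix_convex d (conv_tuples d (circle_curve d)))"
  unfolding smith_ward_geometry_def min_circle_eq_psd_block_toeplitz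
proof (intro allI impI)
  let ?K = "SIGMA n:{1..}. {as \<in> mat_tuples d n. psd (Suc d * n) (block_toeplitz d n as)}"
  fix xs assume H: "length xs = d \<and> set xs \<subseteq> BB \<and> ess_matrix_range xs = ?K"
  then have len: "length xs = d" and xs: "set xs \<subseteq> BB" and ess: "ess_matrix_range xs = ?K" by auto
  have xBB: "xs ! l \<in> BB" if "l < d" for l using xs len that nth_mem by blast
  have "ess_nonneg d (\<lambda>l. xs ! l)"
    by (rule ess_matrix_range_imp_ess_nonneg[OF xs len]) (use ess in simp)
  then obtain k where k: "\<And>l. l < d \<Longrightarrow> k l \<in> KK" and pos: "\<And>v. 0 \<le> tform d (\<lambda>l. xs ! l + k l) v"
    using ess_nonneg_imp_compact_perturbation[of d "\<lambda>l. xs ! l"] xBB by blast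
  define ks where "ks = map k [0..<d]"
  define ys where "ys = map2 (+) xs ks"
  have ysl: "ys ! l = xs ! l + k l" if "l < d" for l unfolding ys_def ks_def using that len by simp
  have lenys: "length ys = d" unfolding ys_def ks_def using len by simp
  have ys: "set ys \<subseteq> BB"
  proof
    fix a assume "a \<in> set ys"
    then obtain l where "l < d" "a = ys ! l" using lenys by (metis in_set_conv_nth)
    then show "a \<in> BB" using ysl xBB KK_BB[OF k] BB_closed_intros(3) by simp
  qed
  have posy: "0 \<le> tform d (\<lambda>l. ys ! l) v" for v
    using pos[of v] tform_cong[of d "\<lambda>l. ys ! l" "\<lambda>l. xs ! l + k l" v] ysl by simp
  have state: "\<exists>\<psi>. ucp BB 1 \<psi> \<and> (\<forall>l<d. \<psi> (xs ! l + k l) $$ (0, 0) = z ^ Suc l)" if z: "cmod z = 1" for z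
    by (rule circle_state[OF xs len k pos z]) (use ess circle_point_psd_block_toeplitz[OF z] in auto)
  \<comment> \<open>The weights of a given tuple are kept, and each node is replaced by a state that
    takes the perturbed tuple to the corresponding point of the curve.\<close>
  have "?K \<subseteq> matrix_range ys"
  proof
    fix q assume q: "q \<in> ?K"
    obtain n as where q_eq: "q = (n, as)" by (cases q)
    have n: "n \<in> {1..}" and as: "as \<in> mat_tuples d n" and psd: "psd (Suc d * n) (block_toeplitz d n as)"
      using q unfolding q_eq by auto
    define N where "N = Suc d * n"
    obtain z y where z: "\<And>j. j < N \<Longrightarrow> cmod (z j) = 1"
      and y1: "\<And>r s. r < n \<Longrightarrow> s < n \<Longrightarrow> (\<Sum>j<N. cnj (y j r) * y j s) = (if r = s then 1 else 0)"
      and asl: "\<And>l r s. l < d \<Longrightarrow> r < n \<Longrightarrow> s < n \<Longrightarrow>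
        (as ! l) $$ (r, s) = (\<Sum>j<N. z j ^ Suc l * (cnj (y j r) * y j s))"
      using block_toeplitz_moments[OF psd as, folded N_def] by blast
    have "\<forall>t. \<exists>\<psi>. t < N \<longrightarrow> ucp BB 1 \<psi> \<and> (\<forall>l<d. \<psi> (xs ! l + k l) $$ (0, 0) = z t ^ Suc l)"
      using state z by blast
    from choice[OF this] obtain \<psi> where \<psi>: "\<forall>t. t < N \<longrightarrow> ucp BB 1 (\<psi> t) \<and> (\<forall>l<d. \<psi> t (xs ! l + k l) $$ (0, 0) = z t ^ Suc l)"
      by (elim exE)
    define \<phi> where "\<phi> = (\<lambda>a. mat n n (\<lambda>(r, s). \<Sum>t<N. \<psi> t a $$ (0, 0) * (cnj (y t r) * y t s)))"
    have "ucp BB n \<phi>" unfolding \<phi>_def by (rule ucp_combination) (use \<psi> y1 in auto)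
    then have ucp: "ucp (cstar (op_system ys)) n \<phi>" by (rule ucp_mono[OF _ cstar_op_system_subset_BB[OF ys]])
    have "as = map \<phi> ys"
    proof (rule nth_equalityI)
      show "length as = length (map \<phi> ys)" using as lenys unfolding mat_tuples_def by simp
      fix l assume "l < length as"
      then have l: "l < d" using as unfolding mat_tuples_def by simp
      have "as ! l = \<phi> (ys ! l)"
        unfolding \<phi>_def ysl[OF l] using mat_tuples_nth[OF as l] \<psi> l by (intro eq_matI) (auto simp: asl)
      then show "as ! l = map \<phi> ys ! l" using l lenys by simp
    qed
    then show "q \<in> matrix_range ys"
      unfolding q_eq matrix_range_def using n ucp by blast
  qed
  moreover have "matrix_range ys \<subseteq> ?K" by (rule matrix_range_subset[OF ys lenys posy])
  ultimately have "ess_matrix_range xs = matrix_range (map2 (+) xs ks)" unfolding ess ys_def by blast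
  moreover have "length ks = length xs" "set ks \<subseteq> KK" unfolding ks_def using len k by auto
  ultimately show "smith_ward_property xs" unfolding smith_ward_property_def by blast
qed

text \<open>The first conjunct certifies that the set is of the kind for which Smith-Ward geometry
  is meant, a compact matrix convex set.\<close>

theorem theorem3p8:
  fixes d :: nat
  shows "compact_matrix_convex d (min_matrix_convex d (conv_tuples d (circle_curve d)))
    \<and> smith_ward_geometry d (min_matrix_convex d (conv_tuples d (circle_curve d)))
    \<and> min_matrix_convex d (conv_tuples d (circle_curve d)) =
        (SIGMA n:{1..}. {as \<in> mat_tuples d n. psd (Suc d * n) (block_toeplitz d n as)})"
  using compact_matrix_convex_min_circle smith_ward_geometry_min_circle min_circle_eq_psd_block_toeplitz by blast

end
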